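(* For any complete first-order theory $T$ and any $k<\omega$, the following are equivalent: (1) $T$ satisfies $(k,\ \text{bi-invariant or semi-reliably invariant},\ \text{bi-invariant or semi-reliably invariant})$--Kim's lemma; (2) $T$ satisfies $(k,\ \text{bi-invariant},\ \text{bi-invariant})$--Kim's lemma; (3) $T$ satisfies $(k,\ \text{heir-coheir},\ \text{heir-coheir})$--Kim's lemma over models; (4) $T$ does not have a $(k,1,1)$-weave of depth $\omega$; (5) $T$ does not have a strong $(k,1,1)$-weave of depth $\omega$.
   Context: Work in a monster model $\mathbb M$ of $T$; parameter sets $A$ are small. A global type is $A$-invariant if fixed by automorphisms fixing $A$. A Morley sequence in $p$ over $A$ is $(b_i)_{i<\omega}$ with $b_i\models p|_{Ab_{<i}}$. For $p\supseteq\mathrm{tp}(b/A)$, $\varphi(x,b)$ $k$-divides along $p$ if $\{\varphi(x,b_i)\}$ is $k$-inconsistent for a Morley sequence in $p$ over $A$, and divides along $p$ if it is inconsistent. $c\mathop{\smile\!\!\!\!\!\mid}^i_A b$ means $\mathrm{tp}(c/Ab)$ extends to a global $A$-invariant type. $p$ is $A$-bi-invariant if $b\models p|_{Ac}$ implies $c\mathop{\smile\!\!\!\!\!\mid}^i_A b$. For a model $M$, $p$ is an $M$-coheir if finitely satisfiable in $M$, and an $M$-heir-coheir if it is an $M$-coheir and $b\models p|_{Mc}$ implies $\mathrm{tp}(c/Mb)$ is finitely satisfiable in $M$. An invariant sequence over $A$ is $(b_i:i<n)$ with $b_i\equiv_A b_j$ and $b_i\mathop{\smile\!\!\!\!\!\mid}^i_A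 b_{<i}$. $p$ is semi-reliably $A$-invariant if it belongs to the largest class $\mathcal R$ of global $A$-invariant types (in arbitrary variable tuples) such that for $p(x_0)\in\mathcal R$ and any $q(x_0,\dots,x_{n-1})\in S(A)$ extending $(p|_A)(x_0)$ which is the type of an invariant sequence over $A$, some $r\in\mathcal R$ extends $p(x_0)\cup\dots\cup p(x_{n-1})\cup q$. $T$ satisfies $(k,\mathcal X,\mathcal Y)$--Kim's lemma (classes of pairs $(A,p)$) if for all $A$, $\varphi(x,b)$, $p,q\supseteq\mathrm{tp}(b/A)$ with $(A,p)\in\mathcal X,(A,q)\in\mathcal Y$: $\varphi(x,b)$ $k$-dividing along $p$ implies dividing along $q$; "over models" means $A$ ranges only over models. Weaves: $2^2=\{0,1\}^2$, $(2^2)^\omega$ functions $\omega\to2^2$, $(2^2)^{<\omega}$ finite sequences, $\tau^\frown a$ concatenation. For $A,B\subseteq(2^2)^\omega$: narrowly below: some $\tau$, $i<2$, $A$'s elements extend $\tau^\frown(i,0)$, $B$'s extend $\tau^\frown(i,1)$; narrowly to the left: some $\tau$, $j<2$, $A$'s extend $\tau^\frown(0,j)$, $B$'s extend $\tau^\frown(1,j)$; widely to the left: some $\sigma$ with $A$'s extending $\sigma^\frown(0,0)$ or $\sigma^\frown(0,1)$ and $B$'s extending $\sigma^\frown(1,0)$ or $\sigma^\frown(1,1)$. Finite up-$1$-combs: smallest class of finite sets containing singletons and containing $A\cup B$ whenever $A,B$ are in it, $|A|\le1$, $A$ narrowly below $B$; finite right-$1$-combs likewise with narrowly left; finite wide right-$1$-combs: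 smallest class containing singletons and containing $A\cup B$ whenever $A,B$ are finite right-$1$-combs, $|A|\le1$ and $A$ widely left of $B$. A $(k,1,1)$-weave of depth $\omega$ is a formula $\varphi(x,y)$ and $(b_\sigma:\sigma\in(2^2)^\omega)$ with $\{\varphi(x,b_\sigma):\sigma\in C\}$ $k$-inconsistent for finite up-$1$-combs $C$ and consistent for finite right-$1$-combs $C$; it is strong if moreover consistent for finite wide right-$1$-combs $C$. *)

theory Defs
  imports Main "HOL-Library.Equipollence"
begin

section \<open>First-order syntax (de Bruijn variables, parameters as constants)\<close>

datatype ('f, 'a) trm = Var nat | Par 'a | App 'f "('f, 'a) trm list"

datatype ('f, 'r, 'a) fm =
    FF
  | Eq "('f, 'a) trm" "('f, 'a) trm"
  | Rel 'r "('f, 'a) trm list"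
  | Neg "('f, 'r, 'a) fm"
  | Conj "('f, 'r, 'a) fm" "('f, 'r, 'a) fm"
  | Ex "('f, 'r, 'a) fm"   \<comment> \<open>binds de Bruijn index 0\<close>

text \<open>A structure carries its (many-sorted-free) signature: arities of function and
  relation symbols.  The language is all of the symbol types 'f and 'r.\<close>

record ('f, 'r, 'a) struc =
  arF :: "'f \<Rightarrow> nat"
  arR :: "'r \<Rightarrow> nat"
  dom :: "'a set"
  fnc :: "'f \<Rightarrow> 'a list \<Rightarrow> 'a"
  rel :: "'r \<Rightarrow> 'a list \<Rightarrow> bool"

fun wf_t :: "('f, 'r, 'a, 'z) struc_scheme \<Rightarrow> ('f, 'a) trm \<Rightarrow> bool" where
  "wf_t M (Var i) = True"
| "wf_t M (Par a) = True"
| "wf_t M (App f ts) = (length ts = arF M f \<and> (\<forall>t\<in>set ts. wf_t M t))"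

fun wf :: "('f, 'r, 'a, 'z) struc_scheme \<Rightarrow> ('f, 'r, 'a) fm \<Rightarrow> bool" where
  "wf M FF = True"
| "wf M (Eq s t) = (wf_t M s \<and> wf_t M t)"
| "wf M (Rel R ts) = (length ts = arR M R \<and> (\<forall>t\<in>set ts. wf_t M t))"
| "wf M (Neg \<phi>) = wf M \<phi>"
| "wf M (Conj \<phi> \<psi>) = (wf M \<phi> \<and> wf M \<psi>)"
| "wf M (Ex \<phi>) = wf M \<phi>"

fun params_t :: "('f, 'a) trm \<Rightarrow> 'a set" where
  "params_t (Var i) = {}"
| "params_t (Par a) = {a}"
| "params_t (App f ts) = (\<Union>t\<in>set ts. params_t t)"

fun params :: "('f, 'r, 'a) fm \<Rightarrow> 'a set" where
  "params FF = {}"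
| "params (Eq s t) = params_t s \<union> params_t t"
| "params (Rel R ts) = (\<Union>t\<in>set ts. params_t t)"
| "params (Neg \<phi>) = params \<phi>"
| "params (Conj \<phi> \<psi>) = params \<phi> \<union> params \<psi>"
| "params (Ex \<phi>) = params \<phi>"

fun pmap_t :: "('a \<Rightarrow> 'a) \<Rightarrow> ('f, 'a) trm \<Rightarrow> ('f, 'a) trm" where
  "pmap_t g (Var i) = Var i"
| "pmap_t g (Par a) = Par (g a)"
| "pmap_t g (App f ts) = App f (map (pmap_t g) ts)"

fun pmap :: "('a \<Rightarrow> 'a) \<Rightarrow> ('f, 'r, 'a) fm \<Rightarrow> ('f, 'r, 'a) fm" where
  "pmap g FF = FF"
| "pmap g (Eq s t) = Eq (pmap_t g s) (pmap_t g t)"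
| "pmap g (Rel R ts) = Rel R (map (pmap_t g) ts)"
| "pmap g (Neg \<phi>) = Neg (pmap g \<phi>)"
| "pmap g (Conj \<phi> \<psi>) = Conj (pmap g \<phi>) (pmap g \<psi>)"
| "pmap g (Ex \<phi>) = Ex (pmap g \<phi>)"

fun fv_t :: "nat \<Rightarrow> ('f, 'a) trm \<Rightarrow> nat set" where
  "fv_t d (Var i) = (if i < d then {} else {i - d})"
| "fv_t d (Par a) = {}"
| "fv_t d (App f ts) = (\<Union>t\<in>set ts. fv_t d t)"

fun fv_d :: "nat \<Rightarrow> ('f, 'r, 'a) fm \<Rightarrow> nat set" where
  "fv_d d FF = {}"
| "fv_d d (Eq s t) = fv_t d s \<union> fv_t d t"
| "fv_d d (Rel R ts) = (\<Union>t\<in>set ts. fv_t d t)"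
| "fv_d d (Neg \<phi>) = fv_d d \<phi>"
| "fv_d d (Conj \<phi> \<psi>) = fv_d d \<phi> \<union> fv_d d \<psi>"
| "fv_d d (Ex \<phi>) = fv_d (Suc d) \<phi>"

definition fv :: "('f, 'r, 'a) fm \<Rightarrow> nat set" where
  "fv \<phi> = fv_d 0 \<phi>"

fun shift_t :: "nat \<Rightarrow> nat \<Rightarrow> ('f, 'a) trm \<Rightarrow> ('f, 'a) trm" where
  "shift_t d k (Var i) = (if i < d then Var i else Var (i + k))"
| "shift_t d k (Par a) = Par a"
| "shift_t d k (App f ts) = App f (map (shift_t d k) ts)"

fun shift_d :: "nat \<Rightarrow> nat \<Rightarrow> ('f, 'r, 'a) fm \<Rightarrow> ('f, 'r, 'a) fm" where
  "shift_d d k FF = FF"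
| "shift_d d k (Eq s t) = Eq (shift_t d k s) (shift_t d k t)"
| "shift_d d k (Rel R ts) = Rel R (map (shift_t d k) ts)"
| "shift_d d k (Neg \<phi>) = Neg (shift_d d k \<phi>)"
| "shift_d d k (Conj \<phi> \<psi>) = Conj (shift_d d k \<phi>) (shift_d d k \<psi>)"
| "shift_d d k (Ex \<phi>) = Ex (shift_d (Suc d) k \<phi>)"

definition shift :: "nat \<Rightarrow> ('f, 'r, 'a) fm \<Rightarrow> ('f, 'r, 'a) fm" where
  "shift k \<phi> = shift_d 0 k \<phi>"

fun evalt :: "('f, 'r, 'a, 'z) struc_scheme \<Rightarrow> (nat \<Rightarrow> 'a) \<Rightarrow> ('f, 'a) trm \<Rightarrow> 'a" where
  "evalt M e (Var i) = e i"
| "evalt M e (Par a) = a"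
| "evalt M e (App f ts) = fnc M f (map (evalt M e) ts)"

fun sat :: "('f, 'r, 'a, 'z) struc_scheme \<Rightarrow> (nat \<Rightarrow> 'a) \<Rightarrow> ('f, 'r, 'a) fm \<Rightarrow> bool" where
  "sat M e FF = False"
| "sat M e (Eq s t) = (evalt M e s = evalt M e t)"
| "sat M e (Rel R ts) = rel M R (map (evalt M e) ts)"
| "sat M e (Neg \<phi>) = (\<not> sat M e \<phi>)"
| "sat M e (Conj \<phi> \<psi>) = (sat M e \<phi> \<and> sat M e \<psi>)"
| "sat M e (Ex \<phi>) = (\<exists>a\<in>dom M. sat M (case_nat a e) \<phi>)"

definition holds :: "('f, 'r, 'a, 'z) struc_scheme \<Rightarrow> ('f, 'r, 'a) fm \<Rightarrow> 'a list \<Rightarrow> bool" where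
  "holds M \<phi> xs = sat M (\<lambda>i. if i < length xs then xs ! i else (SOME a. a \<in> dom M)) \<phi>"

definition sentence :: "('f, 'r, 'a, 'z) struc_scheme \<Rightarrow> ('f, 'r, 'a) fm \<Rightarrow> bool" where
  "sentence M \<phi> \<longleftrightarrow> wf M \<phi> \<and> fv \<phi> = {}"

definition fml :: "('f, 'r, 'a, 'z) struc_scheme \<Rightarrow> 'a set \<Rightarrow> nat \<Rightarrow> ('f, 'r, 'a) fm \<Rightarrow> bool" where
  "fml M B n \<phi> \<longleftrightarrow> wf M \<phi> \<and> fv \<phi> \<subseteq> {..<n} \<and> params \<phi> \<subseteq> B"

definition is_struc :: "('f, 'r, 'a, 'z) struc_scheme \<Rightarrow> bool" where
  "is_struc M \<longleftrightarrow> dom M \<noteq> {} \<and>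
     (\<forall>f as. set as \<subseteq> dom M \<and> length as = arF M f \<longrightarrow> fnc M f as \<in> dom M)"

definition complete_theory :: "('f, 'r, 'a, 'z) struc_scheme \<Rightarrow> ('f, 'r, 'a) fm set \<Rightarrow> bool" where
  "complete_theory M T \<longleftrightarrow>
     (\<forall>\<phi>\<in>T. sentence M \<phi> \<and> params \<phi> = {}) \<and>
     (\<forall>\<phi>. sentence M \<phi> \<and> params \<phi> = {} \<longrightarrow> \<phi> \<in> T \<or> Neg \<phi> \<in> T)"

definition models :: "('f, 'r, 'a, 'z) struc_scheme \<Rightarrow> ('f, 'r, 'a) fm set \<Rightarrow> bool" where
  "models M T \<longleftrightarrow> (\<forall>\<phi>\<in>T. \<forall>e. sat M e \<phi>)"

definition realizes :: "('f, 'r, 'a, 'z) struc_scheme \<Rightarrow> nat \<Rightarrow> 'a list \<Rightarrow> ('f, 'r, 'a) fm set \<Rightarrow> bool" where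
  "realizes M n b \<Sigma> \<longleftrightarrow> length b = n \<and> set b \<subseteq> dom M \<and> (\<forall>\<phi>\<in>\<Sigma>. holds M \<phi> b)"

definition finsat :: "('f, 'r, 'a, 'z) struc_scheme \<Rightarrow> nat \<Rightarrow> ('f, 'r, 'a) fm set \<Rightarrow> bool" where
  "finsat M n \<Sigma> \<longleftrightarrow> (\<forall>\<Sigma>0\<subseteq>\<Sigma>. finite \<Sigma>0 \<longrightarrow> (\<exists>b. realizes M n b \<Sigma>0))"

definition tp :: "('f, 'r, 'a, 'z) struc_scheme \<Rightarrow> 'a set \<Rightarrow> 'a list \<Rightarrow> ('f, 'r, 'a) fm set" where
  "tp M B b = {\<phi>. fml M B (length b) \<phi> \<and> holds M \<phi> b}"

definition gtype :: "('f, 'r, 'a, 'z) struc_scheme \<Rightarrow> nat \<Rightarrow> ('f, 'r, 'a) fm set \<Rightarrow> bool" where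
  "gtype M n p \<longleftrightarrow> p \<subseteq> {\<phi>. fml M (dom M) n \<phi>} \<and>
     (\<forall>\<phi>. fml M (dom M) n \<phi> \<longrightarrow> \<phi> \<in> p \<or> Neg \<phi> \<in> p) \<and> finsat M n p"

definition restr :: "('f, 'r, 'a) fm set \<Rightarrow> 'a set \<Rightarrow> ('f, 'r, 'a) fm set" where
  "restr p B = {\<phi>\<in>p. params \<phi> \<subseteq> B}"

definition aut :: "('f, 'r, 'a, 'z) struc_scheme \<Rightarrow> ('a \<Rightarrow> 'a) \<Rightarrow> bool" where
  "aut M \<sigma> \<longleftrightarrow> bij_betw \<sigma> (dom M) (dom M) \<and>
     (\<forall>f as. set as \<subseteq> dom M \<and> length as = arF M f \<longrightarrow> \<sigma> (fnc M f as) = fnc M f (map \<sigma> as)) \<and>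
     (\<forall>R as. set as \<subseteq> dom M \<and> length as = arR M R \<longrightarrow> (rel M R (map \<sigma> as) \<longleftrightarrow> rel M R as))"

definition elementary_map :: "('f, 'r, 'a, 'z) struc_scheme \<Rightarrow> 'a set \<Rightarrow> ('a \<Rightarrow> 'a) \<Rightarrow> bool" where
  "elementary_map M A g \<longleftrightarrow> A \<subseteq> dom M \<and> g ` A \<subseteq> dom M \<and>
     (\<forall>\<phi> e. sentence M \<phi> \<and> params \<phi> \<subseteq> A \<longrightarrow> (sat M e \<phi> \<longleftrightarrow> sat M e (pmap g \<phi>)))"

text \<open>M is a monster model of the complete theory T: kappa-saturated and strongly
  kappa-homogeneous, where kappa = |K| is an uncountable strong limit cardinal exceeding the
  size of the language.  "Small" means of cardinality < kappa.\<close>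

definition small :: "'a set \<Rightarrow> 'b set \<Rightarrow> bool" where
  "small K A \<longleftrightarrow> A \<prec> K"

definition monster :: "('f, 'r, 'a) fm set \<Rightarrow> ('f, 'r, 'a) struc \<Rightarrow> 'a set \<Rightarrow> bool" where
  "monster T M K \<longleftrightarrow>
     is_struc M \<and> complete_theory M T \<and> models M T \<and>
     (UNIV :: nat set) \<prec> K \<and> (UNIV :: 'f set) \<prec> K \<and> (UNIV :: 'r set) \<prec> K \<and>
     (\<forall>X :: 'a set. X \<prec> K \<longrightarrow> Pow X \<prec> K) \<and>
     (\<forall>A \<Sigma>. A \<subseteq> dom M \<and> small K A \<and> (\<forall>\<phi>\<in>\<Sigma>. fml M A 1 \<phi>) \<and> finsat M 1 \<Sigma>
        \<longrightarrow> (\<exists>b. realizes M 1 b \<Sigma>)) \<and>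
     (\<forall>A g. small K A \<and> elementary_map M A g \<longrightarrow> (\<exists>\<sigma>. aut M \<sigma> \<and> (\<forall>a\<in>A. \<sigma> a = g a)))"

definition is_model :: "('f, 'r, 'a) struc \<Rightarrow> 'a set \<Rightarrow> 'a set \<Rightarrow> bool" where
  "is_model M K A \<longleftrightarrow> A \<subseteq> dom M \<and> small K A \<and> is_struc (M\<lparr>dom := A\<rparr>) \<and>
     (\<forall>\<phi> e. sentence M \<phi> \<and> params \<phi> \<subseteq> A \<longrightarrow> (sat (M\<lparr>dom := A\<rparr>) e \<phi> \<longleftrightarrow> sat M e \<phi>))"

definition invariant :: "('f, 'r, 'a, 'z) struc_scheme \<Rightarrow> 'a set \<Rightarrow> nat \<Rightarrow> ('f, 'r, 'a) fm set \<Rightarrow> bool" where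
  "invariant M A n p \<longleftrightarrow> gtype M n p \<and>
     (\<forall>\<sigma>. aut M \<sigma> \<and> (\<forall>a\<in>A. \<sigma> a = a) \<longrightarrow> pmap \<sigma> ` p = p)"

definition indep_i :: "('f, 'r, 'a, 'z) struc_scheme \<Rightarrow> 'a set \<Rightarrow> 'a list \<Rightarrow> 'a list \<Rightarrow> bool" where
  "indep_i M A c b \<longleftrightarrow> (\<exists>q. invariant M A (length c) q \<and> tp M (A \<union> set b) c \<subseteq> q)"

definition bi_invariant :: "('f, 'r, 'a, 'z) struc_scheme \<Rightarrow> 'a set \<Rightarrow> nat \<Rightarrow> ('f, 'r, 'a) fm set \<Rightarrow> bool" where
  "bi_invariant M A n p \<longleftrightarrow> invariant M A n p \<and>
     (\<forall>b c. set c \<subseteq> dom M \<and> realizes M n b (restr p (A \<union> set c)) \<longrightarrow> indep_i M A c b)"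

definition coheir :: "('f, 'r, 'a, 'z) struc_scheme \<Rightarrow> 'a set \<Rightarrow> nat \<Rightarrow> ('f, 'r, 'a) fm set \<Rightarrow> bool" where
  "coheir M A n p \<longleftrightarrow> gtype M n p \<and>
     (\<forall>\<phi>\<in>p. \<exists>xs. length xs = n \<and> set xs \<subseteq> A \<and> holds M \<phi> xs)"

definition heir_coheir :: "('f, 'r, 'a, 'z) struc_scheme \<Rightarrow> 'a set \<Rightarrow> nat \<Rightarrow> ('f, 'r, 'a) fm set \<Rightarrow> bool" where
  "heir_coheir M A n p \<longleftrightarrow> coheir M A n p \<and>
     (\<forall>b c. set c \<subseteq> dom M \<and> realizes M n b (restr p (A \<union> set c)) \<longrightarrow>
        (\<forall>\<phi>\<in>tp M (A \<union> set b) c. \<exists>xs. length xs = length c \<and> set xs \<subseteq> A \<and> holds M \<phi> xs))"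

definition invseq :: "('f, 'r, 'a, 'z) struc_scheme \<Rightarrow> 'a set \<Rightarrow> nat \<Rightarrow> (nat \<Rightarrow> 'a list) \<Rightarrow> nat \<Rightarrow> bool" where
  "invseq M A m c n \<longleftrightarrow>
     (\<forall>i<n. length (c i) = m \<and> set (c i) \<subseteq> dom M) \<and>
     (\<forall>i<n. \<forall>j<n. tp M A (c i) = tp M A (c j)) \<and>
     (\<forall>i<n. indep_i M A (c i) (concat (map c [0..<i])))"

text \<open>Closure condition defining semi-reliable invariance; the class is the largest closed one.
  Elements of a class are pairs (number of variables, global type).\<close>
definition sri_closed :: "('f, 'r, 'a, 'z) struc_scheme \<Rightarrow> 'a set \<Rightarrow> (nat \<times> ('f, 'r, 'a) fm set) set \<Rightarrow> bool" where
  "sri_closed M A R \<longleftrightarrow> (\<forall>(m, p)\<in>R. invariant M A m p \<and>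
     (\<forall>n c. 1 \<le> n \<and> invseq M A m c n \<and> realizes M m (c 0) (restr p A) \<longrightarrow>
        (\<exists>r. (n * m, r) \<in> R \<and>
             {shift (i * m) \<phi> | \<phi> i. \<phi> \<in> p \<and> i < n} \<subseteq> r \<and>
             tp M A (concat (map c [0..<n])) \<subseteq> r)))"

definition semi_reliable :: "('f, 'r, 'a, 'z) struc_scheme \<Rightarrow> 'a set \<Rightarrow> nat \<Rightarrow> ('f, 'r, 'a) fm set \<Rightarrow> bool" where
  "semi_reliable M A n p \<longleftrightarrow> (n, p) \<in> \<Union>{R. sri_closed M A R}"

definition fam_sat :: "('f, 'r, 'a, 'z) struc_scheme \<Rightarrow> nat \<Rightarrow> ('f, 'r, 'a) fm \<Rightarrow> ('i \<Rightarrow> 'a list) \<Rightarrow> 'i set \<Rightarrow> bool" where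
  "fam_sat M m \<phi> bs I \<longleftrightarrow> (\<exists>xs. length xs = m \<and> set xs \<subseteq> dom M \<and> (\<forall>i\<in>I. holds M \<phi> (xs @ bs i)))"

definition fam_consistent :: "('f, 'r, 'a, 'z) struc_scheme \<Rightarrow> nat \<Rightarrow> ('f, 'r, 'a) fm \<Rightarrow> ('i \<Rightarrow> 'a list) \<Rightarrow> 'i set \<Rightarrow> bool" where
  "fam_consistent M m \<phi> bs I \<longleftrightarrow> (\<forall>J\<subseteq>I. finite J \<longrightarrow> fam_sat M m \<phi> bs J)"

definition fam_k_inconsistent :: "('f, 'r, 'a, 'z) struc_scheme \<Rightarrow> nat \<Rightarrow> ('f, 'r, 'a) fm \<Rightarrow> ('i \<Rightarrow> 'a list) \<Rightarrow> 'i set \<Rightarrow> nat \<Rightarrow> bool" where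
  "fam_k_inconsistent M m \<phi> bs I k \<longleftrightarrow> (\<forall>J\<subseteq>I. finite J \<and> card J = k \<longrightarrow> \<not> fam_sat M m \<phi> bs J)"

definition morley :: "('f, 'r, 'a, 'z) struc_scheme \<Rightarrow> 'a set \<Rightarrow> nat \<Rightarrow> ('f, 'r, 'a) fm set \<Rightarrow> (nat \<Rightarrow> 'a list) \<Rightarrow> bool" where
  "morley M A n p bs \<longleftrightarrow> (\<forall>i. realizes M n (bs i) (restr p (A \<union> (\<Union>j<i. set (bs j)))))"

definition k_divides_along where
  "k_divides_along M A m \<phi> n p k \<longleftrightarrow>
     (\<exists>bs. morley M A n p bs \<and> fam_k_inconsistent M m \<phi> bs UNIV k)"

definition divides_along where
  "divides_along M A m \<phi> n p \<longleftrightarrow>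
     (\<exists>bs. morley M A n p bs \<and> \<not> fam_consistent M m \<phi> bs UNIV)"

text \<open>(k, X, Y)-Kim's lemma; parameter sets A range over small sets (or over small
  models if onlyM).  phi(x, y) is an L(A)-formula, x = x_0..x_(m-1), y = x_m..x_(m+n-1).\<close>
definition kims_lemma ::
  "('f, 'r, 'a) struc \<Rightarrow> 'a set \<Rightarrow> bool \<Rightarrow> nat \<Rightarrow>
   ('a set \<Rightarrow> nat \<Rightarrow> ('f, 'r, 'a) fm set \<Rightarrow> bool) \<Rightarrow>
   ('a set \<Rightarrow> nat \<Rightarrow> ('f, 'r, 'a) fm set \<Rightarrow> bool) \<Rightarrow> bool" where
  "kims_lemma M K onlyM k X Y \<longleftrightarrow>
     (\<forall>A m n \<phi> b p q.
        A \<subseteq> dom M \<and> small K A \<and> (onlyM \<longrightarrow> is_model M K A) \<and>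
        fml M A (m + n) \<phi> \<and> length b = n \<and> set b \<subseteq> dom M \<and>
        gtype M n p \<and> gtype M n q \<and> tp M A b \<subseteq> p \<and> tp M A b \<subseteq> q \<and>
        X A n p \<and> Y A n q \<and> k_divides_along M A m \<phi> n p k
        \<longrightarrow> divides_along M A m \<phi> n q)"

type_synonym path = "nat \<Rightarrow> bool \<times> bool"

definition extends :: "path \<Rightarrow> (bool \<times> bool) list \<Rightarrow> bool" where
  "extends \<sigma> \<tau> \<longleftrightarrow> (\<forall>j<length \<tau>. \<sigma> j = \<tau> ! j)"

definition narrowly_below :: "path set \<Rightarrow> path set \<Rightarrow> bool" where
  "narrowly_below A B \<longleftrightarrow> (\<exists>\<tau> i. (\<forall>\<sigma>\<in>A. extends \<sigma> (\<tau> @ [(i, False)])) \<and>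
                                   (\<forall>\<sigma>\<in>B. extends \<sigma> (\<tau> @ [(i, True)])))"

definition narrowly_left :: "path set \<Rightarrow> path set \<Rightarrow> bool" where
  "narrowly_left A B \<longleftrightarrow> (\<exists>\<tau> j. (\<forall>\<sigma>\<in>A. extends \<sigma> (\<tau> @ [(False, j)])) \<and>
                                  (\<forall>\<sigma>\<in>B. extends \<sigma> (\<tau> @ [(True, j)])))"

definition widely_left :: "path set \<Rightarrow> path set \<Rightarrow> bool" where
  "widely_left A B \<longleftrightarrow> (\<exists>\<tau>.
     (\<forall>\<sigma>\<in>A. extends \<sigma> (\<tau> @ [(False, False)]) \<or> extends \<sigma> (\<tau> @ [(False, True)])) \<and>
     (\<forall>\<sigma>\<in>B. extends \<sigma> (\<tau> @ [(True, False)]) \<or> extends \<sigma> (\<tau> @ [(True, True)])))"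

inductive up_comb :: "path set \<Rightarrow> bool" where
  single: "up_comb {\<sigma>}"
| join: "up_comb A \<Longrightarrow> up_comb B \<Longrightarrow> card A \<le> 1 \<Longrightarrow> narrowly_below A B \<Longrightarrow> up_comb (A \<union> B)"

inductive right_comb :: "path set \<Rightarrow> bool" where
  single: "right_comb {\<sigma>}"
| join: "right_comb A \<Longrightarrow> right_comb B \<Longrightarrow> card A \<le> 1 \<Longrightarrow> narrowly_left A B \<Longrightarrow> right_comb (A \<union> B)"

inductive wide_right_comb :: "path set \<Rightarrow> bool" where
  single: "wide_right_comb {\<sigma>}"
| join: "right_comb A \<Longrightarrow> right_comb B \<Longrightarrow> card A \<le> 1 \<Longrightarrow> widely_left A B \<Longrightarrow> wide_right_comb (A \<union> B)"

definition has_weave :: "('f, 'r, 'a) struc \<Rightarrow> nat \<Rightarrow> bool \<Rightarrow> bool" where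
  "has_weave M k strong \<longleftrightarrow> (\<exists>m n \<phi> (bs :: path \<Rightarrow> 'a list).
     fml M {} (m + n) \<phi> \<and> (\<forall>\<sigma>. length (bs \<sigma>) = n \<and> set (bs \<sigma>) \<subseteq> dom M) \<and>
     (\<forall>C. up_comb C \<longrightarrow> fam_k_inconsistent M m \<phi> bs C k) \<and>
     (\<forall>C. right_comb C \<longrightarrow> fam_consistent M m \<phi> bs C) \<and>
     (strong \<longrightarrow> (\<forall>C. wide_right_comb C \<longrightarrow> fam_consistent M m \<phi> bs C)))"

end

theory Submission
  imports Defs
begin

text \<open>
  From a failure of Kim's lemma to a strong weave: copies of a finite weave are placed next to each
  other so that the lower copy realizes \<open>p\<close> over the upper one and the left half realizes \<open>q\<close> over the
  right half. For a semi-reliable type the definition provides the next copy. For a bi-invariant \<open>p\<close>,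
  a tuple \<open>C\<close> is independent from a realization \<open>d\<close> of \<open>p\<close> over it, and invariance transfers the type of
  \<open>d\<close> over \<open>C\<close> to every member of a copy of \<open>C\<close> through \<open>d\<close>. In both cases \<open>C\<close> and its copy form an
  invariant sequence, so that the step can be repeated for either type.

  From a weave to heir-coheirs: call a partial type large if a weave realizes it. By compactness
  largeness has finite character, and a weave restricted to a somewhere dense set of paths is again
  large. Build an increasing chain of parameter sets and large types, at each stage freezing the
  \<open>(1,0)\<close>- and \<open>(0,1)\<close>-cones of a weave of the current type and adding witnesses for the formulas that
  can have one. Limits of the frozen cones along an ultrafilter that avoids nowhere dense sets
  consist of large formulas, hence are heirs as well as coheirs over the union of the chain and
  restrict there to the same type. The Morley sequences of the two limits inherit the behaviour of
  up-combs and of right-combs, respectively.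
\<close>

section \<open>Substitution and semantics\<close>

text \<open>Saturation is given for types in one variable only, whereas a weave is a family of
  tuples indexed by continuum many paths. Compactness in arbitrarily many variables is therefore
  derived from one-variable saturation, and weaves are only ever checked on finitely many combs. Two
  further obstacles shape the proof. \<open>p\<close> is used downwards and \<open>q\<close> to the
  left on the same tuples, although each of them may be semi-reliable or bi-invariant. So the list
  of all tuples built so far stays extendable along both types, and its order follows the direction
  of the independence, which has nothing to do with the order of the paths. In the other direction a
  limit of cones is a coheir by construction, but an heir needs witnesses in the model. Maximality
  forces them: a formula \<open>\<theta>(x, c)\<close> that is still large at the next stage forces
  some \<open>\<theta>(x, c')\<close>, with \<open>c'\<close> in the model, to be true on all later
  weaves. The two frozen cones are the neighbours of \<open>(1,1)\<close>: a path starting with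
  \<open>(1,0)\<close> lies narrowly below the \<open>(1,1)\<close>-cone, one starting with
  \<open>(0,1)\<close> lies narrowly to its left.\<close>

fun atm :: "nat \<Rightarrow> nat + 'a \<Rightarrow> ('f, 'a) trm" where
  "atm d (Inl j) = Var (j + d)"
| "atm d (Inr a) = Par a"

text \<open>\<open>d\<close> is the number of binders already crossed.\<close>

fun sb_t :: "nat \<Rightarrow> (nat \<Rightarrow> nat + 'a) \<Rightarrow> ('a \<Rightarrow> nat + 'a) \<Rightarrow> ('f, 'a) trm \<Rightarrow> ('f, 'a) trm" where
  "sb_t d \<alpha> \<beta> (Var i) = (if i < d then Var i else atm d (\<alpha> (i - d)))"
| "sb_t d \<alpha> \<beta> (Par a) = atm d (\<beta> a)"
| "sb_t d \<alpha> \<beta> (App f ts) = App f (map (sb_t d \<alpha> \<beta>) ts)"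

text \<open>Variables and parameters may each become either kind. One operation thus covers
  shifting, filling in parameters, and turning parameters into variables.\<close>

fun sb :: "nat \<Rightarrow> (nat \<Rightarrow> nat + 'a) \<Rightarrow> ('a \<Rightarrow> nat + 'a) \<Rightarrow> ('f, 'r, 'a) fm \<Rightarrow> ('f, 'r, 'a) fm" where
  "sb d \<alpha> \<beta> FF = FF"
| "sb d \<alpha> \<beta> (Eq s t) = Eq (sb_t d \<alpha> \<beta> s) (sb_t d \<alpha> \<beta> t)"
| "sb d \<alpha> \<beta> (Rel R ts) = Rel R (map (sb_t d \<alpha> \<beta>) ts)"
| "sb d \<alpha> \<beta> (Neg \<phi>) = Neg (sb d \<alpha> \<beta> \<phi>)"
| "sb d \<alpha> \<beta> (Conj \<phi> \<psi>) = Conj (sb d \<alpha> \<beta> \<phi>) (sb d \<alpha> \<beta> \<psi>)"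
| "sb d \<alpha> \<beta> (Ex \<phi>) = Ex (sb (Suc d) \<alpha> \<beta> \<phi>)"

definition val :: "(nat \<Rightarrow> 'a) \<Rightarrow> nat + 'a \<Rightarrow> 'a" where
  "val e = case_sum e id"

lemma val_simps [simp]: "val e (Inl j) = e j" "val e (Inr a) = a"
  by (simp_all add: val_def)

text \<open>The environment in which the original formula has to be read. The first \<open>d\<close>
  entries belong to crossed binders and are left alone; everything else is looked up beyond
  them.\<close>

definition sbenv :: "nat \<Rightarrow> (nat \<Rightarrow> nat + 'a) \<Rightarrow> (nat \<Rightarrow> 'a) \<Rightarrow> nat \<Rightarrow> 'a" where
  "sbenv d \<alpha> e i = (if i < d then e i else val (\<lambda>j. e (j + d)) (\<alpha> (i - d)))"

lemma evalt_atm: "evalt M e (atm d x) = val (\<lambda>j. e (j + d)) x"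
  by (cases x) auto

lemma evalt_sb: "evalt M e (sb_t d \<alpha> \<beta> t)
  = evalt M (sbenv d \<alpha> e) (pmap_t (\<lambda>a. val (\<lambda>j. e (j + d)) (\<beta> a)) t)"
  by (induction t) (auto simp: evalt_atm sbenv_def o_def intro!: arg_cong[where f = "fnc M _"])

lemma sbenv_Suc: "sbenv (Suc d) \<alpha> (case_nat a e) = case_nat a (sbenv d \<alpha> e)"
  by (rule ext) (auto simp: sbenv_def split: nat.split)

text \<open>A parameter that became a variable takes whatever value the environment gives it, so on
  the right it shows up as a renaming of parameters by \<open>pmap\<close>.\<close>

lemma sat_sb_d: "sat M e (sb d \<alpha> \<beta> \<phi>)
  \<longleftrightarrow> sat M (sbenv d \<alpha> e) (pmap (\<lambda>a. val (\<lambda>j. e (j + d)) (\<beta> a)) \<phi>)"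
proof (induction \<phi> arbitrary: d e)
  case (Rel R ts)
  have "map (\<lambda>t. evalt M e (sb_t d \<alpha> \<beta> t)) ts
    = map (\<lambda>t. evalt M (sbenv d \<alpha> e) (pmap_t (\<lambda>a. val (\<lambda>j. e (j + d)) (\<beta> a)) t)) ts"
    by (simp add: evalt_sb)
  then show ?case by (simp add: o_def del: map_eq_conv)
next
  case (Ex \<phi>)
  then show ?case by (simp add: sbenv_Suc)
qed (simp_all add: evalt_sb)

lemma sat_sb: "sat M e (sb 0 \<alpha> \<beta> \<phi>) \<longleftrightarrow> sat M (\<lambda>i. val e (\<alpha> i)) (pmap (\<lambda>a. val e (\<beta> a)) \<phi>)"
proof -
  have "sbenv 0 \<alpha> e = (\<lambda>i. val e (\<alpha> i))" by (simp add: fun_eq_iff sbenv_def)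
  then show ?thesis by (simp add: sat_sb_d)
qed

lemma pmap_t_cong: "(\<And>a. a \<in> params_t t \<Longrightarrow> g a = h a) \<Longrightarrow> pmap_t g t = pmap_t h t"
  by (induction t) auto

lemma pmap_cong: "(\<And>a. a \<in> params \<phi> \<Longrightarrow> g a = h a) \<Longrightarrow> pmap g \<phi> = pmap h \<phi>"
proof (induction \<phi>)
  case (Eq s t)
  then show ?case by (auto intro: pmap_t_cong)
next
  case (Rel R ts)
  then show ?case by (auto intro: pmap_t_cong)
qed auto

lemma pmap_t_comp: "pmap_t g (pmap_t h t) = pmap_t (\<lambda>a. g (h a)) t"
  by (induction t) auto

lemma pmap_comp: "pmap g (pmap h \<phi>) = pmap (\<lambda>a. g (h a)) \<phi>"
  by (induction \<phi>) (auto simp: pmap_t_comp)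

lemma pmap_t_ident: "pmap_t (\<lambda>a. a) t = t"
  by (induction t) (auto simp: map_idI)

lemma pmap_ident: "pmap (\<lambda>a. a) \<phi> = \<phi>"
  by (induction \<phi>) (auto simp: pmap_t_ident map_idI)

lemma pmap_id_on: "(\<And>a. a \<in> params \<phi> \<Longrightarrow> g a = a) \<Longrightarrow> pmap g \<phi> = \<phi>"
  using pmap_cong[of \<phi> g "\<lambda>a. a"] by (simp add: pmap_ident)

lemma params_pmap_t: "params_t (pmap_t g t) = g ` params_t t"
  by (induction t) auto

lemma params_pmap: "params (pmap g \<phi>) = g ` params \<phi>"
  by (induction \<phi>) (auto simp: params_pmap_t image_UN)

lemma wf_pmap_t [simp]: "wf_t M (pmap_t g t) = wf_t M t"
  by (induction t) auto

lemma wf_pmap [simp]: "wf M (pmap g \<phi>) = wf M \<phi>"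
  by (induction \<phi>) auto

lemma fv_pmap_t [simp]: "fv_t d (pmap_t g t) = fv_t d t"
  by (induction t) auto

lemma fv_pmap_d: "fv_d d (pmap g \<phi>) = fv_d d \<phi>"
  by (induction \<phi> arbitrary: d) auto

lemma fv_pmap [simp]: "fv (pmap g \<phi>) = fv \<phi>"
  by (simp add: fv_def fv_pmap_d)

text \<open>The usual case: each parameter stays or becomes a variable whose value is that very
  parameter, so that the renaming in \<open>sat_sb\<close> disappears.\<close>

lemma sat_sb_id:
  assumes "\<And>a. a \<in> params \<phi> \<Longrightarrow> val e (\<beta> a) = a"
  shows "sat M e (sb 0 \<alpha> \<beta> \<phi>) \<longleftrightarrow> sat M (\<lambda>i. val e (\<alpha> i)) \<phi>"
  using assms by (simp add: sat_sb pmap_id_on)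

lemma wf_atm [simp]: "wf_t M (atm d x)"
  by (cases x) auto

lemma wf_sb_t [simp]: "wf_t M (sb_t d \<alpha> \<beta> t) = wf_t M t"
  by (induction t) auto

lemma wf_sb [simp]: "wf M (sb d \<alpha> \<beta> \<phi>) = wf M \<phi>"
  by (induction \<phi> arbitrary: d) auto

lemma fv_atm: "fv_t d (atm d x) = {j. x = Inl j}"
  by (cases x) auto

lemma params_atm: "params_t (atm d x) = {a. x = Inr a}"
  by (cases x) auto

lemma fv_sb_t: "fv_t d (sb_t d \<alpha> \<beta> t)
  \<subseteq> {j. \<exists>i\<in>fv_t d t. \<alpha> i = Inl j} \<union> {j. \<exists>a\<in>params_t t. \<beta> a = Inl j}"
  by (induction t) (fastforce simp: fv_atm)+

lemma fv_sb_d: "fv_d d (sb d \<alpha> \<beta> \<phi>)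
  \<subseteq> {j. \<exists>i\<in>fv_d d \<phi>. \<alpha> i = Inl j} \<union> {j. \<exists>a\<in>params \<phi>. \<beta> a = Inl j}"
proof (induction \<phi> arbitrary: d)
  case (Eq s t)
  then show ?case using fv_sb_t[of d \<alpha> \<beta> s] fv_sb_t[of d \<alpha> \<beta> t] by fastforce
next
  case (Rel R ts)
  then show ?case using fv_sb_t[of d \<alpha> \<beta>] by fastforce
qed fastforce+

lemma params_sb_t: "params_t (sb_t d \<alpha> \<beta> t)
  \<subseteq> {c. \<exists>i\<in>fv_t d t. \<alpha> i = Inr c} \<union> {c. \<exists>a\<in>params_t t. \<beta> a = Inr c}"
  by (induction t) (fastforce simp: params_atm)+

lemma params_sb_d: "params (sb d \<alpha> \<beta> \<phi>)
  \<subseteq> {c. \<exists>i\<in>fv_d d \<phi>. \<alpha> i = Inr c} \<union> {c. \<exists>a\<in>params \<phi>. \<beta> a = Inr c}"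
proof (induction \<phi> arbitrary: d)
  case (Eq s t)
  then show ?case using params_sb_t[of d \<alpha> \<beta> s] params_sb_t[of d \<alpha> \<beta> t] by fastforce
next
  case (Rel R ts)
  then show ?case using params_sb_t[of d \<alpha> \<beta>] by fastforce
qed fastforce+

lemma fv_sb: "fv (sb 0 \<alpha> \<beta> \<phi>)
  \<subseteq> {j. \<exists>i\<in>fv \<phi>. \<alpha> i = Inl j} \<union> {j. \<exists>a\<in>params \<phi>. \<beta> a = Inl j}"
  unfolding fv_def by (rule fv_sb_d)

lemma params_sb: "params (sb 0 \<alpha> \<beta> \<phi>)
  \<subseteq> {c. \<exists>i\<in>fv \<phi>. \<alpha> i = Inr c} \<union> {c. \<exists>a\<in>params \<phi>. \<beta> a = Inr c}"
  unfolding fv_def by (rule params_sb_d)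

lemma finite_fv_t: "finite (fv_t d t)"
  by (induction t) auto

lemma finite_fv_d: "finite (fv_d d \<phi>)"
  by (induction \<phi> arbitrary: d) (auto simp: finite_fv_t)

lemma finite_fv: "finite (fv \<phi>)"
  by (simp add: fv_def finite_fv_d)

lemma finite_params_t: "finite (params_t t)"
  by (induction t) auto

lemma finite_params: "finite (params \<phi>)"
  by (induction \<phi>) (auto simp: finite_params_t)

section \<open>Dependence of truth on the free variables, shifting and instantiation\<close>

lemma evalt_cong:
  assumes "\<And>i. i < d \<Longrightarrow> e i = e' i" "\<And>i. i \<in> fv_t d t \<Longrightarrow> e (i + d) = e' (i + d)"
  shows "evalt M e t = evalt M e' t"
  using assms
proof (induction t)
  case (Var i)
  then show ?case by (cases "i < d") (force split: if_splits)+
next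
  case (App f ts)
  have "map (evalt M e) ts = map (evalt M e') ts"
    using App by (intro map_cong) auto
  then show ?case by (metis evalt.simps(3))
qed auto

lemma sat_cong_d:
  assumes "\<And>i. i < d \<Longrightarrow> e i = e' i" "\<And>i. i \<in> fv_d d \<phi> \<Longrightarrow> e (i + d) = e' (i + d)"
  shows "sat M e \<phi> = sat M e' \<phi>"
  using assms
proof (induction \<phi> arbitrary: d e e')
  case (Eq s t)
  then show ?case using evalt_cong[of d e e' s M] evalt_cong[of d e e' t M] by auto
next
  case (Rel R ts)
  have "map (evalt M e) ts = map (evalt M e') ts"
    using Rel by (intro map_cong evalt_cong[of d]) auto
  then show ?case by (metis sat.simps(3))
next
  case (Conj \<phi> \<psi>)
  have "sat M e \<phi> = sat M e' \<phi>" by (rule Conj.IH(1)[of d]) (use Conj.prems in auto)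
  moreover have "sat M e \<psi> = sat M e' \<psi>" by (rule Conj.IH(2)[of d]) (use Conj.prems in auto)
  ultimately show ?case by simp
next
  case (Ex \<phi>)
  have "sat M (case_nat a e) \<phi> = sat M (case_nat a e') \<phi>" for a
    by (rule Ex.IH[of "Suc d"]) (use Ex.prems in \<open>auto split: nat.split\<close>)
  then show ?case by simp
next
  case (Neg \<phi>)
  have "sat M e \<phi> = sat M e' \<phi>" by (rule Neg.IH[of d]) (use Neg.prems in auto)
  then show ?case by simp
qed auto

lemma sat_cong:
  assumes "\<And>i. i \<in> fv \<phi> \<Longrightarrow> e i = e' i"
  shows "sat M e \<phi> = sat M e' \<phi>"
  by (rule sat_cong_d[of 0]) (use assms in \<open>auto simp: fv_def\<close>)

lemma holds_sat:
  assumes "fv \<phi> \<subseteq> {..<length xs}" "\<And>i. i < length xs \<Longrightarrow> e i = xs ! i"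
  shows "holds M \<phi> xs \<longleftrightarrow> sat M e \<phi>"
  unfolding holds_def by (rule sat_cong) (use assms in auto)

lemma shift_t_sb: "shift_t d k t = sb_t d (\<lambda>i. Inl (i + k)) Inr t"
  by (induction t) auto

lemma shift_d_sb: "shift_d d k \<phi> = sb d (\<lambda>i. Inl (i + k)) Inr \<phi>"
  by (induction \<phi> arbitrary: d) (auto simp: shift_t_sb)

lemma shift_sb: "shift k \<phi> = sb 0 (\<lambda>i. Inl (i + k)) Inr \<phi>"
  by (simp add: shift_def shift_d_sb)

lemma sat_shift: "sat M e (shift k \<phi>) \<longleftrightarrow> sat M (\<lambda>i. e (i + k)) \<phi>"
  by (simp add: shift_sb sat_sb_id)

lemma fml_shift: "fml M B n \<phi> \<Longrightarrow> n + k \<le> N \<Longrightarrow> fml M B N (shift k \<phi>)"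
  using fv_sb[of "\<lambda>i. Inl (i + k)" Inr \<phi>] params_sb[of "\<lambda>i. Inl (i + k)" Inr \<phi>]
  by (fastforce simp: fml_def shift_sb)

lemma shift_t_shift_t: "shift_t d k (shift_t d l t) = shift_t d (k + l) t"
  by (induction t) auto

lemma shift_d_shift_d: "shift_d d k (shift_d d l \<phi>) = shift_d d (k + l) \<phi>"
  by (induction \<phi> arbitrary: d) (auto simp: shift_t_shift_t)

lemma shift_shift: "shift k (shift l \<phi>) = shift (k + l) \<phi>"
  by (simp add: shift_def shift_d_shift_d)

lemma shift_t_0: "shift_t d 0 t = t"
  by (induction t) (auto simp: map_idI)

lemma shift_d_0: "shift_d d 0 \<phi> = \<phi>"
  by (induction \<phi> arbitrary: d) (auto simp: shift_t_0 map_idI)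

lemma shift_0: "shift 0 \<phi> = \<phi>"
  by (simp add: shift_def shift_d_0)

lemma holds_shift:
  assumes "fml M B n \<phi>" "n + k \<le> length xs"
  shows "holds M (shift k \<phi>) xs \<longleftrightarrow> holds M \<phi> (take n (drop k xs))"
proof -
  define e where "e = (\<lambda>i. if i < length xs then xs ! i else undefined)"
  have "holds M (shift k \<phi>) xs \<longleftrightarrow> sat M e (shift k \<phi>)"
    using fml_shift[OF assms] by (intro holds_sat) (auto simp: fml_def e_def)
  also have "\<dots> \<longleftrightarrow> sat M (\<lambda>i. e (i + k)) \<phi>" by (rule sat_shift)
  also have "\<dots> \<longleftrightarrow> holds M \<phi> (take n (drop k xs))"
    by (rule holds_sat[symmetric]) (use assms in \<open>auto simp: fml_def e_def add.commute\<close>)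
  finally show ?thesis .
qed

lemma fml_mono: "fml M B n \<phi> \<Longrightarrow> B \<subseteq> B' \<Longrightarrow> n \<le> n' \<Longrightarrow> fml M B' n' \<phi>"
  by (fastforce simp: fml_def)

lemma fml_Neg [simp]: "fml M B n (Neg \<phi>) = fml M B n \<phi>"
  by (simp add: fml_def fv_def)

lemma fml_Conj [simp]: "fml M B n (Conj \<phi> \<psi>) \<longleftrightarrow> fml M B n \<phi> \<and> fml M B n \<psi>"
  by (auto simp: fml_def fv_def)

lemma holds_Neg [simp]: "holds M (Neg \<phi>) xs = (\<not> holds M \<phi> xs)"
  by (simp add: holds_def)

lemma holds_Conj [simp]: "holds M (Conj \<phi> \<psi>) xs = (holds M \<phi> xs \<and> holds M \<psi> xs)"
  by (simp add: holds_def)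

lemma fml_pmap: "fml M B n \<phi> \<Longrightarrow> g ` B \<subseteq> B' \<Longrightarrow> fml M B' n (pmap g \<phi>)"
  by (auto simp: fml_def params_pmap)

text \<open>The formula \<open>\<theta>(x, c)\<close>: the first \<open>n\<close> variables are kept
  as \<open>x\<close>, and those after them are filled with the tuple \<open>c\<close>.\<close>

definition inst :: "nat \<Rightarrow> ('f, 'r, 'a) fm \<Rightarrow> 'a list \<Rightarrow> ('f, 'r, 'a) fm" where
  "inst n \<theta> c = sb 0 (\<lambda>i. if i < n then Inl i else Inr (c ! (i - n))) Inr \<theta>"

lemma fml_inst:
  assumes "fml M B (n + length c) \<theta>"
  shows "fml M (B \<union> set c) n (inst n \<theta> c)"
proof -
  let ?\<alpha> = "\<lambda>i. if i < n then Inl i else Inr (c ! (i - n))"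
  have "fv (inst n \<theta> c) \<subseteq> {..<n}"
    using fv_sb[of ?\<alpha> Inr \<theta>] by (fastforce simp: inst_def split: if_splits)
  moreover have "params (inst n \<theta> c) \<subseteq> B \<union> set c"
  proof
    fix x assume "x \<in> params (inst n \<theta> c)"
    then have "(\<exists>i\<in>fv \<theta>. ?\<alpha> i = Inr x) \<or> x \<in> params \<theta>"
      using params_sb[of ?\<alpha> Inr \<theta>] unfolding inst_def by blast
    then show "x \<in> B \<union> set c"
    proof
      assume "\<exists>i\<in>fv \<theta>. ?\<alpha> i = Inr x"
      then obtain i where "i \<in> fv \<theta>" "\<not> i < n" "x = c ! (i - n)" by (auto split: if_splits)
      moreover have "i - n < length c" using assms calculation by (auto simp: fml_def)
      ultimately show ?thesis by auto
    qed (use assms in \<open>auto simp: fml_def\<close>)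
  qed
  ultimately show ?thesis using assms by (simp add: fml_def inst_def)
qed

lemma holds_inst:
  assumes "fml M B (n + length c) \<theta>" "length xs = n"
  shows "holds M (inst n \<theta> c) xs \<longleftrightarrow> holds M \<theta> (xs @ c)"
proof -
  define e where "e = (\<lambda>i. if i < length xs then xs ! i else undefined)"
  have "holds M (inst n \<theta> c) xs \<longleftrightarrow> sat M e (inst n \<theta> c)"
    using fml_inst[OF assms(1)] assms(2) by (intro holds_sat) (auto simp: fml_def e_def)
  also have "\<dots> \<longleftrightarrow> sat M (\<lambda>i. val e (if i < n then Inl i else Inr (c ! (i - n)))) \<theta>"
    unfolding inst_def by (rule sat_sb_id) auto
  also have "\<dots> \<longleftrightarrow> holds M \<theta> (xs @ c)"
    by (rule holds_sat[symmetric]) (use assms in \<open>auto simp: fml_def e_def nth_append\<close>)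
  finally show ?thesis .
qed

section \<open>Cardinality\<close>

lemma lepoll_iff_ordLeq: includes cardinal_syntax shows "A \<lesssim> B \<longleftrightarrow> |A| \<le>o |B|"
  by (simp add: lepoll_def card_of_ordLeq)

lemma lepoll_total: "A \<lesssim> B \<or> B \<lesssim> A"
  unfolding lepoll_iff_ordLeq by (rule ordLeq_total[OF card_of_Well_order card_of_Well_order])

lemma UN_lepoll_infinite:
  assumes "infinite B" "I \<lesssim> B" "\<And>i. i \<in> I \<Longrightarrow> A i \<lesssim> B"
  shows "(\<Union>i\<in>I. A i) \<lesssim> B"
  using assms unfolding lepoll_iff_ordLeq by (intro card_of_UNION_ordLeq_infinite) auto

lemma Un_lepoll_infinite:
  assumes "infinite B" "A \<lesssim> B" "C \<lesssim> B"
  shows "A \<union> C \<lesssim> B"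
proof -
  have "(\<Union>i\<in>{False,True}. if i then A else C) \<lesssim> B"
    using assms by (intro UN_lepoll_infinite) (auto intro: finite_lepoll_infinite)
  then show ?thesis by (simp add: Un_commute)
qed

lemma Times_lepoll_infinite:
  assumes "infinite B" "A \<lesssim> B" "C \<lesssim> B"
  shows "A \<times> C \<lesssim> B"
proof -
  have "A \<times> C = (\<Union>a\<in>A. (\<lambda>c. (a, c)) ` C)" by auto
  moreover have "(\<Union>a\<in>A. (\<lambda>c. (a, c)) ` C) \<lesssim> B"
    using assms by (intro UN_lepoll_infinite) (auto intro: lepoll_trans[OF image_lepoll])
  ultimately show ?thesis by simp
qed

lemma lists_lepoll_infinite:
  assumes "infinite B" "A \<lesssim> B"
  shows "lists A \<lesssim> B"
proof -
  have *: "{xs \<in> lists A. length xs = n} \<lesssim> B" for n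
  proof (induction n)
    case 0
    have "{xs \<in> lists A. length xs = 0} = {[]}" by auto
    then show ?case using assms by (simp add: finite_lepoll_infinite)
  next
    case (Suc n)
    have "{xs \<in> lists A. length xs = Suc n} \<subseteq> (\<lambda>(a, xs). a # xs) ` (A \<times> {xs \<in> lists A. length xs = n})"
      by (auto simp: length_Suc_conv image_iff)
    then show ?case
      using Times_lepoll_infinite[OF assms(1,2) Suc] by (meson lepoll_trans subset_image_lepoll)
  qed
  have "lists A = (\<Union>n. {xs \<in> lists A. length xs = n})" by auto
  also have "\<dots> \<lesssim> B"
    using assms * by (intro UN_lepoll_infinite) (auto simp: infinite_le_lepoll)
  finally show ?thesis .
qed

text \<open>Of two sets the larger one is either finite, and then so is the union, or it is infinite
  and absorbs the smaller one.\<close>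

lemma Un_lesspoll_infinite:
  assumes "infinite K" "A \<prec> K" "B \<prec> K"
  shows "A \<union> B \<prec> K"
proof -
  have *: "X \<union> Y \<prec> K" if "X \<lesssim> Y" "Y \<prec> K" "X \<prec> K" for X Y
  proof (cases "finite Y")
    case True
    then have "finite X" using that lepoll_iff finite_surj by metis
    then show ?thesis using True assms by (simp add: finite_lesspoll_infinite)
  next
    case False
    then show ?thesis using Un_lepoll_infinite[OF False that(1) lepoll_refl] that lesspoll_trans1 by blast
  qed
  show ?thesis
    using lepoll_total[of A B]
  proof
    assume "A \<lesssim> B" then show ?thesis using *[of A B] assms by blast
  next
    assume "B \<lesssim> A" then show ?thesis using *[of B A] assms by (metis Un_commute)
  qed
qed

section \<open>Counting formulas over a parameter set\<close>

definition trms :: "'a set \<Rightarrow> ('f, 'a) trm set" where "trms E = {t. params_t t \<subseteq> E}"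

text \<open>Layers by nesting depth, so that cardinal bounds pass from one layer to the next and
  then to the countable union. Arities are ignored, since an upper bound is all that is
  wanted.\<close>

fun trm_layer :: "'a set \<Rightarrow> nat \<Rightarrow> ('f, 'a) trm set" where
  "trm_layer E 0 = {}"
| "trm_layer E (Suc n) = range Var \<union> Par ` E \<union> (\<lambda>(f, ts). App f ts) ` (UNIV \<times> lists (trm_layer E n))"

lemma trm_layer_mono: "trm_layer E n \<subseteq> trm_layer E (n + k)"
proof -
  have "trm_layer E n \<subseteq> trm_layer E (Suc n)" for n
  proof (induction n)
    case (Suc n)
    then show ?case
      unfolding trm_layer.simps(2) by (intro Un_mono image_mono Sigma_mono lists_mono order_refl)
  qed simp
  then show ?thesis by (induction k) auto
qed

lemma trm_in_layer: "params_t t \<subseteq> E \<Longrightarrow> \<exists>n. t \<in> trm_layer E n"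
proof (induction t)
  case (Var i)
  have "Var i \<in> trm_layer E (Suc 0)" by simp
  then show ?case by blast
next
  case (Par a)
  then have "Par a \<in> trm_layer E (Suc 0)" by simp
  then show ?case by blast
next
  case (App f ts)
  then have "\<forall>t\<in>set ts. \<exists>n. t \<in> trm_layer E n" by fastforce
  then obtain N where N: "\<And>t. t \<in> set ts \<Longrightarrow> t \<in> trm_layer E (N t)" by metis
  have "t \<in> trm_layer E (\<Sum>t\<in>set ts. N t)" if "t \<in> set ts" for t
  proof -
    have "N t \<le> (\<Sum>t\<in>set ts. N t)" using that by (simp add: member_le_sum)
    then show ?thesis using trm_layer_mono[of E "N t"] N[OF that] by (metis le_iff_add subsetD)
  qed
  then have "App f ts \<in> trm_layer E (Suc (\<Sum>t\<in>set ts. N t))" by (auto simp: image_iff)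
  then show ?case by blast
qed

fun fm_layer :: "'a set \<Rightarrow> nat \<Rightarrow> ('f, 'r, 'a) fm set" where
  "fm_layer E 0 = {FF} \<union> (\<lambda>(s, t). Eq s t) ` (trms E \<times> trms E)
     \<union> (\<lambda>(R, ts). Rel R ts) ` (UNIV \<times> lists (trms E))"
| "fm_layer E (Suc n) = fm_layer E n \<union> Neg ` fm_layer E n
     \<union> (\<lambda>(s, t). Conj s t) ` (fm_layer E n \<times> fm_layer E n) \<union> Ex ` fm_layer E n"

lemma fm_layer_mono: "n \<le> m \<Longrightarrow> fm_layer E n \<subseteq> fm_layer E m"
  by (rule lift_Suc_mono_le) auto

lemma fm_in_layer: "params \<phi> \<subseteq> E \<Longrightarrow> \<exists>n. \<phi> \<in> fm_layer E n"
proof (induction \<phi>)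
  case FF
  have "FF \<in> fm_layer E 0" by simp
  then show ?case by blast
next
  case (Eq s t)
  then have "Eq s t \<in> fm_layer E 0" by (auto simp: trms_def)
  then show ?case by blast
next
  case (Rel R ts)
  then have "ts \<in> lists (trms E)" by (auto simp: trms_def)
  then have "Rel R ts \<in> fm_layer E 0" by auto
  then show ?case by blast
next
  case (Neg \<phi>)
  then obtain n where "\<phi> \<in> fm_layer E n" by auto
  then have "Neg \<phi> \<in> fm_layer E (Suc n)" by simp
  then show ?case by blast
next
  case (Conj \<phi> \<psi>)
  then obtain n m where "\<phi> \<in> fm_layer E n" "\<psi> \<in> fm_layer E m" by auto
  then have "\<phi> \<in> fm_layer E (max n m)" "\<psi> \<in> fm_layer E (max n m)"
    using fm_layer_mono[of n "max n m"] fm_layer_mono[of m "max n m"] by auto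
  then have "Conj \<phi> \<psi> \<in> fm_layer E (Suc (max n m))" by auto
  then show ?case by blast
next
  case (Ex \<phi>)
  then obtain n where "\<phi> \<in> fm_layer E n" by auto
  then have "Ex \<phi> \<in> fm_layer E (Suc n)" by simp
  then show ?case by blast
qed

text \<open>This bounds the number of requests for witnesses at one stage of the chain, and hence
  the growth of the parameter sets.\<close>

lemma formulas_lepoll:
  assumes B: "infinite B" and "E \<lesssim> B" "(UNIV :: 'f set) \<lesssim> B" "(UNIV :: 'r set) \<lesssim> B"
  shows "{\<phi> :: ('f, 'r, 'a) fm. params \<phi> \<subseteq> E} \<lesssim> B"
proof -
  note U = Un_lepoll_infinite[OF B] and P = Times_lepoll_infinite[OF B] and L = lists_lepoll_infinite[OF B]
  have N: "(UNIV :: nat set) \<lesssim> B" using B by (simp add: infinite_le_lepoll)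
  have im: "g ` X \<lesssim> B" if "X \<lesssim> B" for g :: "'x \<Rightarrow> 'y" and X
    using that image_lepoll lepoll_trans by blast
  have t: "(trm_layer E n :: ('f, 'a) trm set) \<lesssim> B" for n
    by (induction n) (auto intro!: U P L im assms N)
  have "(trms E :: ('f, 'a) trm set) \<subseteq> (\<Union>n. trm_layer E n)"
    using trm_in_layer by (auto simp: trms_def)
  moreover have "(\<Union>n. trm_layer E n :: ('f, 'a) trm set) \<lesssim> B"
    by (rule UN_lepoll_infinite[OF B N t])
  ultimately have T: "(trms E :: ('f, 'a) trm set) \<lesssim> B"
    by (meson lepoll_trans subset_imp_lepoll)
  have sing: "{FF} \<lesssim> B" using B by (simp add: finite_lepoll_infinite)
  have f: "(fm_layer E n :: ('f, 'r, 'a) fm set) \<lesssim> B" for n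
  proof (induction n)
    case 0
    show ?case unfolding fm_layer.simps by (intro U P L im assms N T sing)
  next
    case (Suc n)
    then show ?case unfolding fm_layer.simps by (intro U P L im)
  qed
  have "{\<phi> :: ('f, 'r, 'a) fm. params \<phi> \<subseteq> E} \<subseteq> (\<Union>n. fm_layer E n)"
    using fm_in_layer by auto
  moreover have "(\<Union>n. fm_layer E n :: ('f, 'r, 'a) fm set) \<lesssim> B"
    by (rule UN_lepoll_infinite[OF B N f])
  ultimately show ?thesis by (meson lepoll_trans subset_imp_lepoll)
qed

lemma path_lepoll_Pow: "(UNIV :: (path \<times> nat) set) \<lesssim> Pow (UNIV :: nat set)"
proof -
  \<comment> \<open>The residue classes modulo 3 keep three pieces of data apart: class 0 holds the
    first coordinates of the path, class 1 the second coordinates, class 2 the number.\<close>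
  define F where "F = (\<lambda>(\<sigma> :: path, j :: nat).
    {3 * i | i. fst (\<sigma> i)} \<union> {3 * i + 1 | i. snd (\<sigma> i)} \<union> {3 * j + 2})"
  have "inj F"
  proof (rule injI)
    fix x y assume eq: "F x = F y"
    obtain \<sigma> j \<rho> l where xy: "x = (\<sigma>, j)" "y = (\<rho>, l)" by (cases x, cases y)
    have ne: "3 * (i::nat) \<noteq> 3 * i' + 1" "3 * i \<noteq> 3 * i' + 2" "3 * i + 1 \<noteq> 3 * i' + 2" for i i'
      by presburger+
    have m: "3 * i \<in> F (s, t) \<longleftrightarrow> fst (s i)" "3 * i + 1 \<in> F (s, t) \<longleftrightarrow> snd (s i)"
      "3 * i + 2 \<in> F (s, t) \<longleftrightarrow> i = t" for i s t
      using ne ne(1,2,3)[symmetric] unfolding F_def by (simp_all del: One_nat_def)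
    have "\<sigma> i = \<rho> i" for i
      using m(1)[of i \<sigma> j] m(1)[of i \<rho> l] m(2)[of i \<sigma> j] m(2)[of i \<rho> l] eq xy
      by (simp add: prod_eq_iff)
    moreover have "j = l" using m(3)[of j \<sigma> j] m(3)[of j \<rho> l] eq xy by simp
    ultimately show "x = y" using xy by auto
  qed
  then show ?thesis unfolding lepoll_def by auto
qed

section \<open>Definable predicates on environments\<close>

text \<open>The variables come from an arbitrary type \<open>'v\<close>, because a weave needs
  variables indexed by paths and positions. The map \<open>v\<close> says which of them the numbered
  variables of the formula stand for.\<close>

definition definable :: "('f, 'r, 'a, 'z) struc_scheme \<Rightarrow> 'a set \<Rightarrow> (('v \<Rightarrow> 'a) \<Rightarrow> bool) \<Rightarrow> bool" where
  "definable M E P \<longleftrightarrow> (\<exists>\<phi> v. wf M \<phi> \<and> params \<phi> \<subseteq> E \<and>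
     (\<forall>e. range e \<subseteq> dom M \<longrightarrow> (P e \<longleftrightarrow> sat M (\<lambda>i. e (v i)) \<phi>)))"

lemma definable_cong:
  "definable M E P \<Longrightarrow> (\<And>e. range e \<subseteq> dom M \<Longrightarrow> Q e \<longleftrightarrow> P e) \<Longrightarrow> definable M E Q"
  unfolding definable_def by (auto; blast)

lemma definable_Not:
  assumes "definable M E P" shows "definable M E (\<lambda>e. \<not> P e)"
proof -
  obtain \<phi> v where "wf M \<phi>" "params \<phi> \<subseteq> E"
    "\<forall>e. range e \<subseteq> dom M \<longrightarrow> (P e \<longleftrightarrow> sat M (\<lambda>i. e (v i)) \<phi>)"
    using assms unfolding definable_def by blast
  then show ?thesis unfolding definable_def by (intro exI[of _ "Neg \<phi>"] exI[of _ v]) auto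
qed

lemma definable_False: "definable M E (\<lambda>e. False)"
  unfolding definable_def by (intro exI[of _ FF]) auto

lemma definable_True: "definable M E (\<lambda>e. True)"
  using definable_Not[OF definable_False] by simp

lemma definable_conj:
  assumes "definable M E P" "definable M E Q" shows "definable M E (\<lambda>e. P e \<and> Q e)"
proof -
  obtain \<phi> v where 1: "wf M \<phi>" "params \<phi> \<subseteq> E"
    "\<forall>e. range e \<subseteq> dom M \<longrightarrow> (P e \<longleftrightarrow> sat M (\<lambda>i. e (v i)) \<phi>)"
    using assms unfolding definable_def by blast
  obtain \<psi> w where 2: "wf M \<psi>" "params \<psi> \<subseteq> E"
    "\<forall>e. range e \<subseteq> dom M \<longrightarrow> (Q e \<longleftrightarrow> sat M (\<lambda>i. e (w i)) \<psi>)"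
    using assms unfolding definable_def by blast
  \<comment> \<open>The two formulas come with unrelated maps \<open>v\<close> and \<open>w\<close>;
    sending one to even and the other to odd indices lets a single map serve both.\<close>
  let ?\<phi> = "sb 0 (\<lambda>i. Inl (2 * i)) Inr \<phi>" and ?\<psi> = "sb 0 (\<lambda>i. Inl (2 * i + 1)) Inr \<psi>"
  have "params ?\<phi> \<subseteq> E" "params ?\<psi> \<subseteq> E" using params_sb[of _ Inr] 1(2) 2(2) by fastforce+
  then show ?thesis
    unfolding definable_def using 1 2
    by (intro exI[of _ "Conj ?\<phi> ?\<psi>"] exI[of _ "\<lambda>i. if even i then v (i div 2) else w (i div 2)"])
      (auto simp: sat_sb_id)
qed

lemma definable_ball:
  assumes "finite I" "\<And>i. i \<in> I \<Longrightarrow> definable M E (P i)"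
  shows "definable M E (\<lambda>e. \<forall>i\<in>I. P i e)"
  using assms by (induction I) (auto simp: definable_True intro: definable_conj)

lemma definable_holds:
  assumes "fml M E (length ts) \<phi>" "\<And>a. Inr a \<in> set ts \<Longrightarrow> a \<in> E"
  shows "definable M E (\<lambda>e :: 'v \<Rightarrow> 'a. holds M \<phi> (map (case_sum e id) ts))"
proof -
  define \<alpha> where "\<alpha> i = (case ts ! i of Inl v \<Rightarrow> Inl i | Inr a \<Rightarrow> Inr a)" for i :: nat
  define v where "v i = (case ts ! i of Inl v \<Rightarrow> v | Inr a \<Rightarrow> undefined)" for i :: nat
  let ?\<phi> = "sb 0 \<alpha> Inr \<phi>"
  have "params ?\<phi> \<subseteq> E"
  proof
    fix c assume "c \<in> params ?\<phi>"
    then consider i where "i \<in> fv \<phi>" "\<alpha> i = Inr c" | "c \<in> params \<phi>"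
      using params_sb[of \<alpha> Inr \<phi>] by blast
    then show "c \<in> E"
    proof cases
      case 1
      then have "i < length ts" using assms by (auto simp: fml_def)
      moreover have "ts ! i = Inr c" using 1(2) by (auto simp: \<alpha>_def split: sum.splits)
      ultimately show ?thesis using assms(2) nth_mem by metis
    qed (use assms in \<open>auto simp: fml_def\<close>)
  qed
  moreover have "holds M \<phi> (map (case_sum e id) ts) \<longleftrightarrow> sat M (\<lambda>i. e (v i)) ?\<phi>" for e
  proof -
    have "sat M (\<lambda>i. e (v i)) ?\<phi> \<longleftrightarrow> sat M (\<lambda>i. val (\<lambda>i. e (v i)) (\<alpha> i)) \<phi>"
      by (rule sat_sb_id) auto
    moreover have "holds M \<phi> (map (case_sum e id) ts) \<longleftrightarrow> sat M (\<lambda>i. val (\<lambda>i. e (v i)) (\<alpha> i)) \<phi>"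
      by (rule holds_sat) (use assms in \<open>auto simp: fml_def \<alpha>_def v_def split: sum.split\<close>)
    ultimately show ?thesis by simp
  qed
  ultimately show ?thesis
    unfolding definable_def using assms by (intro exI[of _ ?\<phi>] exI[of _ v]) (auto simp: fml_def)
qed

lemma definable_reindex:
  fixes M :: "('f, 'r, 'a, 'z) struc_scheme" and g :: "'v \<Rightarrow> 'w" and P :: "('v \<Rightarrow> 'a) \<Rightarrow> bool"
  assumes "definable M E P" shows "definable M E (\<lambda>e. P (\<lambda>v. e (g v)))"
proof -
  obtain \<phi> v where 1: "wf M \<phi>" "params \<phi> \<subseteq> E"
    "\<forall>e. range e \<subseteq> dom M \<longrightarrow> (P e \<longleftrightarrow> sat M (\<lambda>i. e (v i)) \<phi>)"
    using assms unfolding definable_def by blast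
  show ?thesis unfolding definable_def
  proof (intro exI conjI allI impI)
    fix e :: "'w \<Rightarrow> 'a" assume "range e \<subseteq> dom M"
    then show "P (\<lambda>v. e (g v)) \<longleftrightarrow> sat M (\<lambda>i. e ((g \<circ> v) i)) \<phi>"
      using 1(3)[rule_format, of "\<lambda>v. e (g v)"] by auto
  qed (use 1 in auto)
qed

text \<open>Values already chosen enter the formula as parameters, so the parameter set grows by
  exactly these values. The proof of \<open>compactness\<close> applies this to partial
  assignments.\<close>

lemma definable_override:
  fixes M :: "('f, 'r, 'a, 'z) struc_scheme" and P :: "('v \<Rightarrow> 'a) \<Rightarrow> bool"
  assumes "definable M E P" "h ` D \<subseteq> dom M"
  shows "definable M (E \<union> h ` D) (\<lambda>e. P (\<lambda>v. if v \<in> D then h v else e v))"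
proof -
  obtain \<phi> v where 1: "wf M \<phi>" "params \<phi> \<subseteq> E"
    "\<forall>e. range e \<subseteq> dom M \<longrightarrow> (P e \<longleftrightarrow> sat M (\<lambda>i. e (v i)) \<phi>)"
    using assms unfolding definable_def by blast
  let ?\<alpha> = "\<lambda>i. if v i \<in> D then Inr (h (v i)) else Inl i"
  let ?\<phi> = "sb 0 ?\<alpha> Inr \<phi>"
  have "params ?\<phi> \<subseteq> E \<union> h ` D" using params_sb[of ?\<alpha> Inr \<phi>] 1(2) by (fastforce split: if_splits)
  moreover have "P (\<lambda>v. if v \<in> D then h v else e v) \<longleftrightarrow> sat M (\<lambda>i. e (v i)) ?\<phi>"
    if "range e \<subseteq> dom M" for e
  proof -
    have "range (\<lambda>v. if v \<in> D then h v else e v) \<subseteq> dom M" using that assms(2) by auto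
    then have "P (\<lambda>v. if v \<in> D then h v else e v) \<longleftrightarrow> sat M (\<lambda>i. if v i \<in> D then h (v i) else e (v i)) \<phi>"
      using 1(3) by blast
    also have "(\<lambda>i. if v i \<in> D then h (v i) else e (v i)) = (\<lambda>i. val (\<lambda>i. e (v i)) (?\<alpha> i))" by auto
    finally show ?thesis by (simp add: sat_sb_id)
  qed
  ultimately show ?thesis unfolding definable_def using 1(1)
    by (intro exI[of _ ?\<phi>] exI[of _ v]) auto
qed

lemma definable_ex1:
  fixes M :: "('f, 'r, 'a, 'z) struc_scheme" and P :: "('v \<Rightarrow> 'a) \<Rightarrow> bool"
  assumes "definable M E P" shows "definable M E (\<lambda>e. \<exists>a\<in>dom M. P (e(u := a)))"
proof -
  obtain \<phi> v where 1: "wf M \<phi>" "params \<phi> \<subseteq> E"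
    "\<forall>e. range e \<subseteq> dom M \<longrightarrow> (P e \<longleftrightarrow> sat M (\<lambda>i. e (v i)) \<phi>)"
    using assms unfolding definable_def by blast
  \<comment> \<open>Several indices may stand for \<open>u\<close>; all of them are captured by the
    new quantifier.\<close>
  let ?\<alpha> = "\<lambda>i. if v i = u then Inl 0 else Inl (Suc i)"
  let ?\<phi> = "sb 0 ?\<alpha> Inr \<phi>"
  have "params ?\<phi> \<subseteq> E" using params_sb[of ?\<alpha> Inr \<phi>] 1(2) by (fastforce split: if_splits)
  moreover have "P (e(u := a)) \<longleftrightarrow> sat M (case_nat a (\<lambda>i. e (v i))) ?\<phi>"
    if "range e \<subseteq> dom M" "a \<in> dom M" for e a
  proof -
    have "range (e(u := a)) \<subseteq> dom M" using that by auto
    then have "P (e(u := a)) \<longleftrightarrow> sat M (\<lambda>i. (e(u := a)) (v i)) \<phi>" using 1(3) by blast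
    also have "(\<lambda>i. (e(u := a)) (v i)) = (\<lambda>i. val (case_nat a (\<lambda>i. e (v i))) (?\<alpha> i))" by auto
    also have "sat M \<dots> \<phi> \<longleftrightarrow> sat M (case_nat a (\<lambda>i. e (v i))) ?\<phi>" by (simp add: sat_sb_id)
    finally show ?thesis .
  qed
  ultimately show ?thesis unfolding definable_def using 1(1)
    by (intro exI[of _ "Ex ?\<phi>"] exI[of _ v]) auto
qed

lemma definable_support:
  assumes "definable M E P"
  obtains S where "finite S" "\<And>e e'. range e \<subseteq> dom M \<Longrightarrow> range e' \<subseteq> dom M \<Longrightarrow>
    (\<And>v. v \<in> S \<Longrightarrow> e v = e' v) \<Longrightarrow> P e \<longleftrightarrow> P e'"
proof -
  obtain \<phi> v where 1: "wf M \<phi>" "params \<phi> \<subseteq> E"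
    "\<forall>e. range e \<subseteq> dom M \<longrightarrow> (P e \<longleftrightarrow> sat M (\<lambda>i. e (v i)) \<phi>)"
    using assms unfolding definable_def by blast
  show ?thesis
  proof (rule that[of "v ` fv \<phi>"])
    fix e e' assume e: "range e \<subseteq> dom M" "range e' \<subseteq> dom M" "\<And>x. x \<in> v ` fv \<phi> \<Longrightarrow> e x = e' x"
    have "sat M (\<lambda>i. e (v i)) \<phi> \<longleftrightarrow> sat M (\<lambda>i. e' (v i)) \<phi>" by (rule sat_cong) (use e in auto)
    then show "P e \<longleftrightarrow> P e'" using 1(3) e by blast
  qed (simp add: finite_fv)
qed

text \<open>Quantification over infinitely many variables is harmless: a definable predicate depends
  on finitely many of them, and these are quantified one at a time.\<close>

lemma definable_ex_set:
  fixes M :: "('f, 'r, 'a, 'z) struc_scheme" and P :: "('v \<Rightarrow> 'a) \<Rightarrow> bool"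
  assumes "definable M E P"
  shows "definable M E (\<lambda>e. \<exists>e'. range e' \<subseteq> dom M \<and> (\<forall>v. v \<notin> S \<longrightarrow> e' v = e v) \<and> P e')"
proof -
  obtain F where F: "finite F" "\<And>e e'. range e \<subseteq> dom M \<Longrightarrow> range e' \<subseteq> dom M \<Longrightarrow>
    (\<And>v. v \<in> F \<Longrightarrow> e v = e' v) \<Longrightarrow> P e \<longleftrightarrow> P e'"
    using definable_support[OF assms] by metis
  have *: "definable M E (\<lambda>e. \<exists>e'. range e' \<subseteq> dom M \<and> (\<forall>v. v \<notin> S0 \<longrightarrow> e' v = e v) \<and> P e')"
    if "finite S0" for S0
    using that
  proof (induction S0)
    case empty
    show ?case by (rule definable_cong[OF assms]) (auto simp: fun_eq_iff[symmetric])
  next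
    case (insert u S0)
    show ?case
    proof (rule definable_cong[OF definable_ex1[OF insert.IH, of u]])
      fix e :: "'v \<Rightarrow> 'a" assume e: "range e \<subseteq> dom M"
      show "(\<exists>e'. range e' \<subseteq> dom M \<and> (\<forall>v. v \<notin> insert u S0 \<longrightarrow> e' v = e v) \<and> P e') \<longleftrightarrow>
        (\<exists>a\<in>dom M. \<exists>e'. range e' \<subseteq> dom M \<and> (\<forall>v. v \<notin> S0 \<longrightarrow> e' v = (e(u := a)) v) \<and> P e')"
        (is "?L \<longleftrightarrow> ?R")
      proof
        assume ?L
        then obtain e' where "range e' \<subseteq> dom M" "\<forall>v. v \<notin> insert u S0 \<longrightarrow> e' v = e v" "P e'" by blast
        then show ?R by (intro bexI[of _ "e' u"] exI[of _ e']) auto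
      next
        assume ?R
        then show ?L by (metis fun_upd_other insertCI insertI1)
      qed
    qed
  qed
  show ?thesis
  proof (rule definable_cong[OF *[of "S \<inter> F"]])
    fix e :: "'v \<Rightarrow> 'a" assume e: "range e \<subseteq> dom M"
    show "(\<exists>e'. range e' \<subseteq> dom M \<and> (\<forall>v. v \<notin> S \<longrightarrow> e' v = e v) \<and> P e') \<longleftrightarrow>
      (\<exists>e'. range e' \<subseteq> dom M \<and> (\<forall>v. v \<notin> S \<inter> F \<longrightarrow> e' v = e v) \<and> P e')" (is "?L \<longleftrightarrow> ?R")
    proof
      assume ?L
      then obtain e' where e': "range e' \<subseteq> dom M" "\<forall>v. v \<notin> S \<longrightarrow> e' v = e v" "P e'" by blast
      \<comment> \<open>Keeping \<open>e'\<close> on the finite support only preserves the truth of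
        \<open>P\<close> and leaves just the variables of \<open>S \<inter> F\<close>
        changed.\<close>
      let ?e = "\<lambda>v. if v \<in> F then e' v else e v"
      have r: "range ?e \<subseteq> dom M" using e e' by auto
      have "P ?e" using F(2)[of ?e e'] e' r by auto
      moreover have "\<forall>v. v \<notin> S \<inter> F \<longrightarrow> ?e v = e v" using e' by auto
      ultimately show ?R using r by blast
    qed auto
  qed (simp add: F)
qed

lemma definable_ex_sum:
  fixes P :: "('v + nat \<Rightarrow> 'a) \<Rightarrow> bool"
  assumes "definable M E P"
  shows "definable M E (\<lambda>e. \<exists>x. range x \<subseteq> dom M \<and> P (case_sum e x))"
proof (rule definable_cong[OF definable_reindex[OF definable_ex_set[OF assms, of "range Inr"],
        of "case_sum id (\<lambda>_. undefined)"]])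
  fix e :: "'v \<Rightarrow> 'a" assume e: "range e \<subseteq> dom M"
  let ?e = "\<lambda>v. e (case_sum id (\<lambda>_. undefined) v)"
  show "(\<exists>x. range x \<subseteq> dom M \<and> P (case_sum e x)) \<longleftrightarrow>
    (\<exists>e'. range e' \<subseteq> dom M \<and> (\<forall>v. v \<notin> range Inr \<longrightarrow> e' v = ?e v) \<and> P e')" (is "?L \<longleftrightarrow> ?R")
  proof
    assume ?L
    then obtain x where x: "range x \<subseteq> dom M" "P (case_sum e x)" by blast
    have "range (case_sum e x) \<subseteq> dom M" using x e by (force split: sum.split)
    moreover have "\<forall>v. v \<notin> range Inr \<longrightarrow> case_sum e x v = ?e v" by (auto split: sum.split)
    ultimately show ?R using x by blast
  next
    assume ?R
    then obtain e' where e': "range e' \<subseteq> dom M" "\<forall>v. v \<notin> range Inr \<longrightarrow> e' v = ?e v" "P e'" by blast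
    have "e' = case_sum e (\<lambda>i. e' (Inr i))"
      using e'(2) by (intro ext) (auto split: sum.split)
    then show ?L using e' by (intro exI[of _ "\<lambda>i. e' (Inr i)"]) auto
  qed
qed

lemma definable_imp_fml:
  assumes ne: "dom M \<noteq> {}" and d: "definable M E (\<lambda>e :: nat \<Rightarrow> 'a. Q (map e [0..<n]))"
  obtains \<phi> where "fml M E n \<phi>" "\<And>xs. length xs = n \<Longrightarrow> set xs \<subseteq> dom M \<Longrightarrow> holds M \<phi> xs \<longleftrightarrow> Q xs"
proof (cases "n = 0")
  case True
  \<comment> \<open>Without variables there is no index to which the variables of a formula could be
    redirected, so the truth value itself is written down.\<close>
  show ?thesis by (rule that[of "if Q [] then Neg FF else FF"]) (auto simp: True fml_def fv_def holds_def)
next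
  case False
  obtain \<phi> v where 1: "wf M \<phi>" "params \<phi> \<subseteq> E"
    "\<forall>e. range e \<subseteq> dom M \<longrightarrow> (Q (map e [0..<n]) \<longleftrightarrow> sat M (\<lambda>i. e (v i)) \<phi>)"
    using d unfolding definable_def by blast
  \<comment> \<open>The formula may mention variables from \<open>n\<close> on, but its truth
    depends on the first \<open>n\<close> values only; the others are redirected to index 0.\<close>
  let ?\<alpha> = "\<lambda>i. Inl (if v i < n then v i else 0)"
  let ?\<phi> = "sb 0 ?\<alpha> Inr \<phi>"
  have "fml M E n ?\<phi>"
    using 1(1,2) False fv_sb[of ?\<alpha> Inr \<phi>] params_sb[of ?\<alpha> Inr \<phi>]
    by (fastforce simp: fml_def split: if_splits)
  moreover have "holds M ?\<phi> xs \<longleftrightarrow> Q xs" if xs: "length xs = n" "set xs \<subseteq> dom M" for xs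
  proof -
    define e where "e i = xs ! (if i < n then i else 0)" for i
    have r: "range e \<subseteq> dom M"
    proof
      fix y assume "y \<in> range e"
      then obtain i where "y = xs ! (if i < n then i else 0)" by (auto simp: e_def)
      then have "y \<in> set xs" using xs False by auto
      then show "y \<in> dom M" using xs by auto
    qed
    have "map e [0..<n] = xs" using xs by (auto simp: e_def intro: nth_equalityI)
    then have "Q xs \<longleftrightarrow> sat M (\<lambda>i. e (v i)) \<phi>" using 1(3) r by metis
    also have "(\<lambda>i. e (v i)) = (\<lambda>i. val e (?\<alpha> i))" by (auto simp: e_def)
    also have "sat M (\<lambda>i. val e (?\<alpha> i)) \<phi> \<longleftrightarrow> sat M e ?\<phi>" by (simp add: sat_sb_id)
    also have "\<dots> \<longleftrightarrow> holds M ?\<phi> xs"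
      by (rule holds_sat[symmetric]) (use xs \<open>fml M E n ?\<phi>\<close> in \<open>auto simp: fml_def e_def\<close>)
    finally show ?thesis by simp
  qed
  ultimately show ?thesis by (rule that)
qed

section \<open>Ultrafilters\<close>

definition ultra :: "'i set set \<Rightarrow> bool" where
  "ultra U \<longleftrightarrow> {} \<notin> U \<and> (\<forall>X\<in>U. \<forall>Y\<in>U. X \<inter> Y \<in> U) \<and> (\<forall>X\<in>U. \<forall>Y. X \<subseteq> Y \<longrightarrow> Y \<in> U)
     \<and> (\<forall>X. X \<in> U \<or> - X \<in> U)"

definition proper_ideal :: "'i set set \<Rightarrow> bool" where
  "proper_ideal I \<longleftrightarrow> {} \<in> I \<and> (\<forall>X\<in>I. \<forall>Y\<in>I. X \<union> Y \<in> I) \<and> (\<forall>X\<in>I. \<forall>Y. Y \<subseteq> X \<longrightarrow> Y \<in> I) \<and> UNIV \<notin> I"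

text \<open>A maximal proper ideal above \<open>I\<close> exists by Zorn, and its dual filter is an
  ultrafilter.\<close>

lemma ultra_avoiding_ideal:
  assumes "proper_ideal I"
  obtains U where "ultra U" "U \<inter> I = {}"
proof -
  let ?A = "{J. proper_ideal J \<and> I \<subseteq> J}"
  have "\<exists>J\<in>?A. \<forall>X\<in>?A. J \<subseteq> X \<longrightarrow> X = J"
  proof (rule subset_Zorn_nonempty)
    fix C assume C: "C \<noteq> {}" "subset.chain ?A C"
    have mem: "proper_ideal J" "I \<subseteq> J" if "J \<in> C" for J using C that by (auto simp: subset_chain_def)
    have "X \<union> Y \<in> \<Union>C" if XY: "X \<in> \<Union>C" "Y \<in> \<Union>C" for X Y
    proof -
      obtain J J' where J: "J \<in> C" "X \<in> J" "J' \<in> C" "Y \<in> J'" using XY by blast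
      then have "J \<subseteq> J' \<or> J' \<subseteq> J" using C by (auto simp: subset_chain_def)
      then obtain J'' where J'': "J'' \<in> C" "X \<in> J''" "Y \<in> J''" using J by blast
      then have "X \<union> Y \<in> J''" using mem(1)[OF J''(1)] unfolding proper_ideal_def by simp
      then show ?thesis using J'' by blast
    qed
    moreover have "Y \<in> \<Union>C" if "X \<in> \<Union>C" "Y \<subseteq> X" for X Y
      using that mem(1) unfolding proper_ideal_def by (meson UnionE UnionI)
    moreover have "UNIV \<notin> \<Union>C" using mem(1) unfolding proper_ideal_def by blast
    moreover obtain J0 where J0: "J0 \<in> C" using C(1) by blast
    then have "{} \<in> \<Union>C" "I \<subseteq> \<Union>C" using mem[OF J0] unfolding proper_ideal_def by blast+
    ultimately show "\<Union>C \<in> ?A" unfolding proper_ideal_def by simp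
  qed (use assms in auto)
  then obtain J where JA: "J \<in> ?A" and JM: "\<forall>X\<in>?A. J \<subseteq> X \<longrightarrow> X = J" by (elim bexE)
  have J: "proper_ideal J" "I \<subseteq> J" using JA by simp_all
  have max: "X = J" if "proper_ideal X" "J \<subseteq> X" for X
  proof -
    have "X \<in> ?A" using that J(2) by simp
    from bspec[OF JM this] show ?thesis using that(2) by simp
  qed
  have comp: "- X \<in> J" if X: "X \<notin> J" for X
  proof (rule ccontr)
    assume nX: "- X \<notin> J"
    \<comment> \<open>The ideal generated by \<open>J\<close> and \<open>X\<close>. It is proper
      because \<open>- X\<close> is not in \<open>J\<close>, so maximality puts \<open>X\<close>
      into \<open>J\<close>.\<close>
    let ?J = "{Z. \<exists>Y\<in>J. Z \<subseteq> X \<union> Y}"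
    have j1: "UNIV \<notin> ?J"
    proof
      assume "UNIV \<in> ?J"
      then obtain Y where "Y \<in> J" "UNIV \<subseteq> X \<union> Y" by blast
      then have "- X \<subseteq> Y" by blast
      then show False using J(1) \<open>Y \<in> J\<close> nX unfolding proper_ideal_def by blast
    qed
    have j2: "Z \<union> Z' \<in> ?J" if Z: "Z \<in> ?J" "Z' \<in> ?J" for Z Z'
    proof -
      obtain Y Y' where "Y \<in> J" "Z \<subseteq> X \<union> Y" "Y' \<in> J" "Z' \<subseteq> X \<union> Y'" using Z by blast
      moreover have "Y \<union> Y' \<in> J" using J(1) calculation unfolding proper_ideal_def by blast
      ultimately show ?thesis by blast
    qed
    have j3: "{} \<in> ?J" using J(1) unfolding proper_ideal_def by blast
    have j4: "Z' \<in> ?J" if "Z \<in> ?J" "Z' \<subseteq> Z" for Z Z' using that by blast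
    have "proper_ideal ?J"
      unfolding proper_ideal_def
      by (intro conjI ballI allI impI) (fact j3, erule (1) j2, erule (1) j4, fact j1)
    moreover have "J \<subseteq> ?J" by blast
    ultimately have "?J = J" by (rule max)
    moreover have "X \<in> ?J" using J(1) unfolding proper_ideal_def by blast
    ultimately show False using X by blast
  qed
  let ?U = "{X. - X \<in> J}"
  have "ultra ?U"
    using J(1) comp unfolding ultra_def proper_ideal_def by (auto simp: Compl_Int)
  moreover have "X \<notin> J" if "- X \<in> J" for X
    using J(1) that unfolding proper_ideal_def by (metis Compl_partition)
  then have "?U \<inter> I = {}" using J(2) by blast
  ultimately show ?thesis using that by blast
qed

lemma ultra_Int: "ultra U \<Longrightarrow> X \<in> U \<Longrightarrow> Y \<in> U \<Longrightarrow> X \<inter> Y \<in> U"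
  unfolding ultra_def by blast

lemma ultra_mono: "ultra U \<Longrightarrow> X \<in> U \<Longrightarrow> X \<subseteq> Y \<Longrightarrow> Y \<in> U"
  unfolding ultra_def by blast

lemma ultra_ex: "ultra U \<Longrightarrow> X \<in> U \<Longrightarrow> \<exists>x. x \<in> X"
  unfolding ultra_def by blast

lemma ultra_Compl: "ultra U \<Longrightarrow> X \<notin> U \<Longrightarrow> - X \<in> U"
  unfolding ultra_def by blast

lemma ultra_ball:
  assumes "ultra U" "finite F" "\<And>f. f \<in> F \<Longrightarrow> X f \<in> U"
  shows "{i. \<forall>f\<in>F. i \<in> X f} \<in> U"
  using assms(2,3)
proof (induction F)
  case empty
  have "UNIV \<in> U" using assms(1) unfolding ultra_def by (metis subset_UNIV)
  then show ?case by simp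
next
  case (insert f F)
  have "{i. \<forall>g\<in>insert f F. i \<in> X g} = X f \<inter> {i. \<forall>g\<in>F. i \<in> X g}" by auto
  then show ?case using insert ultra_Int[OF assms(1)] by auto
qed

section \<open>Types in the monster model\<close>

locale monster_model =
  fixes T :: "('f, 'r, 'a) fm set" and M :: "('f, 'r, 'a) struc" and K :: "'a set"
  assumes monster: "monster T M K"
begin

lemma struc: "is_struc M"
  using monster by (simp add: monster_def)

lemma dom_ne: "dom M \<noteq> {}"
  using struc by (simp add: is_struc_def)

lemma K_inf: "infinite K"
proof -
  have "(UNIV :: nat set) \<lesssim> K" using monster by (simp add: monster_def lesspoll_imp_lepoll)
  then show ?thesis by (simp add: infinite_le_lepoll)
qed

lemma saturated:
  assumes "A \<subseteq> dom M" "A \<prec> K" "\<And>\<phi>. \<phi> \<in> \<Sigma> \<Longrightarrow> fml M A 1 \<phi>" "finsat M 1 \<Sigma>"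
  shows "\<exists>b. realizes M 1 b \<Sigma>"
proof -
  have "\<forall>A \<Sigma>. A \<subseteq> dom M \<and> small K A \<and> (\<forall>\<phi>\<in>\<Sigma>. fml M A 1 \<phi>) \<and> finsat M 1 \<Sigma>
    \<longrightarrow> (\<exists>b. realizes M 1 b \<Sigma>)"
    using monster unfolding monster_def by (elim conjE) assumption
  from this[rule_format, of A \<Sigma>] show ?thesis using assms by (simp add: small_def)
qed

lemma homogeneous:
  "A \<prec> K \<Longrightarrow> elementary_map M A g \<Longrightarrow> \<exists>\<sigma>. aut M \<sigma> \<and> (\<forall>a\<in>A. \<sigma> a = g a)"
  using monster by (simp add: monster_def small_def)

lemma small_Un: "A \<prec> K \<Longrightarrow> B \<prec> K \<Longrightarrow> A \<union> B \<prec> K"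
  using Un_lesspoll_infinite[OF K_inf] .

lemma small_finite: "finite A \<Longrightarrow> A \<prec> K"
  using finite_lesspoll_infinite[OF K_inf] .

lemma small_Un_set: "A \<prec> K \<Longrightarrow> A \<union> set c \<prec> K"
  by (simp add: small_Un small_finite)

text \<open>Zorn yields a maximal partial assignment under which every finite part of
  \<open>Ps\<close> remains satisfiable. If a variable \<open>u\<close> had no value, its possible
  values would be described by a finitely satisfiable set of one-variable formulas over
  \<open>E\<close> and the values chosen so far. There are few variables, so this parameter set is
  small and saturation supplies a value.\<close>

lemma compactness:
  fixes Ps :: "(('v \<Rightarrow> 'a) \<Rightarrow> bool) set"
  assumes V: "(UNIV :: 'v set) \<prec> K" and E: "E \<subseteq> dom M" "E \<prec> K"
    and def: "\<And>P. P \<in> Ps \<Longrightarrow> definable M E P"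
    and fin: "\<And>P0. P0 \<subseteq> Ps \<Longrightarrow> finite P0 \<Longrightarrow> \<exists>e. range e \<subseteq> dom M \<and> (\<forall>P\<in>P0. P e)"
  shows "\<exists>e. range e \<subseteq> dom M \<and> (\<forall>P\<in>Ps. P e)"
proof -
  define ext where "ext G e \<longleftrightarrow> range e \<subseteq> dom M \<and> (\<forall>(v, a)\<in>G. e v = a)" for G and e :: "'v \<Rightarrow> 'a"
  define adm where "adm G \<longleftrightarrow> single_valued G \<and> Range G \<subseteq> dom M \<and>
    (\<forall>P0. P0 \<subseteq> Ps \<longrightarrow> finite P0 \<longrightarrow> (\<exists>e. ext G e \<and> (\<forall>P\<in>P0. P e)))" for G
  have "\<exists>G\<in>{G. adm G}. \<forall>X\<in>{G. adm G}. G \<subseteq> X \<longrightarrow> X = G"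
  proof (rule subset_Zorn_nonempty)
    have "adm {}" using fin by (simp add: adm_def ext_def single_valued_def)
    then show "{G. adm G} \<noteq> {}" by blast
  next
    fix C assume C: "C \<noteq> {}" "subset.chain {G. adm G} C"
    have mem: "adm G" if "G \<in> C" for G using C that by (auto simp: subset_chain_def)
    have sv: "single_valued (\<Union>C)"
    proof (rule single_valuedI)
      fix x y z assume "(x, y) \<in> \<Union>C" "(x, z) \<in> \<Union>C"
      then obtain G G' where G: "G \<in> C" "(x, y) \<in> G" "G' \<in> C" "(x, z) \<in> G'" by blast
      then have "G \<subseteq> G' \<or> G' \<subseteq> G" using C by (auto simp: subset_chain_def)
      moreover have "single_valued G" "single_valued G'"
        using mem[OF G(1)] mem[OF G(3)] unfolding adm_def by simp_all
      ultimately show "y = z" using G(2,4) by (auto dest: single_valuedD)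
    qed
    have rg: "Range (\<Union>C) \<subseteq> dom M" using mem unfolding adm_def by blast
    have "\<exists>e. ext (\<Union>C) e \<and> (\<forall>P\<in>P0. P e)" if P0: "P0 \<subseteq> Ps" "finite P0" for P0
    proof -
      have "\<forall>P\<in>P0. \<exists>S. finite S \<and> (\<forall>e e'. range e \<subseteq> dom M \<longrightarrow> range e' \<subseteq> dom M \<longrightarrow>
        (\<forall>v\<in>S. e v = e' v) \<longrightarrow> (P e \<longleftrightarrow> P e'))"
      proof
        fix P assume "P \<in> P0"
        then have "definable M E P" using def P0 by blast
        then obtain S where "finite S" "\<And>e e'. range e \<subseteq> dom M \<Longrightarrow> range e' \<subseteq> dom M \<Longrightarrow>
          (\<And>v. v \<in> S \<Longrightarrow> e v = e' v) \<Longrightarrow> P e \<longleftrightarrow> P e'" using definable_support by metis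
        then show "\<exists>S. finite S \<and> (\<forall>e e'. range e \<subseteq> dom M \<longrightarrow> range e' \<subseteq> dom M \<longrightarrow>
          (\<forall>v\<in>S. e v = e' v) \<longrightarrow> (P e \<longleftrightarrow> P e'))" by (intro exI[of _ S]) blast
      qed
      then obtain S where S: "\<And>P. P \<in> P0 \<Longrightarrow> finite (S P)"
        "\<And>P e e'. P \<in> P0 \<Longrightarrow> range e \<subseteq> dom M \<Longrightarrow> range e' \<subseteq> dom M \<Longrightarrow>
          (\<forall>v\<in>S P. e v = e' v) \<Longrightarrow> (P e \<longleftrightarrow> P e')" by metis
      let ?S = "\<Union>P\<in>P0. S P"
      \<comment> \<open>The part of the union of the chain that concerns the finite support of
        \<open>P0\<close>. Being finite, it lies in a single member of the chain.\<close>
      let ?H = "{(v, a). (v, a) \<in> \<Union>C \<and> v \<in> ?S}"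
      have "?H \<subseteq> (\<lambda>v. (v, THE a. (v, a) \<in> \<Union>C)) ` ?S"
      proof (clarsimp, goal_cases)
        case (1 v a P G)
        have "(THE a. (v, a) \<in> \<Union>C) = a"
          using 1 sv by (intro the_equality) (auto dest: single_valuedD)
        then show ?case using 1 by (force simp: image_iff)
      qed
      then have "finite ?H" using S P0 by (meson finite_UN_I finite_imageI finite_subset)
      then obtain G where G: "G \<in> C" "?H \<subseteq> G"
        using finite_subset_Union_chain[OF _ _ C(1,2), of ?H] by blast
      then obtain e where e: "ext G e" "\<forall>P\<in>P0. P e" using mem[OF G(1)] P0 unfolding adm_def by blast
      \<comment> \<open>The extension of \<open>G\<close> is overwritten by all values from the
        union of the chain; on the support of \<open>P0\<close> nothing changes.\<close>
      define e' where "e' v = (if v \<in> Domain (\<Union>C) then THE a. (v, a) \<in> \<Union>C else e v)" for v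
      have the: "(THE a. (v, a) \<in> \<Union>C) = a" if "(v, a) \<in> \<Union>C" for v a
        using that sv by (intro the_equality) (auto dest: single_valuedD)
      have e'C: "e' v = a" if "(v, a) \<in> \<Union>C" for v a
        using that the unfolding e'_def by (auto simp: Domain_iff)
      have "range e' \<subseteq> dom M"
      proof
        fix y assume "y \<in> range e'"
        then obtain v where v: "y = e' v" by blast
        show "y \<in> dom M"
        proof (cases "v \<in> Domain (\<Union>C)")
          case True
          then obtain a where "(v, a) \<in> \<Union>C" by blast
          then show ?thesis using e'C rg v by blast
        qed (use e v in \<open>auto simp: e'_def ext_def\<close>)
      qed
      moreover have "e v = e' v" if "v \<in> ?S" for v
      proof (cases "v \<in> Domain (\<Union>C)")
        case True
        then obtain a where a: "(v, a) \<in> \<Union>C" by blast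
        then have "(v, a) \<in> G" using G that by blast
        then show ?thesis using e(1) e'C[OF a] unfolding ext_def by auto
      qed (simp add: e'_def)
      ultimately have "P e'" if "P \<in> P0" for P
        using S(2)[of P e e'] that e unfolding ext_def by auto
      moreover have "ext (\<Union>C) e'" unfolding ext_def using \<open>range e' \<subseteq> dom M\<close> e'C by auto
      ultimately show ?thesis by blast
    qed
    then show "\<Union>C \<in> {G. adm G}" using sv rg unfolding adm_def by blast
  qed
  then obtain G where G: "adm G" and max: "\<And>X. adm X \<Longrightarrow> G \<subseteq> X \<Longrightarrow> X = G" by blast
  define D where "D = Domain G"
  define h where "h v = (THE a. (v, a) \<in> G)" for v
  have sv: "single_valued G" and rg: "Range G \<subseteq> dom M" using G by (auto simp: adm_def)
  have hG: "(v, h v) \<in> G" if v: "v \<in> D" for v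
  proof -
    obtain a where a: "(v, a) \<in> G" using v unfolding D_def by blast
    then have "h v = a" unfolding h_def using sv by (auto dest: single_valuedD)
    then show ?thesis using a by simp
  qed
  have hu: "a = h v" "v \<in> D" if "(v, a) \<in> G" for v a
    using that hG sv unfolding D_def by (auto dest: single_valuedD)
  have hD: "h ` D \<subseteq> dom M" using hG rg by blast
  have ext_iff: "ext G e \<longleftrightarrow> range e \<subseteq> dom M \<and> (\<forall>v\<in>D. e v = h v)" for e
    unfolding ext_def using hG hu by fast
  have "D = UNIV"
  proof (rule ccontr)
    assume "D \<noteq> UNIV"
    then obtain u where u: "u \<notin> D" by blast
    \<comment> \<open>\<open>Q P0\<close> collects the values for \<open>u\<close> that keep
      \<open>P0\<close> satisfiable. Finite unions of such \<open>P0\<close> make these conditions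
      jointly finitely satisfiable.\<close>
    define Q where "Q P0 a \<longleftrightarrow> (\<exists>e. ext G e \<and> e u = a \<and> (\<forall>P\<in>P0. P e))" for P0 :: "(('v \<Rightarrow> 'a) \<Rightarrow> bool) set" and a
    have "\<exists>\<psi>. fml M (E \<union> h ` D) 1 \<psi> \<and> (\<forall>a\<in>dom M. holds M \<psi> [a] \<longleftrightarrow> Q P0 a)"
      if P0: "P0 \<subseteq> Ps" "finite P0" for P0
    proof -
      \<comment> \<open>All variables except \<open>u\<close> are quantified, with those in
        \<open>D\<close> overridden by their chosen values. On a constant environment with value
        \<open>a\<close> this says \<open>Q P0 a\<close>, and it can be written with one
        variable.\<close>
      define R where "R e \<longleftrightarrow> (\<exists>e'. range e' \<subseteq> dom M \<and> (\<forall>v. v \<notin> - {u} \<longrightarrow> e' v = e v) \<and>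
        (\<forall>P\<in>P0. P (\<lambda>v. if v \<in> D then h v else e' v)))" for e
      have "definable M E (\<lambda>e. \<forall>P\<in>P0. P e)"
        using def P0 by (intro definable_ball[where P = "\<lambda>P. P"]) auto
      then have "definable M (E \<union> h ` D) (\<lambda>e. \<forall>P\<in>P0. P (\<lambda>v. if v \<in> D then h v else e v))"
        by (rule definable_override) (rule hD)
      then have "definable M (E \<union> h ` D) R"
        unfolding R_def by (rule definable_ex_set)
      then have "definable M (E \<union> h ` D) (\<lambda>e :: nat \<Rightarrow> 'a. R (\<lambda>v. e ((\<lambda>_. 0) v)))"
        by (rule definable_reindex)
      then have "definable M (E \<union> h ` D) (\<lambda>e :: nat \<Rightarrow> 'a. R (\<lambda>v. (map e [0..<1]) ! 0))"
        by simp
      then obtain \<psi> where \<psi>: "fml M (E \<union> h ` D) 1 \<psi>"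
        "\<And>xs. length xs = 1 \<Longrightarrow> set xs \<subseteq> dom M \<Longrightarrow> holds M \<psi> xs \<longleftrightarrow> R (\<lambda>v. xs ! 0)"
        using definable_imp_fml[OF dom_ne, of "E \<union> h ` D" "\<lambda>xs. R (\<lambda>v. xs ! 0)" 1] by blast
      have "R (\<lambda>v. a) \<longleftrightarrow> Q P0 a" if "a \<in> dom M" for a
      proof
        assume "R (\<lambda>v. a)"
        then obtain e' where e': "range e' \<subseteq> dom M" "e' u = a"
          "\<forall>P\<in>P0. P (\<lambda>v. if v \<in> D then h v else e' v)" unfolding R_def by auto
        then show "Q P0 a" unfolding Q_def ext_iff using hD u
          by (intro exI[of _ "\<lambda>v. if v \<in> D then h v else e' v"]) auto
      next
        assume "Q P0 a"
        then obtain e where e: "range e \<subseteq> dom M" "\<forall>v\<in>D. e v = h v" "e u = a" "\<forall>P\<in>P0. P e"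
          unfolding Q_def ext_iff by auto
        moreover have "(\<lambda>v. if v \<in> D then h v else e v) = e" using e(2) by auto
        ultimately show "R (\<lambda>v. a)" unfolding R_def by (intro exI[of _ e]) auto
      qed
      then show ?thesis using \<psi> by (intro exI[of _ \<psi>]) auto
    qed
    then obtain \<psi> where \<psi>: "\<And>P0. P0 \<subseteq> Ps \<Longrightarrow> finite P0 \<Longrightarrow> fml M (E \<union> h ` D) 1 (\<psi> P0)"
      "\<And>P0 a. P0 \<subseteq> Ps \<Longrightarrow> finite P0 \<Longrightarrow> a \<in> dom M \<Longrightarrow> holds M (\<psi> P0) [a] \<longleftrightarrow> Q P0 a" by metis
    let ?F = "{P0. P0 \<subseteq> Ps \<and> finite P0}"
    have "finsat M 1 (\<psi> ` ?F)"
      unfolding finsat_def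
    proof (intro allI impI)
      fix S0 assume S0: "S0 \<subseteq> \<psi> ` ?F" "finite S0"
      obtain F0 where F0: "F0 \<subseteq> ?F" "finite F0" "S0 = \<psi> ` F0"
        using finite_subset_image[OF S0(2,1)] by blast
      then have "\<Union>F0 \<subseteq> Ps" "finite (\<Union>F0)" by auto
      then obtain e where e: "ext G e" "\<forall>P\<in>\<Union>F0. P e" using G unfolding adm_def by blast
      then have "e u \<in> dom M" by (auto simp: ext_def)
      moreover have "Q P0 (e u)" if "P0 \<in> F0" for P0 using e that unfolding Q_def by blast
      ultimately have "realizes M 1 [e u] S0"
        using F0 \<psi>(2) unfolding realizes_def by auto
      then show "\<exists>b. realizes M 1 b S0" by blast
    qed
    moreover have "h ` D \<prec> K"
      using V by (meson image_lepoll lesspoll_trans1 lepoll_trans subset_UNIV subset_imp_lepoll)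
    then have "E \<union> h ` D \<prec> K" using small_Un E by blast
    ultimately obtain b where b: "realizes M 1 b (\<psi> ` ?F)"
      using saturated[of "E \<union> h ` D" "\<psi> ` ?F"] \<psi>(1) E hD by blast
    then obtain a where a: "b = [a]" "a \<in> dom M"
      unfolding realizes_def by (cases b) auto
    have Qa: "Q P0 a" if "P0 \<subseteq> Ps" "finite P0" for P0
      using b a \<psi>(2) that unfolding realizes_def by blast
    have "adm (insert (u, a) G)"
      unfolding adm_def
    proof (intro conjI allI impI)
      show "single_valued (insert (u, a) G)"
        using sv u hu unfolding single_valued_def by blast
      show "Range (insert (u, a) G) \<subseteq> dom M" using rg a by auto
      fix P0 assume "P0 \<subseteq> Ps" "finite P0"
      then obtain e where e: "ext G e" "e u = a" "\<forall>P\<in>P0. P e" using Qa unfolding Q_def by auto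
      then have "ext (insert (u, a) G) e" unfolding ext_def by simp
      then show "\<exists>e. ext (insert (u, a) G) e \<and> (\<forall>P\<in>P0. P e)" using e by auto
    qed
    then have "insert (u, a) G = G" by (rule max) blast
    then show False using u hu by blast
  qed
  show ?thesis
  proof (intro exI[of _ h] conjI ballI)
    show "range h \<subseteq> dom M" using hD \<open>D = UNIV\<close> by auto
    fix P assume "P \<in> Ps"
    then obtain e where e: "ext G e" "P e" using G unfolding adm_def by (elim conjE allE[of _ "{P}"]) auto
    then have "e = h" using \<open>D = UNIV\<close> unfolding ext_iff by auto
    then show "P h" using e by simp
  qed
qed

lemma realize_type:
  assumes "A \<subseteq> dom M" "A \<prec> K" "\<And>\<phi>. \<phi> \<in> \<Sigma> \<Longrightarrow> fml M A n \<phi>" "finsat M n \<Sigma>"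
  obtains b where "realizes M n b \<Sigma>"
proof -
  obtain a0 where a0: "a0 \<in> dom M" using dom_ne by blast
  let ?Ps = "(\<lambda>\<phi> (e :: nat \<Rightarrow> 'a). holds M \<phi> (map e [0..<n])) ` \<Sigma>"
  have "(UNIV :: nat set) \<prec> K" using monster by (simp add: monster_def)
  then have "\<exists>e. range e \<subseteq> dom M \<and> (\<forall>P\<in>?Ps. P e)"
  proof (rule compactness[where Ps = ?Ps, OF _ assms(1,2)])
    fix P assume "P \<in> ?Ps"
    then obtain \<phi> where \<phi>: "\<phi> \<in> \<Sigma>" "P = (\<lambda>e. holds M \<phi> (map e [0..<n]))" by blast
    have "definable M A (\<lambda>e :: nat \<Rightarrow> 'a. holds M \<phi> (map (case_sum e id) (map Inl [0..<n])))"
      by (rule definable_holds) (use assms(3) \<phi> in auto)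
    then show "definable M A P" using \<phi> by (simp add: o_def)
  next
    fix P0 assume P0: "P0 \<subseteq> ?Ps" "finite P0"
    obtain S0 where S0: "S0 \<subseteq> \<Sigma>" "finite S0" "P0 = (\<lambda>\<phi> e. holds M \<phi> (map e [0..<n])) ` S0"
      using finite_subset_image[OF P0(2,1)] by blast
    then obtain b where b: "realizes M n b S0" using assms(4) by (auto simp: finsat_def)
    define e where "e i = (if i < n then b ! i else a0)" for i
    have "map e [0..<n] = b" using b by (auto simp: e_def realizes_def intro: nth_equalityI)
    moreover have "range e \<subseteq> dom M" using b a0 by (force simp: e_def realizes_def)
    ultimately show "\<exists>e. range e \<subseteq> dom M \<and> (\<forall>P\<in>P0. P e)"
      using b S0 by (intro exI[of _ e]) (auto simp: realizes_def)
  qed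
  then obtain e where "range e \<subseteq> dom M" "\<forall>P\<in>?Ps. P e" by blast
  then have "realizes M n (map e [0..<n]) \<Sigma>" by (force simp: realizes_def)
  then show ?thesis by (rule that)
qed

section \<open>Global types and their restrictions to small sets\<close>

lemma gtypeD: "gtype M n p \<Longrightarrow> \<phi> \<in> p \<Longrightarrow> fml M (dom M) n \<phi>"
  by (auto simp: gtype_def)

lemma gtype_conseq:
  assumes "gtype M n p" "S \<subseteq> p" "finite S" "fml M (dom M) n \<theta>"
    "\<And>xs. length xs = n \<Longrightarrow> set xs \<subseteq> dom M \<Longrightarrow> (\<forall>\<phi>\<in>S. holds M \<phi> xs) \<Longrightarrow> holds M \<theta> xs"
  shows "\<theta> \<in> p"
proof (rule ccontr)
  assume "\<theta> \<notin> p"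
  then have "Neg \<theta> \<in> p" using assms by (auto simp: gtype_def)
  then have "insert (Neg \<theta>) S \<subseteq> p" using assms by auto
  then obtain b where "realizes M n b (insert (Neg \<theta>) S)"
    using assms(1,3) unfolding gtype_def finsat_def by (meson finite_insert)
  then show False using assms(5)[of b] by (auto simp: realizes_def)
qed

lemma gtype_Neg:
  assumes "gtype M n p" "fml M (dom M) n \<phi>"
  shows "Neg \<phi> \<in> p \<longleftrightarrow> \<phi> \<notin> p"
proof
  assume "Neg \<phi> \<in> p"
  show "\<phi> \<notin> p"
  proof
    assume "\<phi> \<in> p"
    then have "FF \<in> p"
      using gtype_conseq[OF assms(1), of "{\<phi>, Neg \<phi>}" FF] \<open>Neg \<phi> \<in> p\<close> by (auto simp: fml_def fv_def)
    then have "finsat M n {FF}" using assms(1) unfolding gtype_def finsat_def by blast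
    then show False by (auto simp: finsat_def realizes_def holds_def)
  qed
qed (use assms in \<open>auto simp: gtype_def\<close>)

lemma gtype_realize:
  assumes "gtype M n p" "B \<subseteq> dom M" "B \<prec> K"
  obtains b where "realizes M n b (restr p B)"
proof (rule realize_type[OF assms(2,3), of "restr p B" n])
  show "fml M B n \<phi>" if "\<phi> \<in> restr p B" for \<phi>
    using gtypeD[OF assms(1)] that by (auto simp: restr_def fml_def)
  show "finsat M n (restr p B)"
    using assms(1) unfolding gtype_def finsat_def restr_def by (metis (no_types, lifting) mem_Collect_eq subset_iff)
qed (rule that)

lemma gtype_mem:
  assumes "gtype M n p" "B \<subseteq> dom M" "realizes M n b (restr p B)" "fml M B n \<phi>"
  shows "holds M \<phi> b \<longleftrightarrow> \<phi> \<in> p"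
proof -
  have f: "fml M (dom M) n \<phi>" using assms fml_mono by blast
  show ?thesis
  proof
    assume h: "holds M \<phi> b"
    show "\<phi> \<in> p"
    proof (rule ccontr)
      assume "\<phi> \<notin> p"
      then have "Neg \<phi> \<in> restr p B" using gtype_Neg[OF assms(1) f] assms(4) by (auto simp: restr_def fml_def)
      then show False using assms(3) h unfolding realizes_def by fastforce
    qed
  qed (use assms in \<open>auto simp: realizes_def restr_def fml_def\<close>)
qed

lemma realizes_restr_mono: "realizes M n b (restr p B) \<Longrightarrow> B' \<subseteq> B \<Longrightarrow> realizes M n b (restr p B')"
  by (auto simp: realizes_def restr_def)

lemma tp_subset_restr_iff:
  assumes "gtype M n p" "A \<subseteq> dom M" "length b = n" "set b \<subseteq> dom M"
  shows "tp M A b \<subseteq> p \<longleftrightarrow> realizes M n b (restr p A)"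
proof
  assume t: "tp M A b \<subseteq> p"
  have "holds M \<phi> b" if "\<phi> \<in> p" "params \<phi> \<subseteq> A" for \<phi>
  proof (rule ccontr)
    assume n: "\<not> holds M \<phi> b"
    have f: "fml M (dom M) n \<phi>" using gtypeD[OF assms(1)] that by blast
    then have "Neg \<phi> \<in> tp M A b" using that n assms by (auto simp: tp_def fml_def fv_def)
    then show False using t that gtype_Neg[OF assms(1) f] by blast
  qed
  then show "realizes M n b (restr p A)" using assms by (auto simp: realizes_def restr_def)
next
  assume "realizes M n b (restr p A)"
  then show "tp M A b \<subseteq> p" using gtype_mem[OF assms(1,2)] assms(3) by (auto simp: tp_def)
qed

section \<open>Automorphisms and invariant types\<close>

definition autf :: "'a set \<Rightarrow> ('a \<Rightarrow> 'a) \<Rightarrow> bool" where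
  "autf A \<sigma> \<longleftrightarrow> aut M \<sigma> \<and> (\<forall>a\<in>A. \<sigma> a = a)"

lemma aut_dom: "aut M \<sigma> \<Longrightarrow> a \<in> dom M \<Longrightarrow> \<sigma> a \<in> dom M"
  by (auto simp: aut_def bij_betw_def)

lemma aut_dom_set: "aut M \<sigma> \<Longrightarrow> set c \<subseteq> dom M \<Longrightarrow> set (map \<sigma> c) \<subseteq> dom M"
  using aut_dom by auto

lemma evalt_dom: "range e \<subseteq> dom M \<Longrightarrow> params_t t \<subseteq> dom M \<Longrightarrow> wf_t M t \<Longrightarrow> evalt M e t \<in> dom M"
proof (induction t)
  case (App f ts)
  have "evalt M e t \<in> dom M" if "t \<in> set ts" for t
    using App.IH[OF that App.prems(1)] App.prems(2,3) that by auto
  then have "set (map (evalt M e) ts) \<subseteq> dom M" by auto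
  moreover have "length (map (evalt M e) ts) = arF M f" using App.prems by simp
  ultimately have "fnc M f (map (evalt M e) ts) \<in> dom M" using struc unfolding is_struc_def by blast
  then show ?case by simp
qed auto

lemma aut_evalt:
  "aut M \<sigma> \<Longrightarrow> range e \<subseteq> dom M \<Longrightarrow> params_t t \<subseteq> dom M \<Longrightarrow> wf_t M t \<Longrightarrow>
    evalt M (\<lambda>i. \<sigma> (e i)) (pmap_t \<sigma> t) = \<sigma> (evalt M e t)"
proof (induction t)
  case (App f ts)
  have "evalt M e t \<in> dom M" if "t \<in> set ts" for t
    using evalt_dom[of e t] App.prems(2-4) that by auto
  then have "set (map (evalt M e) ts) \<subseteq> dom M" by auto
  then have "\<sigma> (fnc M f (map (evalt M e) ts)) = fnc M f (map \<sigma> (map (evalt M e) ts))"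
    using App.prems(1,4) unfolding aut_def by simp
  moreover have "map (evalt M (\<lambda>i. \<sigma> (e i)) \<circ> pmap_t \<sigma>) ts = map (\<sigma> \<circ> evalt M e) ts"
    using App by (intro map_cong) auto
  ultimately show ?case by (simp del: map_eq_conv)
qed auto

lemma aut_sat:
  assumes \<sigma>: "aut M \<sigma>"
  shows "range e \<subseteq> dom M \<Longrightarrow> params \<phi> \<subseteq> dom M \<Longrightarrow> wf M \<phi> \<Longrightarrow>
    sat M (\<lambda>i. \<sigma> (e i)) (pmap \<sigma> \<phi>) \<longleftrightarrow> sat M e \<phi>"
proof (induction \<phi> arbitrary: e)
  case (Eq s t)
  have "inj_on \<sigma> (dom M)" using \<sigma> by (auto simp: aut_def bij_betw_def)
  then show ?case using Eq aut_evalt[OF \<sigma>, of e] evalt_dom[of e] by (auto simp: inj_on_def)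
next
  case (Rel R ts)
  have "evalt M e t \<in> dom M" if "t \<in> set ts" for t
    using evalt_dom[of e t] Rel.prems that by auto
  then have "set (map (evalt M e) ts) \<subseteq> dom M" by auto
  have "rel M R (map \<sigma> (map (evalt M e) ts)) \<longleftrightarrow> rel M R (map (evalt M e) ts)"
  proof -
    have "\<forall>R as. set as \<subseteq> dom M \<and> length as = arR M R \<longrightarrow> (rel M R (map \<sigma> as) \<longleftrightarrow> rel M R as)"
      using \<sigma> by (simp add: aut_def)
    from this[rule_format, of "map (evalt M e) ts" R] show ?thesis
      using Rel.prems(3) \<open>set (map (evalt M e) ts) \<subseteq> dom M\<close> by simp
  qed
  moreover have "map (evalt M (\<lambda>i. \<sigma> (e i)) \<circ> pmap_t \<sigma>) ts = map (\<sigma> \<circ> evalt M e) ts"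
    using Rel by (intro map_cong) (auto intro!: aut_evalt[OF \<sigma>])
  ultimately show ?case by (metis list.map_comp pmap.simps(3) sat.simps(3))
next
  case (Ex \<phi>)
  have *: "sat M (case_nat (\<sigma> a) (\<lambda>i. \<sigma> (e i))) (pmap \<sigma> \<phi>) \<longleftrightarrow> sat M (case_nat a e) \<phi>" if "a \<in> dom M" for a
  proof -
    have "case_nat (\<sigma> a) (\<lambda>i. \<sigma> (e i)) = (\<lambda>i. \<sigma> (case_nat a e i))" by (auto split: nat.split)
    moreover have "range (case_nat a e) \<subseteq> dom M" using that Ex.prems(1) by (force split: nat.split)
    ultimately show ?thesis using Ex by simp
  qed
  have "dom M = \<sigma> ` dom M" using \<sigma> by (auto simp: aut_def bij_betw_def)
  then have "(\<exists>a\<in>dom M. sat M (case_nat a (\<lambda>i. \<sigma> (e i))) (pmap \<sigma> \<phi>)) \<longleftrightarrow>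
    (\<exists>a\<in>dom M. sat M (case_nat (\<sigma> a) (\<lambda>i. \<sigma> (e i))) (pmap \<sigma> \<phi>))" by (metis (no_types, lifting) image_iff)
  then show ?case using * by simp
qed auto

lemma aut_holds:
  assumes "aut M \<sigma>" "fml M (dom M) (length xs) \<phi>" "set xs \<subseteq> dom M"
  shows "holds M (pmap \<sigma> \<phi>) (map \<sigma> xs) \<longleftrightarrow> holds M \<phi> xs"
proof -
  obtain a0 where a0: "a0 \<in> dom M" using dom_ne by blast
  define e where "e i = (if i < length xs then xs ! i else a0)" for i
  have "range e \<subseteq> dom M" using assms a0 by (force simp: e_def)
  then have "sat M (\<lambda>i. \<sigma> (e i)) (pmap \<sigma> \<phi>) \<longleftrightarrow> sat M e \<phi>"
    using assms by (intro aut_sat) (auto simp: fml_def)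
  moreover have "holds M (pmap \<sigma> \<phi>) (map \<sigma> xs) \<longleftrightarrow> sat M (\<lambda>i. \<sigma> (e i)) (pmap \<sigma> \<phi>)"
    by (rule holds_sat) (use assms in \<open>auto simp: fml_def e_def\<close>)
  moreover have "holds M \<phi> xs \<longleftrightarrow> sat M e \<phi>"
    by (rule holds_sat) (use assms in \<open>auto simp: fml_def e_def\<close>)
  ultimately show ?thesis by simp
qed

lemma autf_holds:
  assumes "autf A \<sigma>" "A \<subseteq> dom M" "fml M A (length xs) \<phi>" "set xs \<subseteq> dom M"
  shows "holds M \<phi> (map \<sigma> xs) \<longleftrightarrow> holds M \<phi> xs"
proof -
  have "pmap \<sigma> \<phi> = \<phi>" using assms by (intro pmap_id_on) (auto simp: autf_def fml_def)
  moreover have "fml M (dom M) (length xs) \<phi>" using assms fml_mono by blast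
  ultimately show ?thesis using aut_holds[of \<sigma> xs \<phi>] assms by (simp add: autf_def)
qed

lemma autf_tp:
  assumes "autf A \<sigma>" "A \<subseteq> dom M" "set c \<subseteq> dom M"
  shows "tp M A (map \<sigma> c) = tp M A c"
  using autf_holds[OF assms(1,2)] assms(3) by (auto simp: tp_def)

lemma aut_inv:
  assumes "aut M \<sigma>"
  shows "aut M (inv_into (dom M) \<sigma>)" "\<And>a. a \<in> dom M \<Longrightarrow> inv_into (dom M) \<sigma> (\<sigma> a) = a"
    "\<And>a. a \<in> dom M \<Longrightarrow> \<sigma> (inv_into (dom M) \<sigma> a) = a"
proof -
  let ?\<tau> = "inv_into (dom M) \<sigma>"
  have b: "bij_betw \<sigma> (dom M) (dom M)" using assms by (simp add: aut_def)
  show 1: "\<And>a. a \<in> dom M \<Longrightarrow> ?\<tau> (\<sigma> a) = a" using b by (simp add: bij_betw_def)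
  show 2: "\<And>a. a \<in> dom M \<Longrightarrow> \<sigma> (?\<tau> a) = a" using b by (simp add: bij_betw_inv_into_right)
  have bt: "bij_betw ?\<tau> (dom M) (dom M)" using b by (rule bij_betw_inv_into)
  have m: "set (map ?\<tau> as) \<subseteq> dom M" "map \<sigma> (map ?\<tau> as) = as" if "set as \<subseteq> dom M" for as
    using that bt 2 by (auto simp: bij_betw_def intro!: map_idI)
  show "aut M ?\<tau>"
    unfolding aut_def
  proof (intro conjI allI impI bt)
    fix f as assume as: "set as \<subseteq> dom M \<and> length as = arF M f"
    then have "\<sigma> (fnc M f (map ?\<tau> as)) = fnc M f as"
      using assms m[of as] unfolding aut_def by (metis length_map)
    moreover have "fnc M f (map ?\<tau> as) \<in> dom M"
      using struc m[of as] as unfolding is_struc_def by (metis length_map)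
    ultimately show "?\<tau> (fnc M f as) = fnc M f (map ?\<tau> as)" using 1 by metis
  next
    fix R as assume as: "set as \<subseteq> dom M \<and> length as = arR M R"
    then show "rel M R (map ?\<tau> as) \<longleftrightarrow> rel M R as"
      using assms m[of as] unfolding aut_def by (metis length_map)
  qed
qed

lemma autf_inv:
  assumes "autf A \<sigma>" "A \<subseteq> dom M"
  shows "autf A (inv_into (dom M) \<sigma>)"
  using assms aut_inv unfolding autf_def by (metis subsetD)

text \<open>Equality of types covers equations between entries of the tuple and between entries and
  elements of \<open>A\<close>. The coordinatewise map is therefore well defined and elementary, and
  strong homogeneity extends it.\<close>

lemma homogeneity:
  assumes A: "A \<subseteq> dom M" "A \<prec> K" and cd: "set c \<subseteq> dom M" "set d \<subseteq> dom M" "length c = length d"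
    and tp: "tp M A c = tp M A d"
  obtains \<sigma> where "autf A \<sigma>" "map \<sigma> c = d"
proof -
  have tpD: "holds M \<phi> c \<longleftrightarrow> holds M \<phi> d" if "fml M A (length c) \<phi>" for \<phi>
    using tp that cd(3) by (auto simp: tp_def)
  \<comment> \<open>Tuples may repeat entries; the least position gives each element one
    representative.\<close>
  define idx where "idx a = (LEAST i. i < length c \<and> c ! i = a)" for a
  have idx: "idx a < length c" "c ! idx a = a" if "a \<in> set c" for a
    using that LeastI_ex[of "\<lambda>i. i < length c \<and> c ! i = a"] unfolding idx_def in_set_conv_nth by auto
  define g where "g a = (if a \<in> A then a else d ! idx a)" for a
  have gc: "g (c ! i) = d ! i" if i: "i < length c" for i
  proof (cases "c ! i \<in> A")
    case True
    have "holds M (Eq (Var i) (Par (c ! i))) c" using i by (simp add: holds_def)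
    then have "holds M (Eq (Var i) (Par (c ! i))) d"
      using tpD[of "Eq (Var i) (Par (c ! i))"] i True by (simp add: fml_def fv_def)
    then show ?thesis using True i cd by (simp add: holds_def g_def)
  next
    case False
    have "c ! i \<in> set c" using i by simp
    note j = idx[OF this]
    have "holds M (Eq (Var i) (Var (idx (c ! i)))) c" using i j by (simp add: holds_def)
    then have "holds M (Eq (Var i) (Var (idx (c ! i)))) d"
      using tpD[of "Eq (Var i) (Var (idx (c ! i)))"] i j by (simp add: fml_def fv_def)
    then show ?thesis using False i j cd by (simp add: holds_def g_def)
  qed
  have "elementary_map M (A \<union> set c) g"
    unfolding elementary_map_def
  proof (intro conjI allI impI)
    show "A \<union> set c \<subseteq> dom M" using A cd by auto
    have "g x \<in> dom M" if x: "x \<in> A \<union> set c" for x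
    proof (cases "x \<in> A")
      case False
      then obtain i where "i < length c" "x = c ! i" using x by (auto simp: in_set_conv_nth)
      then show ?thesis using gc cd by auto
    qed (use A in \<open>auto simp: g_def\<close>)
    then show "g ` (A \<union> set c) \<subseteq> dom M" by blast
    fix \<phi> e assume \<phi>: "sentence M \<phi> \<and> params \<phi> \<subseteq> A \<union> set c"
    \<comment> \<open>A sentence over \<open>A\<close> and \<open>c\<close> becomes a formula over
      \<open>A\<close> by replacing the elements outside \<open>A\<close> by the variables for their
      positions. Evaluated at \<open>c\<close> it gives back the sentence, at \<open>d\<close> its
      image under \<open>g\<close>.\<close>
    define \<beta> where "\<beta> a = (if a \<in> A then Inr a else Inl (idx a))" for a
    let ?\<psi> = "sb 0 Inl \<beta> \<phi>"
    have fv: "fv \<phi> = {}" using \<phi> by (simp add: sentence_def)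
    have f: "fml M A (length c) ?\<psi>"
    proof -
      have "fv ?\<psi> \<subseteq> {..<length c}"
        using fv_sb[of Inl \<beta> \<phi>] fv \<phi> idx(1) by (fastforce simp: \<beta>_def split: if_splits)
      moreover have "params ?\<psi> \<subseteq> A"
        using params_sb[of Inl \<beta> \<phi>] by (fastforce simp: \<beta>_def split: if_splits)
      ultimately show ?thesis using \<phi> by (simp add: fml_def sentence_def)
    qed
    have "holds M ?\<psi> c \<longleftrightarrow> sat M e \<phi>"
    proof -
      let ?e = "\<lambda>i. if i < length c then c ! i else undefined"
      have "holds M ?\<psi> c \<longleftrightarrow> sat M ?e ?\<psi>"
        by (rule holds_sat) (use f in \<open>auto simp: fml_def\<close>)
      also have "\<dots> \<longleftrightarrow> sat M (\<lambda>i. val ?e (Inl i)) \<phi>"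
      proof (rule sat_sb_id)
        fix a assume "a \<in> params \<phi>"
        then have "a \<in> A \<or> a \<in> set c" using \<phi> by blast
        then show "val ?e (\<beta> a) = a" using idx by (auto simp: \<beta>_def)
      qed
      also have "\<dots> \<longleftrightarrow> sat M e \<phi>" by (rule sat_cong) (simp add: fv)
      finally show ?thesis .
    qed
    moreover have "holds M ?\<psi> d \<longleftrightarrow> sat M e (pmap g \<phi>)"
    proof -
      let ?e = "\<lambda>i. if i < length d then d ! i else undefined"
      have "holds M ?\<psi> d \<longleftrightarrow> sat M ?e ?\<psi>"
        by (rule holds_sat) (use f cd in \<open>auto simp: fml_def\<close>)
      also have "\<dots> \<longleftrightarrow> sat M (\<lambda>i. val ?e (Inl i)) (pmap (\<lambda>a. val ?e (\<beta> a)) \<phi>)" by (rule sat_sb)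
      also have "pmap (\<lambda>a. val ?e (\<beta> a)) \<phi> = pmap g \<phi>"
      proof (rule pmap_cong)
        fix a assume "a \<in> params \<phi>"
        then have "a \<in> A \<or> a \<in> set c" using \<phi> by blast
        then show "val ?e (\<beta> a) = g a" using idx cd by (auto simp: \<beta>_def g_def)
      qed
      also have "sat M (\<lambda>i. val ?e (Inl i)) (pmap g \<phi>) \<longleftrightarrow> sat M e (pmap g \<phi>)"
        by (rule sat_cong) (simp add: fv)
      finally show ?thesis .
    qed
    ultimately show "sat M e \<phi> \<longleftrightarrow> sat M e (pmap g \<phi>)" using tpD[OF f] by simp
  qed
  then obtain \<sigma> where \<sigma>: "aut M \<sigma>" "\<forall>a\<in>A \<union> set c. \<sigma> a = g a"
    using homogeneous[OF small_Un_set[OF A(2)]] by blast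
  show ?thesis
  proof (rule that)
    show "autf A \<sigma>" using \<sigma> by (auto simp: autf_def g_def)
    show "map \<sigma> c = d" using \<sigma> gc cd by (intro nth_equalityI) auto
  qed
qed

lemma invariantD: "invariant M A n p \<Longrightarrow> gtype M n p"
  by (simp add: invariant_def)

lemma invariant_pmap: "invariant M A n p \<Longrightarrow> autf A \<sigma> \<Longrightarrow> \<phi> \<in> p \<Longrightarrow> pmap \<sigma> \<phi> \<in> p"
  unfolding invariant_def autf_def by blast

text \<open>A formula of \<open>p\<close> over the image set is pulled back by the inverse
  automorphism; invariance keeps the result in \<open>p\<close>, where \<open>b\<close> satisfies
  it.\<close>

lemma realizes_aut:
  assumes p: "invariant M A n p" and \<sigma>: "autf A \<sigma>" and A: "A \<subseteq> dom M" and B: "B \<subseteq> dom M"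
    and b: "realizes M n b (restr p B)"
  shows "realizes M n (map \<sigma> b) (restr p (\<sigma> ` B))"
  unfolding realizes_def
proof (intro conjI ballI)
  have s: "aut M \<sigma>" using \<sigma> by (simp add: autf_def)
  show "length (map \<sigma> b) = n" using b by (simp add: realizes_def)
  show "set (map \<sigma> b) \<subseteq> dom M" using b aut_dom_set[OF s] by (simp add: realizes_def)
  fix \<phi> assume \<phi>: "\<phi> \<in> restr p (\<sigma> ` B)"
  let ?\<tau> = "inv_into (dom M) \<sigma>"
  have f: "fml M (dom M) n \<phi>" using gtypeD[OF invariantD[OF p]] \<phi> by (auto simp: restr_def)
  have 1: "pmap ?\<tau> \<phi> \<in> p" using invariant_pmap[OF p autf_inv[OF \<sigma> A]] \<phi> by (auto simp: restr_def)
  have "?\<tau> ` \<sigma> ` B = B" using aut_inv(2)[OF s] B by (force simp: image_image)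
  moreover have "params (pmap ?\<tau> \<phi>) \<subseteq> ?\<tau> ` \<sigma> ` B"
    unfolding params_pmap by (rule image_mono) (use \<phi> in \<open>simp add: restr_def\<close>)
  ultimately have "params (pmap ?\<tau> \<phi>) \<subseteq> B" by simp
  then have "holds M (pmap ?\<tau> \<phi>) b" using b 1 by (auto simp: realizes_def restr_def)
  moreover have "fml M (dom M) (length b) (pmap ?\<tau> \<phi>)"
    using gtypeD[OF invariantD[OF p] 1] b by (simp add: realizes_def)
  ultimately have "holds M (pmap \<sigma> (pmap ?\<tau> \<phi>)) (map \<sigma> b)"
    using aut_holds[OF s] b by (simp add: realizes_def)
  moreover have "pmap \<sigma> (pmap ?\<tau> \<phi>) = \<phi>"
    unfolding pmap_comp by (rule pmap_id_on) (use f aut_inv(3)[OF s] in \<open>auto simp: fml_def\<close>)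
  ultimately show "holds M \<phi> (map \<sigma> b)" by simp
qed

text \<open>An automorphism over \<open>A\<close> carries \<open>B\<close> to \<open>B'\<close>, and
  by invariance it carries \<open>c\<close> to a realization of \<open>p\<close> over
  \<open>B'\<close>. There \<open>p\<close> decides every formula, so this realization cannot be
  told apart from \<open>c'\<close>.\<close>

lemma stationarity:
  assumes A: "A \<subseteq> dom M" "A \<prec> K" and p: "invariant M A n p"
    and B: "set B \<subseteq> dom M" "set B' \<subseteq> dom M" "length B = length B'" "tp M A B = tp M A B'"
    and c: "realizes M n c (restr p (A \<union> set B))" "realizes M n c' (restr p (A \<union> set B'))"
  shows "tp M A (c @ B) = tp M A (c' @ B')"
proof -
  obtain \<sigma> where \<sigma>: "autf A \<sigma>" "map \<sigma> B = B'" using homogeneity[OF A B] by blast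
  have "\<sigma> ` (A \<union> set B) = A \<union> set B'" using \<sigma> by (force simp: autf_def image_Un image_iff)
  then have c1: "realizes M n (map \<sigma> c) (restr p (A \<union> set B'))"
    using realizes_aut[OF p \<sigma>(1) A(1) _ c(1)] A B by simp
  have l: "length c = n" "length c' = n" "set c \<subseteq> dom M" using c by (auto simp: realizes_def)
  have "holds M \<theta> (c @ B) \<longleftrightarrow> holds M \<theta> (c' @ B')" if f: "fml M A (n + length B) \<theta>" for \<theta>
  proof -
    have f': "fml M A (n + length B') \<theta>" using f B by simp
    have "holds M \<theta> (c @ B) \<longleftrightarrow> holds M \<theta> (map \<sigma> (c @ B))"
      using autf_holds[OF \<sigma>(1) A(1), of "c @ B" \<theta>] f l B by simp
    also have "\<dots> \<longleftrightarrow> holds M (inst n \<theta> B') (map \<sigma> c)"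
      using holds_inst[OF f', of "map \<sigma> c"] l \<sigma> by simp
    also have "\<dots> \<longleftrightarrow> inst n \<theta> B' \<in> p"
      using gtype_mem[OF invariantD[OF p] _ c1 fml_inst[OF f']] A B by simp
    also have "\<dots> \<longleftrightarrow> holds M (inst n \<theta> B') c'"
      using gtype_mem[OF invariantD[OF p] _ c(2) fml_inst[OF f']] A B by simp
    also have "\<dots> \<longleftrightarrow> holds M \<theta> (c' @ B')" using holds_inst[OF f', of c'] l by simp
    finally show ?thesis .
  qed
  then show ?thesis using l B by (auto simp: tp_def)
qed

section \<open>Morley sequences\<close>

text \<open>The most recent element of the sequence comes first.\<close>

fun mlist :: "'a set \<Rightarrow> nat \<Rightarrow> ('f, 'r, 'a) fm set \<Rightarrow> 'a list list \<Rightarrow> bool" where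
  "mlist A n p [] = True"
| "mlist A n p (c # L) = (realizes M n c (restr p (A \<union> set (concat L))) \<and> mlist A n p L)"

lemma mlist_block: "mlist A n p L \<Longrightarrow> c \<in> set L \<Longrightarrow> length c = n \<and> set c \<subseteq> dom M"
  by (induction L) (auto simp: realizes_def)

lemma length_concat_blocks: "(\<And>c. c \<in> set L \<Longrightarrow> length c = n) \<Longrightarrow> length (concat L) = length L * n"
  by (induction L) auto

lemma blocks_eqI:
  assumes "concat L = concat L'" "length L = length L'"
    "\<And>c. c \<in> set L \<Longrightarrow> length c = n" "\<And>c. c \<in> set L' \<Longrightarrow> length c = n"
  shows "L = L'"
proof (rule concat_injective[OF assms(1,2)])
  show "\<forall>(x, y)\<in>set (zip L L'). length x = length y"
    using assms(3,4) set_zip_leftD set_zip_rightD by fastforce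
qed

lemma mlist_tp:
  assumes A: "A \<subseteq> dom M" "A \<prec> K" and p: "invariant M A n p"
  shows "mlist A n p L \<Longrightarrow> mlist A n p L' \<Longrightarrow> length L = length L' \<Longrightarrow> tp M A (concat L) = tp M A (concat L')"
proof (induction L arbitrary: L')
  case (Cons c L)
  then obtain c' L'' where L': "L' = c' # L''" by (cases L') auto
  have "set (concat L) \<subseteq> dom M" "set (concat L'') \<subseteq> dom M"
    using Cons.prems L' mlist_block[of A n p] by fastforce+
  moreover have "length (concat L) = length (concat L'')"
    using length_concat_blocks[of L n] length_concat_blocks[of L'' n] Cons.prems L'
      mlist_block[of A n p] by auto
  moreover have "tp M A (concat L) = tp M A (concat L'')" using Cons L' by simp
  ultimately show ?case using stationarity[OF A p] Cons.prems L' by simp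
qed simp

lemma mlist_aut:
  assumes A: "A \<subseteq> dom M" "A \<prec> K" and p: "invariant M A n p"
    and L: "mlist A n p L" "mlist A n p L'" "length L = length L'"
  obtains \<sigma> where "autf A \<sigma>" "map (map \<sigma>) L = L'"
proof -
  have b: "length c = n \<and> set c \<subseteq> dom M" if "c \<in> set L \<union> set L'" for c
    using L that mlist_block[of A n p] by blast
  have "set (concat L) \<subseteq> dom M" "set (concat L') \<subseteq> dom M" using b by auto
  moreover have "length (concat L) = length (concat L')"
    using length_concat_blocks[of L n] length_concat_blocks[of L' n] b L(3) by auto
  ultimately obtain \<sigma> where \<sigma>: "autf A \<sigma>" "map \<sigma> (concat L) = concat L'"
    using homogeneity[OF A _ _ _ mlist_tp[OF A p L]] by blast
  have "map (map \<sigma>) L = L'"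
    by (rule blocks_eqI[where n = n]) (use \<sigma> b L in \<open>auto simp: map_concat\<close>)
  then show ?thesis using that \<sigma> by blast
qed

text \<open>Phrased for sets of tuples, so that automorphisms act by taking images. Different
  indices may carry equal tuples, which is why the number \<open>k\<close> is always counted by list
  lengths or by sets of indices.\<close>

definition jsat :: "nat \<Rightarrow> ('f, 'r, 'a) fm \<Rightarrow> 'a list set \<Rightarrow> bool" where
  "jsat m \<phi> S \<longleftrightarrow> (\<exists>xs. length xs = m \<and> set xs \<subseteq> dom M \<and> (\<forall>b\<in>S. holds M \<phi> (xs @ b)))"

lemma fam_sat_jsat: "fam_sat M m \<phi> bs J \<longleftrightarrow> jsat m \<phi> (bs ` J)"
  by (simp add: fam_sat_def jsat_def)

lemma jsat_mono: "jsat m \<phi> S \<Longrightarrow> S' \<subseteq> S \<Longrightarrow> jsat m \<phi> S'"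
  unfolding jsat_def by blast

lemma jsat_aut:
  assumes "autf A \<sigma>" "A \<subseteq> dom M" "fml M A (m + n) \<phi>"
    "\<And>b. b \<in> S \<Longrightarrow> length b = n \<and> set b \<subseteq> dom M" "jsat m \<phi> S"
  shows "jsat m \<phi> (map \<sigma> ` S)"
proof -
  obtain xs where xs: "length xs = m" "set xs \<subseteq> dom M" "\<forall>b\<in>S. holds M \<phi> (xs @ b)"
    using assms(5) unfolding jsat_def by blast
  have "holds M \<phi> (map \<sigma> xs @ map \<sigma> b)" if "b \<in> S" for b
    using autf_holds[OF assms(1,2), of "xs @ b" \<phi>] xs assms(3,4) that by simp
  moreover have "set (map \<sigma> xs) \<subseteq> dom M" using aut_dom_set assms(1) xs by (simp add: autf_def)
  ultimately show ?thesis unfolding jsat_def using xs(1)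
    by (intro exI[of _ "map \<sigma> xs"]) simp
qed

lemma mlist_jsat:
  assumes A: "A \<subseteq> dom M" "A \<prec> K" and p: "invariant M A n p" and "fml M A (m + n) \<phi>"
    and L: "mlist A n p L" "mlist A n p L'" "length L = length L'" and "jsat m \<phi> (set L)"
  shows "jsat m \<phi> (set L')"
proof -
  obtain \<sigma> where "autf A \<sigma>" "map (map \<sigma>) L = L'" using mlist_aut[OF A p L] by blast
  then show ?thesis using jsat_aut[of A \<sigma> m n \<phi> "set L"] assms mlist_block[OF L(1)] by auto
qed

lemma morley_exists:
  assumes "gtype M n p" "A \<subseteq> dom M" "A \<prec> K"
  obtains bs where "morley M A n p bs"
proof -
  define nxt where "nxt L = (SOME c. realizes M n c (restr p (A \<union> set (concat L))))" for L :: "'a list list"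
  define LL where "LL i = ((\<lambda>L. L @ [nxt L]) ^^ i) []" for i
  have LS: "LL (Suc i) = LL i @ [nxt (LL i)]" for i by (simp add: LL_def)
  have ln: "length (LL i) = i" for i by (induction i) (simp_all add: LS, simp add: LL_def)
  have d: "set (concat (LL i)) \<subseteq> dom M \<and> realizes M n (nxt (LL i)) (restr p (A \<union> set (concat (LL i))))" for i
  proof -
    have r: "realizes M n (nxt L) (restr p (A \<union> set (concat L)))" if "set (concat L) \<subseteq> dom M" for L
      unfolding nxt_def
      using gtype_realize[OF assms(1), of "A \<union> set (concat L)"] that assms(2) small_Un_set[OF assms(3)]
      by (metis (no_types, lifting) Un_subset_iff someI_ex)
    have "set (concat (LL i)) \<subseteq> dom M"
    proof (induction i)
      case (Suc i)
      then show ?case using r[OF Suc] by (auto simp: LS realizes_def)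
    qed (simp add: LL_def)
    then show ?thesis using r by blast
  qed
  define bs where "bs i = nxt (LL i)" for i
  have LLbs: "LL i = map bs [0..<i]" for i
    by (induction i) (simp_all add: LS bs_def, simp add: LL_def)
  have "morley M A n p bs"
    unfolding morley_def
  proof
    fix i
    have "(\<Union>j<i. set (bs j)) = set (concat (LL i))" by (auto simp: LLbs)
    then show "realizes M n (bs i) (restr p (A \<union> (\<Union>j<i. set (bs j))))" using d[of i] by (simp add: bs_def)
  qed
  then show ?thesis by (rule that)
qed

lemma morley_mlist:
  assumes "morley M A n p bs"
  shows "sorted_wrt (<) is \<Longrightarrow> mlist A n p (map bs (rev is))"
proof (induction "is" rule: rev_induct)
  case (snoc i "is")
  then have "\<forall>j\<in>set is. j < i" by (auto simp: sorted_wrt_append)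
  then have "A \<union> set (concat (map bs (rev is))) \<subseteq> A \<union> (\<Union>j<i. set (bs j))" by auto
  moreover have "realizes M n (bs i) (restr p (A \<union> (\<Union>j<i. set (bs j))))"
    using assms by (simp add: morley_def)
  ultimately have "realizes M n (bs i) (restr p (A \<union> set (concat (map bs (rev is)))))"
    using realizes_restr_mono by blast
  then show ?case using snoc by (simp add: sorted_wrt_append)
qed simp

text \<open>Dividing only provides one inconsistent Morley sequence. By invariance all Morley
  sequences of the same length have the same type over \<open>A\<close>, so every list of length
  \<open>k\<close> inherits the inconsistency.\<close>

lemma k_divides_mlist:
  assumes A: "A \<subseteq> dom M" "A \<prec> K" and p: "invariant M A n p" and f: "fml M A (m + n) \<phi>"
    and k: "k_divides_along M A m \<phi> n p k" and L: "mlist A n p L" "length L = k"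
  shows "\<not> jsat m \<phi> (set L)"
proof
  assume j: "jsat m \<phi> (set L)"
  obtain bs where bs: "morley M A n p bs" "fam_k_inconsistent M m \<phi> bs UNIV k"
    using k unfolding k_divides_along_def by blast
  have "mlist A n p (map bs (rev [0..<k]))" by (rule morley_mlist[OF bs(1)]) simp
  then have "jsat m \<phi> (set (map bs (rev [0..<k])))"
    using mlist_jsat[OF A p f L(1) _ _ j, of "map bs (rev [0..<k])"] L(2) by simp
  then have "fam_sat M m \<phi> bs {0..<k}" by (simp add: fam_sat_jsat)
  then show False using bs(2) unfolding fam_k_inconsistent_def by (metis card_atLeastLessThan diff_zero finite_atLeastLessThan subset_UNIV)
qed

text \<open>Some infinite Morley sequence exists and is consistent by hypothesis; its initial
  segment of the right length is conjugate to \<open>L\<close>.\<close>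

lemma not_divides_mlist:
  assumes A: "A \<subseteq> dom M" "A \<prec> K" and p: "invariant M A n p" and f: "fml M A (m + n) \<phi>"
    and k: "\<not> divides_along M A m \<phi> n p" and L: "mlist A n p L"
  shows "jsat m \<phi> (set L)"
proof -
  obtain bs where bs: "morley M A n p bs" using morley_exists[OF invariantD[OF p] A] by blast
  then have "fam_consistent M m \<phi> bs UNIV" using k unfolding divides_along_def by blast
  then have "fam_sat M m \<phi> bs {0..<length L}" unfolding fam_consistent_def by blast
  then have "jsat m \<phi> (set (map bs (rev [0..<length L])))" by (simp add: fam_sat_jsat)
  moreover have "mlist A n p (map bs (rev [0..<length L]))" by (rule morley_mlist[OF bs]) simp
  ultimately show ?thesis using mlist_jsat[OF A p f _ L] by simp
qed

section \<open>Coheirs\<close>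

text \<open>The limit, or average type, of a family of tuples along an ultrafilter.\<close>

definition lim_tp :: "'i set set \<Rightarrow> ('i \<Rightarrow> 'a list) \<Rightarrow> nat \<Rightarrow> ('f, 'r, 'a) fm set" where
  "lim_tp U \<beta> n = {\<phi>. fml M (dom M) n \<phi> \<and> {i. holds M \<phi> (\<beta> i)} \<in> U}"

lemma coheir_lim_tp:
  assumes U: "ultra U" and A: "A \<subseteq> dom M" and \<beta>: "{i. length (\<beta> i) = n \<and> set (\<beta> i) \<subseteq> A} \<in> U"
  shows "coheir M A n (lim_tp U \<beta> n)"
proof -
  let ?p = "lim_tp U \<beta> n" and ?G = "{i. length (\<beta> i) = n \<and> set (\<beta> i) \<subseteq> A}"
  have "Neg \<phi> \<in> ?p" if "fml M (dom M) n \<phi>" "\<phi> \<notin> ?p" for \<phi>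
    using that ultra_Compl[OF U, of "{i. holds M \<phi> (\<beta> i)}"] by (auto simp: lim_tp_def Collect_neg_eq)
  moreover have "finsat M n ?p"
    unfolding finsat_def
  proof (intro allI impI)
    fix S0 assume S0: "S0 \<subseteq> ?p" "finite S0"
    have "{i. \<forall>\<phi>\<in>S0. i \<in> {i. holds M \<phi> (\<beta> i)}} \<in> U"
      by (rule ultra_ball[OF U S0(2)]) (use S0 in \<open>auto simp: lim_tp_def\<close>)
    then obtain i where "i \<in> {i. \<forall>\<phi>\<in>S0. i \<in> {i. holds M \<phi> (\<beta> i)}} \<inter> ?G"
      using ultra_ex[OF U ultra_Int[OF U _ \<beta>]] by blast
    then show "\<exists>b. realizes M n b S0" using A by (intro exI[of _ "\<beta> i"]) (auto simp: realizes_def)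
  qed
  ultimately have g: "gtype M n ?p" unfolding gtype_def by (auto simp: lim_tp_def)
  have "\<exists>xs. length xs = n \<and> set xs \<subseteq> A \<and> holds M \<phi> xs" if "\<phi> \<in> ?p" for \<phi>
  proof -
    have "{i. holds M \<phi> (\<beta> i)} \<in> U" using that by (simp add: lim_tp_def)
    then obtain i where "i \<in> {i. holds M \<phi> (\<beta> i)} \<inter> ?G" using ultra_ex[OF U ultra_Int[OF U _ \<beta>]] by blast
    then show ?thesis by blast
  qed
  then show ?thesis using g unfolding coheir_def by blast
qed

text \<open>If an automorphism over \<open>A\<close> moved a formula of \<open>p\<close> out of
  \<open>p\<close>, then the formula together with the negation of its image would have a solution
  in \<open>A\<close>. This solution is fixed by the automorphism, a contradiction.\<close>

lemma coheir_invariant: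
  assumes p: "coheir M A n p" and A: "A \<subseteq> dom M"
  shows "invariant M A n p"
proof -
  have g: "gtype M n p" using p by (simp add: coheir_def)
  have closed: "pmap \<sigma> \<phi> \<in> p" if \<sigma>: "autf A \<sigma>" and \<phi>: "\<phi> \<in> p" for \<sigma> \<phi>
  proof (rule ccontr)
    assume n: "pmap \<sigma> \<phi> \<notin> p"
    have s: "aut M \<sigma>" using \<sigma> by (simp add: autf_def)
    have f: "fml M (dom M) n \<phi>" using gtypeD[OF g \<phi>] .
    have f': "fml M (dom M) n (pmap \<sigma> \<phi>)" by (rule fml_pmap[OF f]) (use aut_dom[OF s] in auto)
    have "Neg (pmap \<sigma> \<phi>) \<in> p" using gtype_Neg[OF g f'] n by blast
    then have "Conj \<phi> (Neg (pmap \<sigma> \<phi>)) \<in> p"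
      using gtype_conseq[OF g, of "{\<phi>, Neg (pmap \<sigma> \<phi>)}" "Conj \<phi> (Neg (pmap \<sigma> \<phi>))"] \<phi> f f' by auto
    then obtain xs where xs: "length xs = n" "set xs \<subseteq> A" "holds M \<phi> xs" "\<not> holds M (pmap \<sigma> \<phi>) xs"
      using p unfolding coheir_def by (metis holds_Conj holds_Neg)
    have "map \<sigma> xs = xs" using \<sigma> xs(2) by (intro map_idI) (auto simp: autf_def)
    then show False using aut_holds[OF s, of xs \<phi>] f xs A by auto
  qed
  have "pmap \<sigma> ` p = p" if \<sigma>: "autf A \<sigma>" for \<sigma>
  proof
    show "pmap \<sigma> ` p \<subseteq> p" using closed[OF \<sigma>] by blast
    show "p \<subseteq> pmap \<sigma> ` p"
    proof
      fix \<phi> assume \<phi>: "\<phi> \<in> p"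
      have s: "aut M \<sigma>" using \<sigma> by (simp add: autf_def)
      have "pmap \<sigma> (pmap (inv_into (dom M) \<sigma>) \<phi>) = \<phi>"
        unfolding pmap_comp
        by (rule pmap_id_on) (use gtypeD[OF g \<phi>] aut_inv(3)[OF s] in \<open>auto simp: fml_def\<close>)
      moreover have "pmap (inv_into (dom M) \<sigma>) \<phi> \<in> p" using closed[OF autf_inv[OF \<sigma> A] \<phi>] .
      ultimately show "\<phi> \<in> pmap \<sigma> ` p" by (metis imageI)
    qed
  qed
  then show ?thesis using g unfolding invariant_def autf_def by blast
qed

text \<open>The solution sets in \<open>A\<close> of the formulas in the type are closed under
  finite intersection and nonempty. A limit along an ultrafilter containing them is a global coheir
  extending the type, hence an invariant extension.\<close>

lemma finsat_indep_i:
  assumes A: "A \<subseteq> dom M" and c: "set c \<subseteq> dom M" "set b \<subseteq> dom M"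
    and fs: "\<And>\<phi>. \<phi> \<in> tp M (A \<union> set b) c \<Longrightarrow> \<exists>xs. length xs = length c \<and> set xs \<subseteq> A \<and> holds M \<phi> xs"
  shows "indep_i M A c b"
proof -
  let ?t = "tp M (A \<union> set b) c"
  define X where "X \<phi> = {xs. length xs = length c \<and> set xs \<subseteq> A \<and> holds M \<phi> xs}" for \<phi>
  let ?I = "{Z. \<exists>\<phi>\<in>?t. Z \<inter> X \<phi> = {}}"
  have conj: "Conj \<phi> \<psi> \<in> ?t" if "\<phi> \<in> ?t" "\<psi> \<in> ?t" for \<phi> \<psi> using that by (auto simp: tp_def)
  have true: "Neg FF \<in> ?t" by (auto simp: tp_def fml_def fv_def holds_def)
  have "proper_ideal ?I"
    unfolding proper_ideal_def
  proof (intro conjI ballI allI impI)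
    show "{} \<in> ?I" using true by blast
    show "UNIV \<notin> ?I" using fs by (fastforce simp: X_def)
    fix Z Y assume "Z \<in> ?I" "Y \<in> ?I"
    then obtain \<phi> \<psi> where *: "\<phi> \<in> ?t" "\<psi> \<in> ?t" "Z \<inter> X \<phi> = {}" "Y \<inter> X \<psi> = {}" by blast
    have "(Z \<union> Y) \<inter> X (Conj \<phi> \<psi>) = {}" using * by (auto simp: X_def)
    then show "Z \<union> Y \<in> ?I" using conj[OF *(1,2)] by blast
  next
    fix Z Y assume "Z \<in> ?I" "Y \<subseteq> Z" then show "Y \<in> ?I" by blast
  qed
  then obtain U where U: "ultra U" "U \<inter> ?I = {}" by (rule ultra_avoiding_ideal)
  have XU: "X \<phi> \<in> U" if "\<phi> \<in> ?t" for \<phi>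
  proof (rule ccontr)
    assume "X \<phi> \<notin> U"
    then have "- X \<phi> \<in> U" using ultra_Compl[OF U(1)] by blast
    moreover have "- X \<phi> \<in> ?I" using that by blast
    ultimately show False using U(2) by blast
  qed
  have "{xs. length (id xs) = length c \<and> set (id xs) \<subseteq> A} \<in> U"
    by (rule ultra_mono[OF U(1) XU[OF true]]) (auto simp: X_def)
  then have co: "coheir M A (length c) (lim_tp U id (length c))"
    by (rule coheir_lim_tp[OF U(1) A])
  have "?t \<subseteq> lim_tp U id (length c)"
  proof
    fix \<phi> assume \<phi>: "\<phi> \<in> ?t"
    have "fml M (dom M) (length c) \<phi>" using \<phi> A c by (auto simp: tp_def intro: fml_mono)
    moreover have "{xs. holds M \<phi> (id xs)} \<in> U"
      by (rule ultra_mono[OF U(1) XU[OF \<phi>]]) (auto simp: X_def)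
    ultimately show "\<phi> \<in> lim_tp U id (length c)" by (simp add: lim_tp_def)
  qed
  then show ?thesis using coheir_invariant[OF co A] unfolding indep_i_def by blast
qed

lemma heir_coheir_bi_invariant:
  assumes "heir_coheir M A n p" "A \<subseteq> dom M"
  shows "bi_invariant M A n p"
  unfolding bi_invariant_def
proof (intro conjI allI impI)
  show "invariant M A n p" using assms coheir_invariant by (simp add: heir_coheir_def)
  fix b c assume *: "set c \<subseteq> dom M \<and> realizes M n b (restr p (A \<union> set c))"
  then have "set b \<subseteq> dom M" by (simp add: realizes_def)
  then show "indep_i M A c b"
    using finsat_indep_i[OF assms(2)] * assms(1) unfolding heir_coheir_def by metis
qed

end

section \<open>Combs\<close>

text \<open>Combs are finite and nonempty, so the size bound in the join rule makes the first part a
  singleton. The insertion form of the comb inductions rests on this.\<close>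

lemma comb_single: "up_comb C \<Longrightarrow> card C \<le> 1 \<Longrightarrow> \<exists>a. C = {a}" "right_comb C \<Longrightarrow> card C \<le> 1 \<Longrightarrow> \<exists>a. C = {a}"
proof -
  have u: "finite C \<and> C \<noteq> {}" if "up_comb C" for C using that by induction auto
  have r: "finite C \<and> C \<noteq> {}" if "right_comb C" for C using that by induction auto
  have *: "\<exists>a. C = {a}" if "finite C \<and> C \<noteq> {}" "card C \<le> 1" for C :: "path set"
    using that card_1_singletonE[of C] by (metis card_gt_0_iff le_antisym less_eq_Suc_le One_nat_def)
  show "up_comb C \<Longrightarrow> card C \<le> 1 \<Longrightarrow> \<exists>a. C = {a}" using u * by blast
  show "right_comb C \<Longrightarrow> card C \<le> 1 \<Longrightarrow> \<exists>a. C = {a}" using r * by blast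
qed

lemma finite_up_comb: "up_comb C \<Longrightarrow> finite C"
  by (induction rule: up_comb.induct) auto

lemma finite_right_comb: "right_comb C \<Longrightarrow> finite C"
  by (induction rule: right_comb.induct) auto

lemma finite_wide_right_comb: "wide_right_comb C \<Longrightarrow> finite C"
  by (induction rule: wide_right_comb.induct) (auto simp: finite_right_comb)

lemma up_comb_induct [consumes 1, case_names single join]:
  assumes "up_comb C" "\<And>a. P {a}"
    "\<And>a B \<tau> i. up_comb B \<Longrightarrow> P B \<Longrightarrow> extends a (\<tau> @ [(i, False)]) \<Longrightarrow>
      (\<And>b. b \<in> B \<Longrightarrow> extends b (\<tau> @ [(i, True)])) \<Longrightarrow> P (insert a B)"
  shows "P C"
  using assms(1)
proof induction
  case (join A B)
  then obtain a where a: "A = {a}" using comb_single(1) by blast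
  obtain \<tau> i where "extends a (\<tau> @ [(i, False)])" "\<And>b. b \<in> B \<Longrightarrow> extends b (\<tau> @ [(i, True)])"
    using join.hyps(4) a unfolding narrowly_below_def by blast
  then show ?case using assms(3)[OF join.hyps(2) join.IH(2)] a by simp
qed (rule assms(2))

lemma right_comb_induct [consumes 1, case_names single join]:
  assumes "right_comb C" "\<And>a. P {a}"
    "\<And>a B \<tau> j. right_comb B \<Longrightarrow> P B \<Longrightarrow> extends a (\<tau> @ [(False, j)]) \<Longrightarrow>
      (\<And>b. b \<in> B \<Longrightarrow> extends b (\<tau> @ [(True, j)])) \<Longrightarrow> P (insert a B)"
  shows "P C"
  using assms(1)
proof induction
  case (join A B)
  then obtain a where a: "A = {a}" using comb_single(2) by blast
  obtain \<tau> j where "extends a (\<tau> @ [(False, j)])" "\<And>b. b \<in> B \<Longrightarrow> extends b (\<tau> @ [(True, j)])"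
    using join.hyps(4) a unfolding narrowly_left_def by blast
  then show ?case using assms(3)[OF join.hyps(2) join.IH(2)] a by simp
qed (rule assms(2))

lemma up_comb_insert:
  assumes "up_comb B" "extends a (\<tau> @ [(i, False)])" "\<And>b. b \<in> B \<Longrightarrow> extends b (\<tau> @ [(i, True)])"
  shows "up_comb (insert a B)"
proof -
  have "up_comb ({a} \<union> B)"
    by (rule up_comb.join) (use assms in \<open>auto simp: narrowly_below_def intro: up_comb.single\<close>)
  then show ?thesis by simp
qed

lemma right_comb_insert:
  assumes "right_comb B" "extends a (\<tau> @ [(False, j)])" "\<And>b. b \<in> B \<Longrightarrow> extends b (\<tau> @ [(True, j)])"
  shows "right_comb (insert a B)"
proof -
  have "right_comb ({a} \<union> B)"
    by (rule right_comb.join) (use assms in \<open>auto simp: narrowly_left_def intro: right_comb.single\<close>)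
  then show ?thesis by simp
qed

lemma extends_last: "extends \<sigma> (\<tau> @ [x]) \<Longrightarrow> \<sigma> (length \<tau>) = x"
  unfolding extends_def by (elim allE[of _ "length \<tau>"]) simp

text \<open>Through this \<open>k\<close>-inconsistency of a comb, a statement about its subsets of
  size \<open>k\<close>, reduces to inconsistency of combs of size exactly \<open>k\<close>.\<close>

lemma up_comb_subset: "up_comb C \<Longrightarrow> J \<subseteq> C \<Longrightarrow> J \<noteq> {} \<Longrightarrow> up_comb J"
proof (induction arbitrary: J rule: up_comb_induct)
  case (single a)
  then have "J = {a}" by blast
  then show ?case by (simp add: up_comb.single)
next
  case (join a B \<tau> i)
  show ?case
  proof (cases "J - {a} = {}")
    case True
    then have "J = {a}" using join.prems by blast
    then show ?thesis by (simp add: up_comb.single)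
  next
    case False
    then have u: "up_comb (J - {a})" using join.IH[of "J - {a}"] join.prems by blast
    show ?thesis
    proof (cases "a \<in> J")
      case True
      have "up_comb (insert a (J - {a}))" by (rule up_comb_insert[OF u]) (use join in auto)
      then show ?thesis using True by (simp add: insert_absorb)
    qed (use u in simp)
  qed
qed

lemma extends_prefix:
  assumes "extends \<rho> (\<tau>0 @ map \<sigma> [0..<d])" "extends \<sigma> \<tau>" "length \<tau> \<le> d"
  shows "extends \<rho> (\<tau>0 @ \<tau>)"
  unfolding extends_def
proof (intro allI impI)
  fix j assume j: "j < length (\<tau>0 @ \<tau>)"
  then have 1: "\<rho> j = (\<tau>0 @ map \<sigma> [0..<d]) ! j" using assms(1,3) unfolding extends_def by auto
  show "\<rho> j = (\<tau>0 @ \<tau>) ! j"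
  proof (cases "j < length \<tau>0")
    case False
    then have "\<sigma> (j - length \<tau>0) = \<tau> ! (j - length \<tau>0)"
      using j assms(2) unfolding extends_def by auto
    then show ?thesis using 1 False j assms(3) by (simp add: nth_append)
  qed (use 1 in \<open>simp add: nth_append\<close>)
qed

text \<open>Such a map copies the first \<open>d\<close> steps of a path above the node
  \<open>\<tau>0\<close>; what follows is unconstrained. This freedom allows the images to be chosen
  inside a somewhere dense set.\<close>

definition cone_map :: "nat \<Rightarrow> (bool \<times> bool) list \<Rightarrow> (path \<Rightarrow> path) \<Rightarrow> bool" where
  "cone_map d \<tau>0 g \<longleftrightarrow> (\<forall>\<sigma>. extends (g \<sigma>) (\<tau>0 @ map \<sigma> [0..<d]))"

lemma cone_mapD: "cone_map d \<tau>0 g \<Longrightarrow> extends \<sigma> \<tau> \<Longrightarrow> length \<tau> \<le> d \<Longrightarrow> extends (g \<sigma>) (\<tau>0 @ \<tau>)"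
  unfolding cone_map_def using extends_prefix by blast

text \<open>Only finitely many splitting nodes enter the construction of a comb. Once
  \<open>d\<close> exceeds their levels the image splits in the same pattern, and the differing
  steps at these nodes also keep the points distinct.\<close>

lemma up_comb_cone_map:
  "up_comb C \<Longrightarrow> \<exists>d. \<forall>d' \<tau>0 g. d \<le> d' \<longrightarrow> cone_map d' \<tau>0 g \<longrightarrow> up_comb (g ` C) \<and> card (g ` C) = card C"
proof (induction rule: up_comb_induct)
  case (single a)
  then show ?case by (auto intro: up_comb.single)
next
  case (join a B \<tau> i)
  then obtain d where d: "\<And>d' \<tau>0 g. d \<le> d' \<Longrightarrow> cone_map d' \<tau>0 g \<Longrightarrow> up_comb (g ` B) \<and> card (g ` B) = card B"
    by blast
  show ?case
  proof (intro exI[of _ "max d (Suc (length \<tau>))"] allI impI)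
    fix d' \<tau>0 g assume d': "max d (Suc (length \<tau>)) \<le> d'" and g: "cone_map d' \<tau>0 g"
    have 1: "extends (g a) ((\<tau>0 @ \<tau>) @ [(i, False)])"
      using cone_mapD[OF g join.hyps(2)] d' by simp
    have 2: "extends c ((\<tau>0 @ \<tau>) @ [(i, True)])" if "c \<in> g ` B" for c
      using cone_mapD[OF g join.hyps(3)] d' that by auto
    have B: "up_comb (g ` B)" "card (g ` B) = card B" using d[OF _ g] d' by auto
    have "g a \<notin> g ` B" using extends_last[OF 1] extends_last[OF 2, of "g a"] by auto
    moreover have "a \<notin> B" using extends_last[OF join.hyps(2)] extends_last[OF join.hyps(3), of a] by auto
    ultimately have "card (g ` insert a B) = card (insert a B)"
      using B finite_up_comb[OF join.hyps(1)] by simp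
    moreover have "up_comb (insert (g a) (g ` B))" using up_comb_insert[OF B(1) 1 2] .
    ultimately show "up_comb (g ` insert a B) \<and> card (g ` insert a B) = card (insert a B)" by simp
  qed
qed

lemma right_comb_cone_map:
  "right_comb C \<Longrightarrow> \<exists>d. \<forall>d' \<tau>0 g. d \<le> d' \<longrightarrow> cone_map d' \<tau>0 g \<longrightarrow> right_comb (g ` C)"
proof (induction rule: right_comb_induct)
  case (single a)
  then show ?case by (auto intro: right_comb.single)
next
  case (join a B \<tau> j)
  then obtain d where d: "\<And>d' \<tau>0 g. d \<le> d' \<Longrightarrow> cone_map d' \<tau>0 g \<Longrightarrow> right_comb (g ` B)"
    by blast
  show ?case
  proof (intro exI[of _ "max d (Suc (length \<tau>))"] allI impI)
    fix d' \<tau>0 g assume d': "max d (Suc (length \<tau>)) \<le> d'" and g: "cone_map d' \<tau>0 g"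
    have 1: "extends (g a) ((\<tau>0 @ \<tau>) @ [(False, j)])"
      using cone_mapD[OF g join.hyps(2)] d' by simp
    have 2: "extends c ((\<tau>0 @ \<tau>) @ [(True, j)])" if "c \<in> g ` B" for c
      using cone_mapD[OF g join.hyps(3)] d' that by auto
    have B: "right_comb (g ` B)" using d[OF _ g] d' by auto
    show "right_comb (g ` insert a B)" using right_comb_insert[OF B 1 2] by simp
  qed
qed

section \<open>Compactness for weaves\<close>

context monster_model
begin

lemma definable_jsat:
  assumes f: "fml M E (m + n) \<phi>" and TS: "finite TS"
    "\<And>ts. ts \<in> TS \<Longrightarrow> length ts = n \<and> (\<forall>a. Inr a \<in> set ts \<longrightarrow> a \<in> E)"
  shows "definable M E (\<lambda>e :: 'v \<Rightarrow> 'a. jsat m \<phi> ((\<lambda>ts. map (case_sum e id) ts) ` TS))"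
proof -
  obtain a0 where a0: "a0 \<in> dom M" using dom_ne by blast
  define lift :: "'v + 'a \<Rightarrow> ('v + nat) + 'a" where "lift = case_sum (\<lambda>v. Inl (Inl v)) Inr"
  let ?ts = "\<lambda>ts. map (\<lambda>i. Inl (Inr i)) [0..<m] @ map lift ts"
  have val: "map (case_sum e' id) (?ts ts) = map (\<lambda>i. e' (Inr i)) [0..<m] @ map (case_sum (\<lambda>v. e' (Inl v)) id) ts"
    for e' ts by (auto simp: lift_def o_def split: sum.split)
  have "definable M E (\<lambda>e' :: 'v + nat \<Rightarrow> 'a. holds M \<phi> (map (case_sum e' id) (?ts ts)))" if "ts \<in> TS" for ts
  proof (rule definable_holds)
    show "fml M E (length (?ts ts)) \<phi>" using f TS(2)[OF that] by simp
    fix a assume "Inr a \<in> set (?ts ts)"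
    then have "Inr a \<in> set ts" by (auto simp: lift_def split: sum.splits)
    then show "a \<in> E" using TS(2)[OF that] by blast
  qed
  then have "definable M E (\<lambda>e' :: 'v + nat \<Rightarrow> 'a. \<forall>ts\<in>TS. holds M \<phi> (map (case_sum e' id) (?ts ts)))"
    by (rule definable_ball[OF TS(1)])
  from definable_ex_sum[OF this] show ?thesis
  proof (rule definable_cong)
    fix e :: "'v \<Rightarrow> 'a" assume e: "range e \<subseteq> dom M"
    show "jsat m \<phi> ((\<lambda>ts. map (case_sum e id) ts) ` TS) \<longleftrightarrow>
      (\<exists>x. range x \<subseteq> dom M \<and> (\<forall>ts\<in>TS. holds M \<phi> (map (case_sum (case_sum e x) id) (?ts ts))))"
      (is "?L \<longleftrightarrow> ?R")
    proof
      assume ?L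
      then obtain xs where xs: "length xs = m" "set xs \<subseteq> dom M"
        "\<forall>ts\<in>TS. holds M \<phi> (xs @ map (case_sum e id) ts)" unfolding jsat_def by auto
      define x where "x i = (if i < m then xs ! i else a0)" for i
      have "map x [0..<m] = xs" using xs by (auto simp: x_def intro: nth_equalityI)
      moreover have "range x \<subseteq> dom M" using xs a0 by (force simp: x_def)
      ultimately show ?R using xs(3) unfolding val by (intro exI[of _ x]) auto
    next
      assume ?R
      then obtain x where x: "range x \<subseteq> dom M" "\<forall>ts\<in>TS. holds M \<phi> (map x [0..<m] @ map (case_sum e id) ts)"
        unfolding val by auto
      then show ?L unfolding jsat_def by (intro exI[of _ "map x [0..<m]"]) auto
    qed
  qed
qed

definition wv :: "nat \<Rightarrow> nat \<Rightarrow> ('f, 'r, 'a) fm \<Rightarrow> nat \<Rightarrow> (path set \<Rightarrow> bool) \<Rightarrow> ('f, 'r, 'a) fm set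
    \<Rightarrow> 'a list list set \<Rightarrow> 'a list list set \<Rightarrow> path set set \<Rightarrow> (path \<Rightarrow> 'a list) \<Rightarrow> bool" where
  "wv m n \<phi> k Rc r U R CC B \<longleftrightarrow> (\<forall>\<sigma>. length (B \<sigma>) = n \<and> set (B \<sigma>) \<subseteq> dom M) \<and>
     (\<forall>\<sigma>. \<forall>\<theta>\<in>r. holds M \<theta> (B \<sigma>)) \<and>
     (\<forall>u\<in>U. \<forall>C\<in>CC. (C = {} \<or> up_comb C) \<and> length u + card C = k \<longrightarrow> \<not> jsat m \<phi> (set u \<union> B ` C)) \<and>
     (\<forall>v\<in>R. \<forall>C\<in>CC. C = {} \<or> Rc C \<longrightarrow> jsat m \<phi> (set v \<union> B ` C))"

lemma wv_mono:
  "wv m n \<phi> k Rc r U R CC B \<Longrightarrow> r' \<subseteq> r \<Longrightarrow> U' \<subseteq> U \<Longrightarrow> R' \<subseteq> R \<Longrightarrow> CC' \<subseteq> CC \<Longrightarrow> wv m n \<phi> k Rc r' U' R' CC' B"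
  unfolding wv_def by (meson subsetD)

text \<open>A countable set is small, so by the strong limit assumption its power set is small too,
  and paths with positions inject into that.\<close>

lemma small_paths: "(UNIV :: (path \<times> nat) set) \<prec> K"
proof -
  have "(UNIV :: nat set) \<prec> K" and P: "\<And>X :: 'a set. X \<prec> K \<Longrightarrow> Pow X \<prec> K"
    using monster by (simp_all add: monster_def)
  then obtain f :: "nat \<Rightarrow> 'a" where f: "inj f" by (auto simp: lesspoll_def lepoll_def)
  then have "range f \<prec> K" using \<open>(UNIV :: nat set) \<prec> K\<close> by simp
  then have "Pow (range f) \<prec> K" by (rule P)
  moreover have "Pow (UNIV :: nat set) \<lesssim> Pow (range f)"
    unfolding lepoll_def using f by (intro exI[of _ "image f"]) (auto simp: inj_on_def inj_image_eq_iff)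
  ultimately show ?thesis using path_lepoll_Pow by (meson lesspoll_trans1)
qed

text \<open>With one variable for each path and each position, all requirements on a weave become
  definable predicates. Any finite number of them involves only finitely many formulas of
  \<open>r\<close> and finitely many combs.\<close>

lemma weave_compactness:
  assumes E: "E \<subseteq> dom M" "E \<prec> K" and f: "fml M E (m + n) \<phi>" and r: "\<And>\<theta>. \<theta> \<in> r \<Longrightarrow> fml M E n \<theta>"
    and UR: "\<And>u b. u \<in> U \<union> R \<Longrightarrow> b \<in> set u \<Longrightarrow> length b = n \<and> set b \<subseteq> E"
    and Rc: "\<And>C. Rc C \<Longrightarrow> finite C"
    and fin: "\<And>r0 CC. r0 \<subseteq> r \<Longrightarrow> finite r0 \<Longrightarrow> finite CC \<Longrightarrow> \<exists>B. wv m n \<phi> k Rc r0 U R CC B"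
  shows "\<exists>B. wv m n \<phi> k Rc r U R UNIV B"
proof -
  obtain a0 where a0: "a0 \<in> dom M" using dom_ne by blast
  define BB :: "(path \<times> nat \<Rightarrow> 'a) \<Rightarrow> path \<Rightarrow> 'a list" where "BB e \<sigma> = map (\<lambda>j. e (\<sigma>, j)) [0..<n]" for e \<sigma>
  let ?j = "\<lambda>u C e. jsat m \<phi> (set u \<union> BB e ` C)"
  define P1 where "P1 = {\<lambda>e. holds M \<theta> (BB e \<sigma>) | \<theta> \<sigma>. \<theta> \<in> r}"
  define P2 where "P2 = {\<lambda>e. \<not> ?j u C e | u C. u \<in> U \<and> (C = {} \<or> up_comb C) \<and> length u + card C = k}"
  define P3 where "P3 = {?j v C | v C. v \<in> R \<and> (C = {} \<or> Rc C)}"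
  have dj: "definable M E (?j u C)" if "u \<in> U \<union> R" "finite C" for u C
  proof -
    let ?TS = "map Inr ` set u \<union> (\<lambda>\<sigma>. map (\<lambda>j. Inl (\<sigma>, j)) [0..<n]) ` C"
    have "definable M E (\<lambda>e. jsat m \<phi> ((\<lambda>ts. map (case_sum e id) ts) ` ?TS))"
      by (rule definable_jsat[OF f]) (use that UR[OF that(1)] in fastforce)+
    moreover have "(\<lambda>ts. map (case_sum e id) ts) ` ?TS = set u \<union> BB e ` C" for e
      by (simp add: image_Un image_image o_def BB_def)
    ultimately show ?thesis by simp
  qed
  have "\<exists>e. range e \<subseteq> dom M \<and> (\<forall>P\<in>P1 \<union> P2 \<union> P3. P e)"
  proof (rule compactness[OF small_paths E])
    fix P assume "P \<in> P1 \<union> P2 \<union> P3"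
    then consider "P \<in> P1" | "P \<in> P2" | "P \<in> P3" by blast
    then show "definable M E P"
    proof cases
      case 1
      then obtain \<theta> \<sigma> where P: "P = (\<lambda>e. holds M \<theta> (BB e \<sigma>))" "\<theta> \<in> r" unfolding P1_def by blast
      have "definable M E (\<lambda>e. holds M \<theta> (map (case_sum e id) (map (\<lambda>j. Inl (\<sigma>, j)) [0..<n])))"
        by (rule definable_holds) (use r[OF P(2)] in auto)
      then show ?thesis unfolding P(1) BB_def by (simp add: o_def)
    next
      case 2
      then obtain u C where "P = (\<lambda>e. \<not> ?j u C e)" "u \<in> U" "C = {} \<or> up_comb C" unfolding P2_def by blast
      then show ?thesis using definable_Not[OF dj[of u C]] finite_up_comb by auto
    next
      case 3
      then obtain v C where "P = ?j v C" "v \<in> R" "C = {} \<or> Rc C" unfolding P3_def by blast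
      then show ?thesis using dj[of v C] Rc by auto
    qed
  next
    fix P0 assume P0: "P0 \<subseteq> P1 \<union> P2 \<union> P3" "finite P0"
    have "\<forall>P\<in>P0. \<exists>r1 C1. r1 \<subseteq> r \<and> finite r1 \<and> finite C1 \<and> (\<forall>e. wv m n \<phi> k Rc r1 U R C1 (BB e) \<longrightarrow> P e)"
    proof
      fix P assume "P \<in> P0"
      then consider "P \<in> P1" | "P \<in> P2" | "P \<in> P3" using P0 by blast
      then show "\<exists>r1 C1. r1 \<subseteq> r \<and> finite r1 \<and> finite C1 \<and> (\<forall>e. wv m n \<phi> k Rc r1 U R C1 (BB e) \<longrightarrow> P e)"
      proof cases
        case 1
        then obtain \<theta> \<sigma> where P: "P = (\<lambda>e. holds M \<theta> (BB e \<sigma>))" "\<theta> \<in> r" unfolding P1_def by blast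
        then show ?thesis by (intro exI[of _ "{\<theta>}"] exI[of _ "{}"]) (auto simp: wv_def)
      next
        case 2
        then obtain u C where "P = (\<lambda>e. \<not> ?j u C e)" "u \<in> U" "C = {} \<or> up_comb C" "length u + card C = k"
          unfolding P2_def by blast
        then show ?thesis by (intro exI[of _ "{}"] exI[of _ "{C}"]) (simp add: wv_def)
      next
        case 3
        then obtain v C where "P = ?j v C" "v \<in> R" "C = {} \<or> Rc C" unfolding P3_def by blast
        then show ?thesis by (intro exI[of _ "{}"] exI[of _ "{C}"]) (simp add: wv_def)
      qed
    qed
    then obtain r1 C1 where rc: "\<And>P. P \<in> P0 \<Longrightarrow> r1 P \<subseteq> r \<and> finite (r1 P) \<and> finite (C1 P) \<and>
      (\<forall>e. wv m n \<phi> k Rc (r1 P) U R (C1 P) (BB e) \<longrightarrow> P e)" by metis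
    have "(\<Union>P\<in>P0. r1 P) \<subseteq> r" "finite (\<Union>P\<in>P0. r1 P)" "finite (\<Union>P\<in>P0. C1 P)" using rc P0(2) by blast+
    then obtain B where B: "wv m n \<phi> k Rc (\<Union>P\<in>P0. r1 P) U R (\<Union>P\<in>P0. C1 P) B" using fin by meson
    have Bn: "length (B \<sigma>) = n" "set (B \<sigma>) \<subseteq> dom M" for \<sigma> using B by (auto simp: wv_def)
    \<comment> \<open>Positions from \<open>n\<close> on are never read; they receive an arbitrary
      element of the domain.\<close>
    define e where "e = (\<lambda>(\<sigma>, j). if j < n then B \<sigma> ! j else a0)"
    have eB: "BB e = B"
    proof
      fix \<sigma> show "BB e \<sigma> = B \<sigma>" using Bn[of \<sigma>] by (auto simp: BB_def e_def intro: nth_equalityI)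
    qed
    have "range e \<subseteq> dom M"
    proof
      fix y assume "y \<in> range e"
      then obtain \<sigma> j where "y = (if j < n then B \<sigma> ! j else a0)" by (auto simp: e_def)
      then show "y \<in> dom M" using Bn[of \<sigma>] a0 by (auto split: if_splits)
    qed
    moreover have "P e" if P: "P \<in> P0" for P
    proof -
      have "wv m n \<phi> k Rc (r1 P) U R (C1 P) (BB e)"
        unfolding eB by (rule wv_mono[OF B]) (use P in auto)
      then show ?thesis using rc[OF P] by simp
    qed
    ultimately show "\<exists>e. range e \<subseteq> dom M \<and> (\<forall>P\<in>P0. P e)" by blast
  qed
  then obtain e where e: "range e \<subseteq> dom M" "\<And>P. P \<in> P1 \<union> P2 \<union> P3 \<Longrightarrow> P e" by auto
  have "wv m n \<phi> k Rc r U R UNIV (BB e)"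
    unfolding wv_def
  proof (intro conjI allI ballI impI)
    fix \<sigma> show "length (BB e \<sigma>) = n" "set (BB e \<sigma>) \<subseteq> dom M" using e(1) by (auto simp: BB_def)
    fix \<theta> assume "\<theta> \<in> r"
    then have "(\<lambda>e. holds M \<theta> (BB e \<sigma>)) \<in> P1" unfolding P1_def by blast
    then show "holds M \<theta> (BB e \<sigma>)" using e(2) by blast
  next
    fix u C assume "u \<in> U" "(C = {} \<or> up_comb C) \<and> length u + card C = k"
    then have "(\<lambda>e. \<not> ?j u C e) \<in> P2" unfolding P2_def by blast
    then show "\<not> ?j u C e" using e(2) by blast
  next
    fix v C assume "v \<in> R" "C = {} \<or> Rc C"
    then have "?j v C \<in> P3" unfolding P3_def by blast
    then show "?j v C e" using e(2) by blast
  qed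
  then show ?thesis by blast
qed

section \<open>From a failure of Kim's lemma to a strong weave\<close>

lemma autf_comp:
  assumes "autf A \<sigma>" "autf A \<rho>" shows "autf A (\<lambda>a. \<rho> (\<sigma> a))"
proof -
  have s: "aut M \<sigma>" "aut M \<rho>" using assms by (auto simp: autf_def)
  have "bij_betw (\<rho> \<circ> \<sigma>) (dom M) (dom M)"
    using s by (intro bij_betw_trans) (auto simp: aut_def)
  moreover have d: "set (map \<sigma> as) \<subseteq> dom M" if "set as \<subseteq> dom M" for as using aut_dom_set[OF s(1) that] .
  have "\<rho> (\<sigma> (fnc M f as)) = fnc M f (map (\<lambda>a. \<rho> (\<sigma> a)) as)"
    if "set as \<subseteq> dom M" "length as = arF M f" for f as
  proof -
    have "\<sigma> (fnc M f as) = fnc M f (map \<sigma> as)" using s(1) that by (simp add: aut_def)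
    moreover have "\<rho> (fnc M f (map \<sigma> as)) = fnc M f (map \<rho> (map \<sigma> as))"
      using s(2) d[OF that(1)] that unfolding aut_def by (metis length_map)
    ultimately show ?thesis by (simp add: o_def)
  qed
  moreover have "rel M R (map (\<lambda>a. \<rho> (\<sigma> a)) as) \<longleftrightarrow> rel M R as"
    if "set as \<subseteq> dom M" "length as = arR M R" for R as
  proof -
    have "rel M R (map \<sigma> as) \<longleftrightarrow> rel M R as" using s(1) that by (simp add: aut_def)
    moreover have "rel M R (map \<rho> (map \<sigma> as)) \<longleftrightarrow> rel M R (map \<sigma> as)"
      using s(2) d[OF that(1)] that unfolding aut_def by (metis length_map)
    ultimately show ?thesis by (simp add: o_def)
  qed
  ultimately show ?thesis using assms unfolding autf_def aut_def by (simp add: o_def)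
qed

lemma autf_ident: "autf A (\<lambda>a. a)"
  by (simp add: autf_def aut_def bij_betw_def)

lemma block_nth:
  assumes "\<And>c. c \<in> set L \<Longrightarrow> length c = n" "j < length L"
  shows "take n (drop (j * n) (concat L)) = L ! j"
  using assms
proof (induction L arbitrary: j)
  case (Cons c L)
  then show ?case by (cases j) auto
qed simp

text \<open>Together with equality of types this says that the two concatenated lists form an
  invariant sequence of length two. The empty tuple stands for what precedes the first
  entry.\<close>

definition iseq :: "'a set \<Rightarrow> 'a list list \<Rightarrow> 'a list list \<Rightarrow> bool" where
  "iseq A L L' \<longleftrightarrow> indep_i M A (concat L) [] \<and> indep_i M A (concat L') (concat L)"

text \<open>What is needed to place another copy of the whole list along \<open>p\<close>. A
  bi-invariant \<open>p\<close> suffices as it is. Otherwise a semi-reliable type in the variables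
  of all blocks is carried along, extending the type of the list and containing \<open>p\<close> in
  each block.\<close>

definition good :: "'a set \<Rightarrow> nat \<Rightarrow> ('f, 'r, 'a) fm set \<Rightarrow> 'a list list \<Rightarrow> bool" where
  "good A n p L \<longleftrightarrow> L \<noteq> [] \<and> (\<forall>c\<in>set L. realizes M n c (restr p A)) \<and>
     (bi_invariant M A n p \<or> (\<exists>r. semi_reliable M A (length L * n) r \<and>
        {shift (i * n) \<psi> | \<psi> i. \<psi> \<in> p \<and> i < length L} \<subseteq> r \<and> tp M A (concat L) \<subseteq> r))"

lemma semi_reliable_invariant: "semi_reliable M A n p \<Longrightarrow> invariant M A n p"
  unfolding semi_reliable_def sri_closed_def by blast

lemma same_tp:
  assumes "gtype M n p" "A \<subseteq> dom M" "realizes M n b (restr p A)" "realizes M n c (restr p A)"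
  shows "tp M A b = tp M A c"
  using gtype_mem[OF assms(1,2,3)] gtype_mem[OF assms(1,2,4)] assms(3,4)
  by (auto simp: tp_def realizes_def)

lemma indep_iI:
  assumes "invariant M A n s" "A \<subseteq> dom M" "set b \<subseteq> dom M" "realizes M n c (restr s (A \<union> set b))"
  shows "indep_i M A c b"
proof -
  have "tp M (A \<union> set b) c \<subseteq> s"
    using tp_subset_restr_iff[OF invariantD[OF assms(1)], of "A \<union> set b" c] assms by (auto simp: realizes_def)
  then show ?thesis using assms unfolding indep_i_def realizes_def by blast
qed

lemma good_blocks: "good A n p L \<Longrightarrow> c \<in> set L \<Longrightarrow> length c = n \<and> set c \<subseteq> dom M"
  unfolding good_def realizes_def by blast

lemma image_Un_fix: "autf A \<sigma> \<Longrightarrow> \<sigma> ` (A \<union> set c) = A \<union> set (map \<sigma> c)"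
  by (force simp: autf_def image_Un image_iff)

text \<open>In the semi-reliable case the new copy realizes the invariant type over the old one; in the
  bi-invariant case it is the old copy that is independent from the new one, because the whole old
  copy is independent from a single realization of \<open>p\<close>.\<close>

lemma good_extend:
  assumes A: "A \<subseteq> dom M" "A \<prec> K" and p: "invariant M A n p" and L: "good A n p L"
  obtains \<sigma> where "autf A \<sigma>" "\<And>c. c \<in> set L \<Longrightarrow> realizes M n (map \<sigma> c) (restr p (A \<union> set (concat L)))"
    "iseq A L (map (map \<sigma>) L) \<or> iseq A (map (map \<sigma>) L) L"
proof -
  let ?C = "concat L"
  have bl: "length c = n" "set c \<subseteq> dom M" if "c \<in> set L" for c using good_blocks[OF L that] by auto
  have Cd: "set ?C \<subseteq> dom M" using bl by auto
  have lC: "length ?C = length L * n" by (rule length_concat_blocks) (rule bl)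
  note AC = Un_least[OF A(1) Cd] and sAC = small_Un_set[OF A(2), of ?C]
  consider (bi) "bi_invariant M A n p" | (semi) r where "semi_reliable M A (length L * n) r"
    "{shift (i * n) \<psi> | \<psi> i. \<psi> \<in> p \<and> i < length L} \<subseteq> r" "tp M A ?C \<subseteq> r"
    using L unfolding good_def by blast
  then show ?thesis
  proof cases
    case semi
    note r = semi_reliable_invariant[OF semi(1)]
    note gr = invariantD[OF r]
    obtain C' where C': "realizes M (length L * n) C' (restr r (A \<union> set ?C))"
      using gtype_realize[OF gr AC sAC] by blast
    have C0: "realizes M (length L * n) ?C (restr r A)"
      using tp_subset_restr_iff[OF gr A(1) lC Cd] semi(3) by simp
    have C'A: "realizes M (length L * n) C' (restr r A)" using realizes_restr_mono[OF C'] by blast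
    have "tp M A ?C = tp M A C'" by (rule same_tp[OF gr A(1) C0 C'A])
    then obtain \<sigma> where \<sigma>: "autf A \<sigma>" "map \<sigma> ?C = C'"
      using homogeneity[OF A Cd, of C'] lC C' by (auto simp: realizes_def)
    show ?thesis
    proof (rule that[OF \<sigma>(1)])
      fix c assume "c \<in> set L"
      then obtain j where j: "j < length L" "c = L ! j" by (auto simp: in_set_conv_nth)
      have bc: "take n (drop (j * n) C') = map \<sigma> c"
        using block_nth[of L n j] bl(1) j by (simp add: take_map drop_map flip: \<sigma>(2))
      have jl: "n + j * n \<le> length C'"
      proof -
        have "Suc j * n \<le> length L * n" using j by (intro mult_right_mono) auto
        then show ?thesis using C' by (simp add: realizes_def)
      qed
      show "realizes M n (map \<sigma> c) (restr p (A \<union> set ?C))"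
        unfolding realizes_def
      proof (intro conjI ballI)
        show "length (map \<sigma> c) = n" "set (map \<sigma> c) \<subseteq> dom M"
          using bl[OF \<open>c \<in> set L\<close>] aut_dom_set \<sigma>(1) by (auto simp: autf_def)
        fix \<psi> assume \<psi>: "\<psi> \<in> restr p (A \<union> set ?C)"
        \<comment> \<open>The copy of \<open>p\<close> in the variables of block \<open>j\<close> is
          part of \<open>r\<close>, hence that block of \<open>C'\<close> realizes \<open>p\<close>
          over the old list.\<close>
        then have "shift (j * n) \<psi> \<in> r" using semi(2) j by (auto simp: restr_def)
        moreover have "params (shift (j * n) \<psi>) \<subseteq> A \<union> set ?C"
          using params_sb[of "\<lambda>i. Inl (i + j * n)" Inr \<psi>] \<psi> by (fastforce simp: shift_sb restr_def)
        ultimately have "holds M (shift (j * n) \<psi>) C'" using C' by (auto simp: realizes_def restr_def)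
        moreover have "fml M (dom M) n \<psi>" using gtypeD[OF invariantD[OF p]] \<psi> by (auto simp: restr_def)
        ultimately show "holds M \<psi> (map \<sigma> c)" using holds_shift[OF _ jl] bc by metis
      qed
    next
      have "indep_i M A ?C []" by (rule indep_iI[OF r A(1)]) (use C0 in auto)
      moreover have "indep_i M A C' ?C" by (rule indep_iI[OF r A(1) Cd C'])
      ultimately show "iseq A L (map (map \<sigma>) L) \<or> iseq A (map (map \<sigma>) L) L"
        using \<sigma>(2) by (simp add: iseq_def map_concat)
    qed
  next
    case bi
    note gp = invariantD[OF p]
    have pA: "realizes M n c (restr p A)" if "c \<in> set L" for c using L that by (simp add: good_def)
    obtain d where d: "realizes M n d (restr p (A \<union> set ?C))" using gtype_realize[OF gp AC sAC] by blast
    have dd: "set d \<subseteq> dom M" "length d = n" using d by (auto simp: realizes_def)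
    have dA: "realizes M n d (restr p A)" using realizes_restr_mono[OF d] by blast
    \<comment> \<open>Bi-invariance is used once, for a single realization \<open>d\<close>. The
      invariant type \<open>s\<close> obtained here can then be realized over more than
      \<open>d\<close>.\<close>
    obtain s where s: "invariant M A (length ?C) s" "tp M (A \<union> set d) ?C \<subseteq> s"
      using bi d Cd unfolding bi_invariant_def indep_i_def by blast
    note gs = invariantD[OF s(1)]
    have Cs: "realizes M (length ?C) ?C (restr s (A \<union> set d))"
      using tp_subset_restr_iff[OF gs, of "A \<union> set d" ?C] s(2) Cd A dd by auto
    obtain c0 where c0: "c0 \<in> set L" using L unfolding good_def by (meson list.set_sel(1))
    obtain \<sigma>1 where \<sigma>1: "autf A \<sigma>1" "map \<sigma>1 c0 = d"
      using homogeneity[OF A bl(2)[OF c0] dd(1) _ same_tp[OF gp A(1) pA[OF c0] dA]] bl(1)[OF c0] dd by auto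
    let ?C1 = "map \<sigma>1 ?C"
    have C1d: "set ?C1 \<subseteq> dom M" using aut_dom_set[OF _ Cd] \<sigma>1 by (simp add: autf_def)
    have sub: "set (map \<sigma>1 c) \<subseteq> set ?C1" if "c \<in> set L" for c using that by auto
    \<comment> \<open>\<open>s\<close> is realized over a whole copy of the list through
      \<open>d\<close>. Moving \<open>C2\<close> back onto the old list turns that copy into the new
      one.\<close>
    obtain C2 where C2: "realizes M (length ?C) C2 (restr s (A \<union> set ?C1))"
      using gtype_realize[OF gs Un_least[OF A(1) C1d] small_Un_set[OF A(2)]] by blast
    have C2d: "set C2 \<subseteq> dom M" "length C2 = length ?C" using C2 by (auto simp: realizes_def)
    have "tp M A C2 = tp M A ?C"
      by (rule same_tp[OF gs A(1)]) (use realizes_restr_mono[OF C2] realizes_restr_mono[OF Cs] in auto)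
    then obtain \<rho> where \<rho>: "autf A \<rho>" "map \<rho> C2 = ?C" using homogeneity[OF A C2d(1) Cd C2d(2)] by blast
    let ?\<sigma> = "\<lambda>a. \<rho> (\<sigma>1 a)"
    have \<sigma>: "autf A ?\<sigma>" by (rule autf_comp[OF \<sigma>1(1) \<rho>(1)])
    show ?thesis
    proof (rule that[OF \<sigma>])
      fix c assume c: "c \<in> set L"
      let ?c1 = "map \<sigma>1 c"
      have c1d: "set ?c1 \<subseteq> dom M" "length ?c1 = length d"
        using aut_dom_set[OF _ bl(2)[OF c]] \<sigma>1 bl(1)[OF c] dd by (auto simp: autf_def)
      \<comment> \<open>Every block of the copy has the type of \<open>d\<close> over
        \<open>A\<close>, so by stationarity of \<open>s\<close> it stands to \<open>C2\<close> as
        \<open>d\<close> stands to the old list.\<close>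
      have "tp M A ?c1 = tp M A d"
        using autf_tp[OF \<sigma>1(1) A(1) bl(2)[OF c]] same_tp[OF gp A(1) pA[OF c] dA] by simp
      moreover have "realizes M (length ?C) C2 (restr s (A \<union> set ?c1))"
        using realizes_restr_mono[OF C2] sub[OF c] by blast
      ultimately have "tp M A (C2 @ ?c1) = tp M A (?C @ d)"
        using stationarity[OF A s(1) c1d(1) dd(1) c1d(2)] Cs by blast
      moreover have "tp M A (map \<rho> (C2 @ ?c1)) = tp M A (C2 @ ?c1)"
        by (rule autf_tp[OF \<rho>(1) A(1)]) (use C2d(1) c1d(1) in simp)
      ultimately have t: "tp M A (?C @ d) = tp M A (?C @ map ?\<sigma> c)" using \<rho>(2) by (simp add: o_def)
      have cd: "set (map ?\<sigma> c) \<subseteq> dom M" using aut_dom_set[OF _ bl(2)[OF c]] \<sigma> by (simp add: autf_def)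
      \<comment> \<open>This automorphism fixes the old list pointwise and sends \<open>d\<close> to
        the new block, so the block realizes \<open>p\<close> over the old list because
        \<open>d\<close> does.\<close>
      obtain \<kappa> where \<kappa>: "autf A \<kappa>" "map \<kappa> (?C @ d) = ?C @ map ?\<sigma> c"
        by (rule homogeneity[OF A _ _ _ t]) (use Cd dd cd bl[OF c] in auto)
      then have "map \<kappa> ?C = ?C" "map \<kappa> d = map ?\<sigma> c" by (auto simp: append_eq_append_conv)
      then have "realizes M n (map ?\<sigma> c) (restr p (\<kappa> ` (A \<union> set ?C)))" "\<kappa> ` (A \<union> set ?C) = A \<union> set ?C"
        using realizes_aut[OF p \<kappa>(1) A(1) AC d] image_Un_fix[OF \<kappa>(1), of ?C] by simp_all
      then show "realizes M n (map ?\<sigma> c) (restr p (A \<union> set ?C))" by simp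
    next
      have e: "concat (map (map ?\<sigma>) L) = map \<rho> ?C1" by (simp add: map_concat o_def)
      have C3d: "set (map \<rho> ?C1) \<subseteq> dom M" using aut_dom_set[OF _ C1d] \<rho> by (simp add: autf_def)
      have "tp M A (map \<rho> ?C1) = tp M A ?C"
        using autf_tp[OF \<rho>(1) A(1) C1d] autf_tp[OF \<sigma>1(1) A(1) Cd] by simp
      moreover have "tp M A ?C \<subseteq> s"
        using tp_subset_restr_iff[OF gs A(1) refl Cd] realizes_restr_mono[OF Cs] by blast
      ultimately have "indep_i M A (map \<rho> ?C1) []" unfolding indep_i_def using s(1) by auto
      moreover have "realizes M (length ?C) ?C (restr s (A \<union> set (map \<rho> ?C1)))"
        using realizes_aut[OF s(1) \<rho>(1) A(1) Un_least[OF A(1) C1d] C2] \<rho>(2) image_Un_fix[OF \<rho>(1), of ?C1] by simp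
      then have "indep_i M A ?C (map \<rho> ?C1)" by (rule indep_iI[OF s(1) A(1) C3d])
      ultimately have "iseq A (map (map ?\<sigma>) L) L" unfolding iseq_def e by simp
      then show "iseq A L (map (map ?\<sigma>) L) \<or> iseq A (map (map ?\<sigma>) L) L" by blast
    qed
  qed
qed

text \<open>The closure condition of semi-reliability is applied with length two. It provides a type
  in twice as many variables that contains the old type in both halves, hence \<open>p\<close> in
  every block.\<close>

lemma good_append:
  assumes A: "A \<subseteq> dom M" and L: "good A n p L"
    and L': "length L' = length L" "\<And>c. c \<in> set L' \<Longrightarrow> realizes M n c (restr p A)"
    and t: "tp M A (concat L') = tp M A (concat L)" and i: "iseq A L L'"
  shows "good A n p (L @ L')"
proof (cases "bi_invariant M A n p")
  case True
  then show ?thesis using L L'(2) unfolding good_def by auto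
next
  case False
  let ?N = "length L * n"
  obtain r where r: "semi_reliable M A ?N r"
    "{shift (i * n) \<psi> | \<psi> i. \<psi> \<in> p \<and> i < length L} \<subseteq> r" "tp M A (concat L) \<subseteq> r"
    using False L unfolding good_def by blast
  obtain R where R: "sri_closed M A R" "(?N, r) \<in> R" using r(1) unfolding semi_reliable_def by blast
  note gr = invariantD[OF semi_reliable_invariant[OF r(1)]]
  have bl: "length c = n" "set c \<subseteq> dom M" if "c \<in> set L \<union> set L'" for c
    using good_blocks[OF L] L'(2) that by (auto simp: realizes_def)
  have ln: "length (concat L) = ?N" "length (concat L') = ?N"
    using length_concat_blocks[of L n] length_concat_blocks[of L' n] bl L'(1) by auto
  have cd: "set (concat L) \<subseteq> dom M" "set (concat L') \<subseteq> dom M" using bl by auto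
  define c where "c i = (if i = 0 then concat L else concat L')" for i :: nat
  have iv: "invseq M A ?N c 2"
    unfolding invseq_def
  proof (intro conjI allI impI)
    fix i :: nat assume "i < 2"
    then have "i = 0 \<or> i = 1" by auto
    then show "indep_i M A (c i) (concat (map c [0..<i]))"
      using \<open>iseq A L L'\<close> by (auto simp: iseq_def c_def)
  qed (use ln cd t in \<open>auto simp: c_def\<close>)
  have re: "realizes M ?N (c 0) (restr r A)"
    using tp_subset_restr_iff[OF gr A ln(1) cd(1)] r(3) by (simp add: c_def)
  have "\<forall>n' c. 1 \<le> n' \<and> invseq M A ?N c n' \<and> realizes M ?N (c 0) (restr r A) \<longrightarrow>
        (\<exists>r'. (n' * ?N, r') \<in> R \<and> {shift (i * ?N) \<phi> | \<phi> i. \<phi> \<in> r \<and> i < n'} \<subseteq> r' \<and>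
             tp M A (concat (map c [0..<n'])) \<subseteq> r')"
    using R unfolding sri_closed_def by fast
  \<comment> \<open>The new type comes from the same closed class \<open>R\<close>, so it is again
    semi-reliable and the doubling can be iterated.\<close>
  from this[rule_format, of 2 c] iv re
  obtain r' where r': "(2 * ?N, r') \<in> R" "{shift (i * ?N) \<phi> | \<phi> i. \<phi> \<in> r \<and> i < 2} \<subseteq> r'"
    "tp M A (concat (map c [0..<2])) \<subseteq> r'" by auto
  have e: "length (L @ L') * n = 2 * ?N" using L'(1) by (simp add: algebra_simps)
  have "concat (map c [0..<2]) = concat (L @ L')" by (simp add: c_def numeral_2_eq_2)
  then have 1: "tp M A (concat (L @ L')) \<subseteq> r'" using r'(3) by simp
  have 2: "shift (i * n) \<psi> \<in> r'" if \<psi>: "\<psi> \<in> p" "i < length (L @ L')" for \<psi> i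
  proof (cases "i < length L")
    case True
    then have "shift (i * n) \<psi> \<in> r" using r(2) \<psi> by blast
    then have "shift (0 * ?N) (shift (i * n) \<psi>) \<in> {shift (i * ?N) \<phi> | \<phi> i. \<phi> \<in> r \<and> i < 2}"
      by (intro CollectI exI[of _ "shift (i * n) \<psi>"] exI[of _ 0]) auto
    then have "shift (0 * ?N) (shift (i * n) \<psi>) \<in> r'" using r'(2) by (rule rev_subsetD)
    then show ?thesis by (simp add: shift_0)
  next
    case False
    then have il: "i - length L < length L" using \<psi> L'(1) by simp
    then have "shift ((i - length L) * n) \<psi> \<in> r" using r(2) \<psi> by blast
    then have "shift (1 * ?N) (shift ((i - length L) * n) \<psi>) \<in> {shift (i * ?N) \<phi> | \<phi> i. \<phi> \<in> r \<and> i < 2}"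
      by (intro CollectI exI[of _ "shift ((i - length L) * n) \<psi>"] exI[of _ 1]) auto
    then have "shift (1 * ?N) (shift ((i - length L) * n) \<psi>) \<in> r'" using r'(2) by (rule rev_subsetD)
    moreover have "1 * ?N + (i - length L) * n = i * n" using False by (simp flip: add_mult_distrib)
    ultimately show ?thesis unfolding shift_shift by simp
  qed
  have "semi_reliable M A (length (L @ L') * n) r'" unfolding e semi_reliable_def using R(1) r'(1) by blast
  moreover have "{shift (i * n) \<psi> | \<psi> i. \<psi> \<in> p \<and> i < length (L @ L')} \<subseteq> r'" using 2 by blast
  ultimately show ?thesis using 1 L L'(2) unfolding good_def by auto
qed

text \<open>Both orders are provided because the independence found in \<open>good_extend\<close>
  may point either way, depending on the kind of type along which the copy was made.\<close>

lemma good_double: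
  assumes A: "A \<subseteq> dom M" and p: "invariant M A n p" and L: "good A n p L" and \<sigma>: "autf A \<sigma>"
  shows "iseq A L (map (map \<sigma>) L) \<Longrightarrow> good A n p (L @ map (map \<sigma>) L)"
    and "iseq A (map (map \<sigma>) L) L \<Longrightarrow> good A n p (map (map \<sigma>) L @ L)"
proof -
  let ?L = "map (map \<sigma>) L"
  have Ld: "set (concat L) \<subseteq> dom M" using good_blocks[OF L] by auto
  have t: "tp M A (concat ?L) = tp M A (concat L)"
    using autf_tp[OF \<sigma> A Ld] by (simp add: map_concat)
  have \<sigma>A: "\<sigma> ` A = A" using \<sigma> by (force simp: autf_def)
  have rl: "realizes M n c (restr p A)" if cL: "c \<in> set ?L" for c
  proof -
    obtain c' where c': "c' \<in> set L" "c = map \<sigma> c'" using cL by auto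
    then have "realizes M n c' (restr p A)" using L by (simp add: good_def)
    from realizes_aut[OF p \<sigma> A A this] show ?thesis using c' \<sigma>A by simp
  qed
  show "iseq A L ?L \<Longrightarrow> good A n p (L @ ?L)" by (rule good_append[OF A L _ rl t]) auto
  have "good A n p ?L" using L rl t unfolding good_def by auto
  then show "iseq A ?L L \<Longrightarrow> good A n p (?L @ L)"
    by (rule good_append[OF A _ _ _ t[symmetric]]) (use L in \<open>auto simp: good_def\<close>)
qed

section \<open>Weaves of finite depth\<close>

definition rl :: "'a set \<Rightarrow> nat \<Rightarrow> ('f, 'r, 'a) fm set \<Rightarrow> 'a list \<Rightarrow> 'a list set \<Rightarrow> bool" where
  "rl A n p c S \<longleftrightarrow> realizes M n c (restr p (A \<union> \<Union>(set ` S)))"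

lemma rl_mono: "rl A n p c S \<Longrightarrow> S' \<subseteq> S \<Longrightarrow> rl A n p c S'"
  unfolding rl_def by (rule realizes_restr_mono) auto

lemma rl_aut:
  assumes "invariant M A n p" "autf A \<sigma>" "A \<subseteq> dom M" "\<Union>(set ` S) \<subseteq> dom M" "rl A n p c S"
  shows "rl A n p (map \<sigma> c) (map \<sigma> ` S)"
proof -
  have "\<sigma> ` (A \<union> \<Union>(set ` S)) = A \<union> \<Union>(set ` (map \<sigma> ` S))"
    using assms(2) by (force simp: autf_def image_Un image_iff image_UN)
  then show ?thesis using realizes_aut[OF assms(1-3) _ assms(5)[unfolded rl_def]] assms(3,4) unfolding rl_def by simp
qed

text \<open>A weave of depth \<open>d\<close>: along \<open>p\<close> downwards and along \<open>q\<close> to the left.\<close>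

definition fweave :: "'a set \<Rightarrow> nat \<Rightarrow> ('f, 'r, 'a) fm set \<Rightarrow> ('f, 'r, 'a) fm set \<Rightarrow> nat
    \<Rightarrow> ((bool \<times> bool) list \<Rightarrow> 'a list) \<Rightarrow> bool" where
  "fweave A n p q d W \<longleftrightarrow>
     (\<forall>s. length s = d \<longrightarrow> rl A n p (W s) {} \<and> rl A n q (W s) {}) \<and>
     (\<forall>\<tau> i s. length (\<tau> @ (i, False) # s) = d \<longrightarrow>
        rl A n p (W (\<tau> @ (i, False) # s)) (W ` {t. length t = d \<and> (\<exists>t'. t = \<tau> @ (i, True) # t')})) \<and>
     (\<forall>\<tau> j s. length (\<tau> @ (False, j) # s) = d \<longrightarrow>
        rl A n q (W (\<tau> @ (False, j) # s)) (W ` {t. length t = d \<and> (\<exists>j' t'. t = \<tau> @ (True, j') # t')}))"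

text \<open>Each new level at the root doubles twice: a lower copy along \<open>p\<close>, then a
  left copy of the whole result along \<open>q\<close>. Since \<open>iseq\<close> does not mention
  the type used for the copy, a doubling along one type also preserves goodness for the
  other.\<close>

lemma fweave_exists:
  assumes A: "A \<subseteq> dom M" "A \<prec> K" and p: "invariant M A n p" and q: "invariant M A n q"
    and b: "good A n p [b]" "good A n q [b]"
  shows "\<exists>L W. good A n p L \<and> good A n q L \<and> fweave A n p q d W \<and> (\<forall>s. length s = d \<longrightarrow> W s \<in> set L)"
proof (induction d)
  case 0
  have "rl A n p b {}" "rl A n q b {}" using b by (auto simp: rl_def good_def)
  then have "fweave A n p q 0 (\<lambda>_. b)" by (auto simp: fweave_def)
  then show ?case using b by (intro exI[of _ "[b]"] exI[of _ "\<lambda>_. b"]) auto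
next
  case (Suc d)
  then obtain L W where L: "good A n p L" "good A n q L" and W: "fweave A n p q d W"
    and WL: "\<And>s. length s = d \<Longrightarrow> W s \<in> set L" by blast
  obtain \<sigma> where \<sigma>: "autf A \<sigma>" "\<And>c. c \<in> set L \<Longrightarrow> realizes M n (map \<sigma> c) (restr p (A \<union> set (concat L)))"
    "iseq A L (map (map \<sigma>) L) \<or> iseq A (map (map \<sigma>) L) L"
    using good_extend[OF A p L(1)] by blast
  \<comment> \<open>The order of concatenation follows the direction of the independence. Only the
    set of blocks matters for the weave.\<close>
  obtain L1 where L1: "good A n p L1" "good A n q L1" "set L1 = set L \<union> map \<sigma> ` set L"
  proof (cases "iseq A L (map (map \<sigma>) L)")
    case True
    show ?thesis
      by (rule that[of "L @ map (map \<sigma>) L"])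
        (use good_double(1)[OF A(1) p L(1) \<sigma>(1) True] good_double(1)[OF A(1) q L(2) \<sigma>(1) True] in auto)
  next
    case False
    then have F: "iseq A (map (map \<sigma>) L) L" using \<sigma>(3) by blast
    show ?thesis
      by (rule that[of "map (map \<sigma>) L @ L"])
        (use good_double(2)[OF A(1) p L(1) \<sigma>(1) F] good_double(2)[OF A(1) q L(2) \<sigma>(1) F] in auto)
  qed
  obtain \<rho> where \<rho>: "autf A \<rho>" "\<And>c. c \<in> set L1 \<Longrightarrow> realizes M n (map \<rho> c) (restr q (A \<union> set (concat L1)))"
    "iseq A L1 (map (map \<rho>) L1) \<or> iseq A (map (map \<rho>) L1) L1"
    using good_extend[OF A q L1(2)] by blast
  obtain L2 where L2: "good A n p L2" "good A n q L2" "set L2 = set L1 \<union> map \<rho> ` set L1"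
  proof (cases "iseq A L1 (map (map \<rho>) L1)")
    case True
    show ?thesis
      by (rule that[of "L1 @ map (map \<rho>) L1"])
        (use good_double(1)[OF A(1) p L1(1) \<rho>(1) True] good_double(1)[OF A(1) q L1(2) \<rho>(1) True] in auto)
  next
    case False
    then have F: "iseq A (map (map \<rho>) L1) L1" using \<rho>(3) by blast
    show ?thesis
      by (rule that[of "map (map \<rho>) L1 @ L1"])
        (use good_double(2)[OF A(1) p L1(1) \<rho>(1) F] good_double(2)[OF A(1) q L1(2) \<rho>(1) F] in auto)
  qed
  \<comment> \<open>\<open>True\<close> keeps the original and \<open>False\<close> selects the
    moved copy, left by \<open>\<rho>\<close> and lower by \<open>\<sigma>\<close>. The old weave
    thus sits unchanged in the \<open>(1,1)\<close>-cone.\<close>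
  define g where "g i = (if i then (\<lambda>a. a) else \<rho>)" for i :: bool
  define f where "f j = (if j then (\<lambda>a. a) else \<sigma>)" for j :: bool
  define h where "h x = (\<lambda>a. g (fst x) (f (snd x) a))" for x :: "bool \<times> bool"
  have gA: "autf A (g i)" and fA: "autf A (f j)" for i j using \<sigma>(1) \<rho>(1) autf_ident by (auto simp: g_def f_def)
  have hA: "autf A (h x)" for x unfolding h_def by (rule autf_comp[OF fA gA])
  define W' where "W' s = map (h (hd s)) (W (tl s))" for s
  have W'C: "W' (x # s) = map (h x) (W s)" for x s by (simp add: W'_def)
  have Wd: "set (W s) \<subseteq> dom M" if "length s = d" for s using good_blocks[OF L(1) WL[OF that]] by simp
  have fL1: "map (f j) (W s) \<in> set L1" if "length s = d" for j s
    using WL[OF that] L1(3) by (auto simp: f_def)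
  have L1d: "\<Union>(set ` set L1) \<subseteq> dom M" using good_blocks[OF L1(1)] by auto
  \<comment> \<open>Conditions at nodes above the root compare paths with the same first step
    \<open>x\<close>, so they are images of old conditions under one automorphism.\<close>
  have lift: "rl A n p' (W' (x # s)) (W' ` {t. length t = Suc d \<and> Q t})"
    if p': "invariant M A n p'" and "rl A n p' (W s) (W ` {t. length t = d \<and> Q (x # t)})"
      and Q: "\<And>y t. Q (y # t) \<Longrightarrow> y = x" for p' x s Q
  proof -
    have "rl A n p' (map (h x) (W s)) (map (h x) ` W ` {t. length t = d \<and> Q (x # t)})"
      by (rule rl_aut[OF p' hA A(1) _ that(2)]) (use Wd in auto)
    moreover have "W' ` {t. length t = Suc d \<and> Q t} \<subseteq> map (h x) ` W ` {t. length t = d \<and> Q (x # t)}"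
    proof
      fix y assume "y \<in> W' ` {t. length t = Suc d \<and> Q t}"
      then obtain z t where t: "y = W' (z # t)" "length t = d" "Q (z # t)" by (auto simp: length_Suc_conv)
      then show "y \<in> map (h x) ` W ` {t. length t = d \<and> Q (x # t)}" using Q[OF t(3)] W'C by auto
    qed
    ultimately show ?thesis unfolding W'C by (rule rl_mono)
  qed
  have W1: "rl A n p (W s) {}" "rl A n q (W s) {}" if "length s = d" for s using W that by (auto simp: fweave_def)
  have "fweave A n p q (Suc d) W'"
    unfolding fweave_def
  proof (intro conjI allI impI)
    fix s :: "(bool \<times> bool) list" assume "length s = Suc d"
    then obtain x s' where s: "s = x # s'" "length s' = d" by (auto simp: length_Suc_conv)
    show "rl A n p (W' s) {}" using rl_aut[OF p hA A(1) _ W1(1)[OF s(2)]] s W'C by simp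
    show "rl A n q (W' s) {}" using rl_aut[OF q hA A(1) _ W1(2)[OF s(2)]] s W'C by simp
  next
    fix \<tau> :: "(bool \<times> bool) list" and i s assume l: "length (\<tau> @ (i, False) # s) = Suc d"
    let ?Q = "\<lambda>t. \<exists>t'. t = \<tau> @ (i, True) # t'"
    show "rl A n p (W' (\<tau> @ (i, False) # s)) (W' ` {t. length t = Suc d \<and> ?Q t})"
    proof (cases \<tau>)
      case Nil
      have ls: "length s = d" using l Nil by simp
      \<comment> \<open>At the root the condition on \<open>p\<close> holds in the right column by
        the choice of \<open>\<sigma>\<close>; the automorphism \<open>g i\<close> carries it to
        column \<open>i\<close>.\<close>
      have "rl A n p (map \<sigma> (W s)) (set L)"
        using \<sigma>(2)[OF WL[OF ls]] by (simp add: rl_def)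
      then have 1: "rl A n p (map (g i) (map \<sigma> (W s))) (map (g i) ` set L)"
        by (rule rl_aut[OF p gA A(1), rotated]) (use good_blocks[OF L(1)] in auto)
      have 2: "W' ` {t. length t = Suc d \<and> ?Q t} \<subseteq> map (g i) ` set L"
        using WL Nil by (auto simp: W'C h_def f_def)
      have 3: "W' (\<tau> @ (i, False) # s) = map (g i) (map \<sigma> (W s))"
        using Nil by (simp add: W'C h_def f_def)
      show ?thesis unfolding 3 using 1 2 by (rule rl_mono)
    next
      case (Cons x \<tau>')
      have 1: "rl A n p (W (\<tau>' @ (i, False) # s)) (W ` {t. length t = d \<and> (\<exists>t'. t = \<tau>' @ (i, True) # t')})"
        using W l Cons by (simp add: fweave_def)
      have 2: "?Q (x # t) \<longleftrightarrow> (\<exists>t'. t = \<tau>' @ (i, True) # t')" for t using Cons by auto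
      have 3: "y = x" if "?Q (y # t)" for y t using that Cons by auto
      have "rl A n p (W' (x # \<tau>' @ (i, False) # s)) (W' ` {t. length t = Suc d \<and> ?Q t})"
        by (rule lift[OF p _ 3]) (unfold 2, rule 1)
      then show ?thesis using Cons by (simp only: append_Cons)
    qed
  next
    fix \<tau> :: "(bool \<times> bool) list" and j s assume l: "length (\<tau> @ (False, j) # s) = Suc d"
    let ?Q = "\<lambda>t. \<exists>j' t'. t = \<tau> @ (True, j') # t'"
    show "rl A n q (W' (\<tau> @ (False, j) # s)) (W' ` {t. length t = Suc d \<and> ?Q t})"
    proof (cases \<tau>)
      case Nil
      have ls: "length s = d" using l Nil by simp
      \<comment> \<open>The left half realizes \<open>q\<close> over both rows of the right half,
        and this is what makes the resulting weave strong.\<close>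
      have 1: "rl A n q (map \<rho> (map (f j) (W s))) (set L1)"
        using \<rho>(2)[OF fL1[OF ls]] by (simp add: rl_def)
      have 2: "W' ` {t. length t = Suc d \<and> ?Q t} \<subseteq> set L1"
        using fL1 Nil by (auto simp: W'C h_def g_def)
      have 3: "W' (\<tau> @ (False, j) # s) = map \<rho> (map (f j) (W s))"
        using Nil by (simp add: W'C h_def g_def)
      show ?thesis unfolding 3 using 1 2 by (rule rl_mono)
    next
      case (Cons x \<tau>')
      have 1: "rl A n q (W (\<tau>' @ (False, j) # s)) (W ` {t. length t = d \<and> (\<exists>j' t'. t = \<tau>' @ (True, j') # t')})"
        using W l Cons by (simp add: fweave_def)
      have 2: "?Q (x # t) \<longleftrightarrow> (\<exists>j' t'. t = \<tau>' @ (True, j') # t')" for t using Cons by auto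
      have 3: "y = x" if "?Q (y # t)" for y t using that Cons by auto
      have "rl A n q (W' (x # \<tau>' @ (False, j) # s)) (W' ` {t. length t = Suc d \<and> ?Q t})"
        by (rule lift[OF q _ 3]) (unfold 2, rule 1)
      then show ?thesis using Cons by (simp only: append_Cons)
    qed
  qed
  moreover have "W' s \<in> set L2" if "length s = Suc d" for s
  proof -
    obtain x s' where s: "s = x # s'" "length s' = d" using \<open>length s = Suc d\<close> by (auto simp: length_Suc_conv)
    have "W' s = map (g (fst x)) (map (f (snd x)) (W s'))" by (simp add: s W'C h_def)
    moreover have "map (g i) c \<in> set L2" if "c \<in> set L1" for i c using that L2(3) by (auto simp: g_def)
    ultimately show ?thesis using fL1[OF s(2)] by (simp only:)
  qed
  ultimately show ?case using L2 by blast
qed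

section \<open>Combs in a finite weave as Morley lists\<close>

lemma res_extends:
  assumes "extends \<sigma> (\<tau> @ [x])" "length \<tau> < d"
  obtains s where "map \<sigma> [0..<d] = \<tau> @ x # s" "length (\<tau> @ x # s) = d"
proof -
  let ?l = "map \<sigma> [0..<d]"
  have "take (Suc (length \<tau>)) ?l = \<tau> @ [x]"
    using assms by (intro nth_equalityI) (auto simp: extends_def)
  then have *: "?l = (\<tau> @ [x]) @ drop (Suc (length \<tau>)) ?l" by (metis append_take_drop_id)
  show ?thesis
    by (rule that[of "drop (Suc (length \<tau>)) ?l"]) (use * assms(2) in auto)
qed

text \<open>The inserted point realizes \<open>p\<close> over everything above it, so it becomes the
  most recent entry of the list. The depth only has to exceed the levels at which the comb
  splits.\<close>

lemma up_comb_mlist: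
  "up_comb C \<Longrightarrow> \<exists>d0. \<forall>d W. d0 \<le> d \<longrightarrow> fweave A n p q d W \<longrightarrow>
    (\<exists>L. mlist A n p L \<and> set L = (\<lambda>\<sigma>. W (map \<sigma> [0..<d])) ` C \<and> length L = card C)"
proof (induction rule: up_comb_induct)
  case (single a)
  have "mlist A n p [W (map a [0..<d])] \<and> set [W (map a [0..<d])] = (\<lambda>\<sigma>. W (map \<sigma> [0..<d])) ` {a} \<and>
    length [W (map a [0..<d])] = card {a}" if "fweave A n p q d W" for d W
    using that by (simp add: fweave_def rl_def)
  then show ?case by blast
next
  case (join a B \<tau> i)
  then obtain d0 where d0: "\<And>d W. d0 \<le> d \<Longrightarrow> fweave A n p q d W \<Longrightarrow>
    (\<exists>L. mlist A n p L \<and> set L = (\<lambda>\<sigma>. W (map \<sigma> [0..<d])) ` B \<and> length L = card B)" by blast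
  show ?case
  proof (intro exI[of _ "max d0 (Suc (length \<tau>))"] allI impI)
    fix d W assume d: "max d0 (Suc (length \<tau>)) \<le> d" and W: "fweave A n p q d W"
    let ?r = "\<lambda>\<sigma>. W (map \<sigma> [0..<d])"
    obtain L where L: "mlist A n p L" "set L = ?r ` B" "length L = card B" using d0[OF _ W] d by auto
    obtain s where s: "map a [0..<d] = \<tau> @ (i, False) # s" "length (\<tau> @ (i, False) # s) = d"
      using res_extends[OF join.hyps(2), of d] d by auto
    have "rl A n p (?r a) (W ` {t. length t = d \<and> (\<exists>t'. t = \<tau> @ (i, True) # t')})"
      using W s(2) unfolding fweave_def s(1) by simp
    moreover have "?r ` B \<subseteq> W ` {t. length t = d \<and> (\<exists>t'. t = \<tau> @ (i, True) # t')}"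
    proof
      fix y assume "y \<in> ?r ` B"
      then obtain b where b: "b \<in> B" "y = ?r b" by blast
      obtain s where "map b [0..<d] = \<tau> @ (i, True) # s" "length (\<tau> @ (i, True) # s) = d"
        using res_extends[OF join.hyps(3)[OF b(1)], of d] d by auto
      then have "map b [0..<d] \<in> {t. length t = d \<and> (\<exists>t'. t = \<tau> @ (i, True) # t')}" by simp
      then show "y \<in> W ` {t. length t = d \<and> (\<exists>t'. t = \<tau> @ (i, True) # t')}" unfolding b(2) by (rule imageI)
    qed
    ultimately have "rl A n p (?r a) (set L)" unfolding L(2) by (rule rl_mono)
    then have "mlist A n p (?r a # L)" using L(1) by (simp add: rl_def)
    moreover have "a \<notin> B" using extends_last[OF join.hyps(2)] extends_last[OF join.hyps(3), of a] by auto
    then have "length (?r a # L) = card (insert a B)" using L(3) finite_up_comb[OF join.hyps(1)] by simp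
    moreover have "set (?r a # L) = ?r ` insert a B" using L(2) by simp
    ultimately show "\<exists>L. mlist A n p L \<and> set L = ?r ` insert a B \<and> length L = card (insert a B)" by blast
  qed
qed

text \<open>The second coordinate on the right is left free at the splitting node, so the same step
  serves narrow and wide combs.\<close>

lemma right_step_mlist:
  assumes W: "fweave A n p q d W" and L: "mlist A n q L" "set L = (\<lambda>\<sigma>. W (map \<sigma> [0..<d])) ` B"
    and a: "extends a (\<tau> @ [(False, j)])" and b: "\<And>b. b \<in> B \<Longrightarrow> \<exists>j'. extends b (\<tau> @ [(True, j')])"
    and d: "length \<tau> < d"
  shows "\<exists>L. mlist A n q L \<and> set L = (\<lambda>\<sigma>. W (map \<sigma> [0..<d])) ` insert a B"
proof -
  let ?r = "\<lambda>\<sigma>. W (map \<sigma> [0..<d])"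
  obtain s where s: "map a [0..<d] = \<tau> @ (False, j) # s" "length (\<tau> @ (False, j) # s) = d"
    using res_extends[OF a d] by auto
  have "rl A n q (?r a) (W ` {t. length t = d \<and> (\<exists>j' t'. t = \<tau> @ (True, j') # t')})"
    using W s(2) unfolding fweave_def s(1) by simp
  moreover have "?r ` B \<subseteq> W ` {t. length t = d \<and> (\<exists>j' t'. t = \<tau> @ (True, j') # t')}"
  proof
    fix y assume "y \<in> ?r ` B"
    then obtain c where c: "c \<in> B" "y = ?r c" by blast
    then obtain j' where "extends c (\<tau> @ [(True, j')])" using b by blast
    then obtain s where "map c [0..<d] = \<tau> @ (True, j') # s" "length (\<tau> @ (True, j') # s) = d"
      using res_extends[OF _ d] by blast
    then have "map c [0..<d] \<in> {t. length t = d \<and> (\<exists>j' t'. t = \<tau> @ (True, j') # t')}" by auto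
    then show "y \<in> W ` {t. length t = d \<and> (\<exists>j' t'. t = \<tau> @ (True, j') # t')}" unfolding c(2) by (rule imageI)
  qed
  ultimately have "rl A n q (?r a) (set L)" unfolding L(2) by (rule rl_mono)
  then have "mlist A n q (?r a # L)" using L(1) by (simp add: rl_def)
  moreover have "set (?r a # L) = ?r ` insert a B" using L(2) by simp
  ultimately show ?thesis by blast
qed

lemma single_mlist:
  assumes "fweave A n p q d W"
  shows "\<exists>L. mlist A n q L \<and> set L = (\<lambda>\<sigma>. W (map \<sigma> [0..<d])) ` {a}"
  using assms by (intro exI[of _ "[W (map a [0..<d])]"]) (simp add: fweave_def rl_def)

lemma right_comb_mlist:
  "right_comb C \<Longrightarrow> \<exists>d0. \<forall>d W. d0 \<le> d \<longrightarrow> fweave A n p q d W \<longrightarrow>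
    (\<exists>L. mlist A n q L \<and> set L = (\<lambda>\<sigma>. W (map \<sigma> [0..<d])) ` C)"
proof (induction rule: right_comb_induct)
  case (single a)
  then show ?case using single_mlist by blast
next
  case (join a B \<tau> j)
  then obtain d0 where d0: "\<And>d W. d0 \<le> d \<Longrightarrow> fweave A n p q d W \<Longrightarrow>
    (\<exists>L. mlist A n q L \<and> set L = (\<lambda>\<sigma>. W (map \<sigma> [0..<d])) ` B)" by blast
  show ?case
  proof (intro exI[of _ "max d0 (Suc (length \<tau>))"] allI impI)
    fix d W assume d: "max d0 (Suc (length \<tau>)) \<le> d" and W: "fweave A n p q d W"
    obtain L where L: "mlist A n q L" "set L = (\<lambda>\<sigma>. W (map \<sigma> [0..<d])) ` B" using d0[OF _ W] d by auto
    show "\<exists>L. mlist A n q L \<and> set L = (\<lambda>\<sigma>. W (map \<sigma> [0..<d])) ` insert a B"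
      by (rule right_step_mlist[OF W L join.hyps(2)]) (use join.hyps(3) d in auto)
  qed
qed

lemma wide_right_comb_mlist:
  assumes "wide_right_comb C"
  shows "\<exists>d0. \<forall>d W. d0 \<le> d \<longrightarrow> fweave A n p q d W \<longrightarrow>
    (\<exists>L. mlist A n q L \<and> set L = (\<lambda>\<sigma>. W (map \<sigma> [0..<d])) ` C)"
  using assms
proof cases
  case (single \<sigma>)
  then show ?thesis using single_mlist by blast
next
  case (join A' B)
  then obtain a where a: "A' = {a}" using comb_single(2) by blast
  obtain \<tau> where \<tau>: "\<exists>j. extends a (\<tau> @ [(False, j)])" "\<And>b. b \<in> B \<Longrightarrow> \<exists>j. extends b (\<tau> @ [(True, j)])"
    using join(5) a unfolding widely_left_def by blast
  then obtain j where j: "extends a (\<tau> @ [(False, j)])" by blast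
  obtain d0 where d0: "\<And>d W. d0 \<le> d \<Longrightarrow> fweave A n p q d W \<Longrightarrow>
    (\<exists>L. mlist A n q L \<and> set L = (\<lambda>\<sigma>. W (map \<sigma> [0..<d])) ` B)"
    using right_comb_mlist[OF join(3)] by blast
  show ?thesis
  proof (intro exI[of _ "max d0 (Suc (length \<tau>))"] allI impI)
    fix d W assume d: "max d0 (Suc (length \<tau>)) \<le> d" and W: "fweave A n p q d W"
    obtain L where L: "mlist A n q L" "set L = (\<lambda>\<sigma>. W (map \<sigma> [0..<d])) ` B" using d0[OF _ W] d by auto
    have "\<exists>L. mlist A n q L \<and> set L = (\<lambda>\<sigma>. W (map \<sigma> [0..<d])) ` insert a B"
      by (rule right_step_mlist[OF W L j \<tau>(2)]) (use d in auto)
    then show "\<exists>L. mlist A n q L \<and> set L = (\<lambda>\<sigma>. W (map \<sigma> [0..<d])) ` C" using join(1) a by simp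
  qed
qed

text \<open>The formula of a weave has no parameters. Those of the given formula are turned into
  trailing variables, and the tuple \<open>as\<close> is later appended to each member of the
  weave.\<close>

lemma fml_parameters:
  assumes "fml M A n \<phi>"
  obtains \<phi>' as where "fml M {} (n + length as) \<phi>'" "set as \<subseteq> A"
    "\<And>xs. length xs = n \<Longrightarrow> holds M \<phi>' (xs @ as) \<longleftrightarrow> holds M \<phi> xs"
proof -
  obtain as where as: "set as = params \<phi>" using finite_list[OF finite_params[of \<phi>]] by auto
  define idx where "idx a = (SOME i. i < length as \<and> as ! i = a)" for a
  have idx: "idx a < length as \<and> as ! idx a = a" if "a \<in> params \<phi>" for a
    unfolding idx_def by (rule someI_ex) (use that as in \<open>auto simp: in_set_conv_nth\<close>)
  let ?\<psi> = "sb 0 Inl (\<lambda>a. Inl (n + idx a)) \<phi>"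
  have f: "fml M {} (n + length as) ?\<psi>"
    unfolding fml_def
  proof (intro conjI)
    show "wf M ?\<psi>" using assms by (simp add: fml_def)
    show "fv ?\<psi> \<subseteq> {..<n + length as}"
      using fv_sb[of Inl "\<lambda>a. Inl (n + idx a)" \<phi>] idx assms by (fastforce simp: fml_def)
    show "params ?\<psi> \<subseteq> {}" using params_sb[of Inl "\<lambda>a. Inl (n + idx a)" \<phi>] by auto
  qed
  show ?thesis
  proof (rule that[OF f])
    show "set as \<subseteq> A" using as assms by (simp add: fml_def)
    fix xs :: "'a list" assume xs: "length xs = n"
    let ?e = "\<lambda>i. if i < length (xs @ as) then (xs @ as) ! i else undefined"
    have "holds M ?\<psi> (xs @ as) \<longleftrightarrow> sat M ?e ?\<psi>"
      by (rule holds_sat) (use f xs in \<open>auto simp: fml_def\<close>)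
    also have "\<dots> \<longleftrightarrow> sat M (\<lambda>i. val ?e (Inl i)) \<phi>"
      by (rule sat_sb_id) (use idx xs in \<open>auto simp: nth_append\<close>)
    also have "\<dots> \<longleftrightarrow> holds M \<phi> xs"
      by (rule holds_sat[symmetric]) (use assms xs in \<open>auto simp: fml_def nth_append\<close>)
    finally show "holds M ?\<psi> (xs @ as) \<longleftrightarrow> holds M \<phi> xs" .
  qed
qed

text \<open>A finite weave that is deep enough for given combs turns up-combs into Morley lists of
  \<open>p\<close> and right-combs, narrow or wide, into Morley lists of \<open>q\<close>. Dividing
  and non-dividing then decide consistency, and compactness merges the finite weaves.\<close>

lemma strong_weave_from_types:
  assumes A: "A \<subseteq> dom M" "A \<prec> K" and p: "invariant M A n p" and q: "invariant M A n q"
    and b: "good A n p [b]" "good A n q [b]" and f: "fml M A (m + n) \<phi>"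
    and kd: "k_divides_along M A m \<phi> n p k" and nd: "\<not> divides_along M A m \<phi> n q"
  shows "has_weave M k True"
proof -
  let ?Rc = "\<lambda>C. right_comb C \<or> wide_right_comb C"
  have "\<exists>B. wv m n \<phi> k ?Rc {} {[]} {[]} UNIV B"
  proof (rule weave_compactness[OF A f])
    fix r0 :: "('f, 'r, 'a) fm set" and CC :: "path set set"
    assume r0: "r0 \<subseteq> {}" and CC: "finite CC"
    have "\<forall>C\<in>CC. \<exists>d0. \<forall>d W. d0 \<le> d \<longrightarrow> fweave A n p q d W \<longrightarrow>
      (up_comb C \<longrightarrow> (\<exists>L. mlist A n p L \<and> set L = (\<lambda>\<sigma>. W (map \<sigma> [0..<d])) ` C \<and> length L = card C)) \<and>
      (?Rc C \<longrightarrow> (\<exists>L. mlist A n q L \<and> set L = (\<lambda>\<sigma>. W (map \<sigma> [0..<d])) ` C))"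
    proof
      fix C
      obtain d1 where 1: "\<forall>d W. d1 \<le> d \<longrightarrow> fweave A n p q d W \<longrightarrow> up_comb C \<longrightarrow>
        (\<exists>L. mlist A n p L \<and> set L = (\<lambda>\<sigma>. W (map \<sigma> [0..<d])) ` C \<and> length L = card C)"
      proof (cases "up_comb C")
        case True
        then show ?thesis using up_comb_mlist[of C A n p q] that by auto
      qed (use that in auto)
      obtain d2 where 2: "\<forall>d W. d2 \<le> d \<longrightarrow> fweave A n p q d W \<longrightarrow> ?Rc C \<longrightarrow>
        (\<exists>L. mlist A n q L \<and> set L = (\<lambda>\<sigma>. W (map \<sigma> [0..<d])) ` C)"
      proof (cases "?Rc C")
        case True
        then have "\<exists>d2. \<forall>d W. d2 \<le> d \<longrightarrow> fweave A n p q d W \<longrightarrow>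
          (\<exists>L. mlist A n q L \<and> set L = (\<lambda>\<sigma>. W (map \<sigma> [0..<d])) ` C)"
          using right_comb_mlist[of C A n p q] wide_right_comb_mlist[of C A n p q] by (elim disjE) simp_all
        then obtain d2 where "\<forall>d W. d2 \<le> d \<longrightarrow> fweave A n p q d W \<longrightarrow>
          (\<exists>L. mlist A n q L \<and> set L = (\<lambda>\<sigma>. W (map \<sigma> [0..<d])) ` C)" by (elim exE)
        then show ?thesis by (intro that[of d2]) simp
      qed (use that in auto)
      show "\<exists>d0. \<forall>d W. d0 \<le> d \<longrightarrow> fweave A n p q d W \<longrightarrow>
        (up_comb C \<longrightarrow> (\<exists>L. mlist A n p L \<and> set L = (\<lambda>\<sigma>. W (map \<sigma> [0..<d])) ` C \<and> length L = card C)) \<and>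
        (?Rc C \<longrightarrow> (\<exists>L. mlist A n q L \<and> set L = (\<lambda>\<sigma>. W (map \<sigma> [0..<d])) ` C))"
        using 1 2 by (intro exI[of _ "max d1 d2"]) simp
    qed
    then obtain D where D: "\<And>C d W. C \<in> CC \<Longrightarrow> D C \<le> d \<Longrightarrow> fweave A n p q d W \<Longrightarrow>
      (up_comb C \<longrightarrow> (\<exists>L. mlist A n p L \<and> set L = (\<lambda>\<sigma>. W (map \<sigma> [0..<d])) ` C \<and> length L = card C)) \<and>
      (?Rc C \<longrightarrow> (\<exists>L. mlist A n q L \<and> set L = (\<lambda>\<sigma>. W (map \<sigma> [0..<d])) ` C))" by metis
    \<comment> \<open>The sum is a convenient common upper bound for finitely many required
      depths.\<close>
    define d where "d = (\<Sum>C\<in>CC. D C)"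
    have dD: "D C \<le> d" if "C \<in> CC" for C unfolding d_def using that CC by (simp add: member_le_sum)
    obtain W where W: "fweave A n p q d W" using fweave_exists[OF A p q b, of d] by blast
    let ?B = "\<lambda>\<sigma>. W (map \<sigma> [0..<d])"
    have "wv m n \<phi> k ?Rc r0 {[]} {[]} CC ?B"
      unfolding wv_def
    proof (intro conjI allI ballI impI)
      fix \<sigma> :: path
      have "rl A n p (W (map \<sigma> [0..<d])) {}" using W by (simp add: fweave_def)
      then show "length (?B \<sigma>) = n" "set (?B \<sigma>) \<subseteq> dom M" by (auto simp: rl_def realizes_def)
      fix \<theta> assume "\<theta> \<in> r0" then show "holds M \<theta> (?B \<sigma>)" using r0 by blast
    next
      fix u C assume u: "u \<in> {[] :: 'a list list}" and C: "C \<in> CC" "(C = {} \<or> up_comb C) \<and> length u + card C = k"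
      have "\<exists>L. mlist A n p L \<and> set L = ?B ` C \<and> length L = card C"
      proof (cases "C = {}")
        case True
        then show ?thesis by (intro exI[of _ "[]"]) simp
      qed (use D[OF C(1) dD[OF C(1)] W] C in blast)
      then obtain L where L: "mlist A n p L" "set L = ?B ` C" "length L = k" using C u by auto
      show "\<not> jsat m \<phi> (set u \<union> ?B ` C)" using k_divides_mlist[OF A p f kd L(1,3)] L(2) u by simp
    next
      fix v C assume v: "v \<in> {[] :: 'a list list}" and C: "C \<in> CC" "C = {} \<or> ?Rc C"
      have "\<exists>L. mlist A n q L \<and> set L = ?B ` C"
      proof (cases "C = {}")
        case True
        then show ?thesis by (intro exI[of _ "[]"]) simp
      qed (use D[OF C(1) dD[OF C(1)] W] C in blast)
      then obtain L where L: "mlist A n q L" "set L = ?B ` C" by blast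
      show "jsat m \<phi> (set v \<union> ?B ` C)" using not_divides_mlist[OF A q f nd L(1)] L(2) v by simp
    qed
    then show "\<exists>B. wv m n \<phi> k ?Rc r0 {[]} {[]} CC B" by blast
  qed (use finite_right_comb finite_wide_right_comb in auto)
  then obtain B where B: "wv m n \<phi> k ?Rc {} {[]} {[]} UNIV B" by blast
  obtain \<phi>' as where \<phi>': "fml M {} (m + n + length as) \<phi>'" "set as \<subseteq> A"
    "\<And>xs. length xs = m + n \<Longrightarrow> holds M \<phi>' (xs @ as) \<longleftrightarrow> holds M \<phi> xs"
  proof (rule fml_parameters[OF f])
  qed (rule that)
  have Bn: "length (B \<sigma>) = n" "set (B \<sigma>) \<subseteq> dom M" for \<sigma> using B by (auto simp: wv_def)
  define bs where "bs \<sigma> = B \<sigma> @ as" for \<sigma>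
  have hb: "holds M \<phi>' (xs @ bs \<sigma>) \<longleftrightarrow> holds M \<phi> (xs @ B \<sigma>)" if "length xs = m" for xs \<sigma>
    using \<phi>'(3)[of "xs @ B \<sigma>"] that Bn by (simp add: bs_def)
  have fs: "fam_sat M m \<phi>' bs J \<longleftrightarrow> jsat m \<phi> (B ` J)" for J
    unfolding fam_sat_def jsat_def by (intro ex_cong1) (auto simp: hb)
  have cons: "fam_consistent M m \<phi>' bs C" if "?Rc C" for C
  proof -
    have "jsat m \<phi> (B ` C)" using that B unfolding wv_def by (elim disjE) simp_all
    then show ?thesis unfolding fam_consistent_def fs using jsat_mono image_mono by metis
  qed
  have "fam_k_inconsistent M m \<phi>' bs C k" if C: "up_comb C" for C
    unfolding fam_k_inconsistent_def fs
  proof (intro allI impI)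
    fix J assume J: "J \<subseteq> C" "finite J \<and> card J = k"
    then have "J = {} \<or> up_comb J" using up_comb_subset[OF C] by blast
    moreover have "\<forall>C. (C = {} \<or> up_comb C) \<and> card C = k \<longrightarrow> \<not> jsat m \<phi> (B ` C)"
      using B unfolding wv_def by simp
    ultimately show "\<not> jsat m \<phi> (B ` J)" using J by blast
  qed
  then show ?thesis unfolding has_weave_def
    using \<phi>'(1,2) A Bn cons
    by (intro exI[of _ m] exI[of _ "n + length as"] exI[of _ \<phi>'] exI[of _ bs]) (auto simp: bs_def add.assoc)
qed

lemma good_singleton:
  assumes "A \<subseteq> dom M" "gtype M n p" "length b = n" "set b \<subseteq> dom M" "tp M A b \<subseteq> p"
    "bi_invariant M A n p \<or> semi_reliable M A n p"
  shows "good A n p [b]"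
proof -
  have r: "realizes M n b (restr p A)" using tp_subset_restr_iff[OF assms(2,1,3,4)] assms(5) by simp
  have "{shift (i * n) \<psi> | \<psi> i. \<psi> \<in> p \<and> i < length [b]} \<subseteq> p" by (auto simp: shift_0)
  then show ?thesis using r assms(5,6) unfolding good_def by auto
qed

lemma no_strong_weave_kims_lemma:
  assumes "\<not> has_weave M k True"
  shows "kims_lemma M K False k
     (\<lambda>A n p. bi_invariant M A n p \<or> semi_reliable M A n p) (\<lambda>A n p. bi_invariant M A n p \<or> semi_reliable M A n p)"
  unfolding kims_lemma_def
proof (intro allI impI, elim conjE, rule ccontr)
  fix A m n \<phi> b p q
  assume *: "A \<subseteq> dom M" "small K A" "fml M A (m + n) \<phi>" "length b = n" "set b \<subseteq> dom M"
    "gtype M n p" "gtype M n q" "tp M A b \<subseteq> p" "tp M A b \<subseteq> q"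
    "bi_invariant M A n p \<or> semi_reliable M A n p" "bi_invariant M A n q \<or> semi_reliable M A n q"
    "k_divides_along M A m \<phi> n p k" "\<not> divides_along M A m \<phi> n q"
  have "invariant M A n p" "invariant M A n q"
    using *(10,11) semi_reliable_invariant by (auto simp: bi_invariant_def)
  then have "has_weave M k True"
    using strong_weave_from_types[OF *(1) _ _ _ _ _ *(3,12,13), of b] *(2)
      good_singleton[OF *(1,6,4,5,8,10)] good_singleton[OF *(1,7,4,5,9,11)] by (simp add: small_def)
  then show False using assms by blast
qed

end

section \<open>From a weave to a failure of Kim's lemma\<close>

text \<open>A weave restricted to a set that is not nowhere dense contains weaves of every finite depth.\<close>

definition nowhere_dense :: "path set \<Rightarrow> bool" where
  "nowhere_dense X \<longleftrightarrow> (\<forall>\<tau>0. \<exists>\<tau>. \<forall>\<sigma>\<in>X. \<not> extends \<sigma> (\<tau>0 @ \<tau>))"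

lemma extends_append: "extends \<sigma> (\<tau> @ \<tau>') \<Longrightarrow> extends \<sigma> \<tau>"
proof -
  assume *: "extends \<sigma> (\<tau> @ \<tau>')"
  have "\<sigma> j = \<tau> ! j" if "j < length \<tau>" for j
    using *[unfolded extends_def, rule_format, of j] that by (simp add: nth_append)
  then show ?thesis by (simp add: extends_def)
qed

lemma nowhere_dense_Un:
  assumes "nowhere_dense X" "nowhere_dense Y" shows "nowhere_dense (X \<union> Y)"
  unfolding nowhere_dense_def
proof
  fix \<tau>0
  obtain \<tau> where \<tau>: "\<forall>\<sigma>\<in>X. \<not> extends \<sigma> (\<tau>0 @ \<tau>)" using assms(1) unfolding nowhere_dense_def by blast
  obtain \<tau>' where \<tau>': "\<forall>\<sigma>\<in>Y. \<not> extends \<sigma> ((\<tau>0 @ \<tau>) @ \<tau>')" using assms(2) unfolding nowhere_dense_def by blast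
  have "\<not> extends \<sigma> (\<tau>0 @ \<tau> @ \<tau>')" if "\<sigma> \<in> X \<union> Y" for \<sigma>
    using that \<tau> \<tau>' extends_append[of \<sigma> "\<tau>0 @ \<tau>" \<tau>'] by auto
  then show "\<exists>\<tau>. \<forall>\<sigma>\<in>X \<union> Y. \<not> extends \<sigma> (\<tau>0 @ \<tau>)" by blast
qed

lemma nowhere_dense_mono: "nowhere_dense X \<Longrightarrow> Y \<subseteq> X \<Longrightarrow> nowhere_dense Y"
  unfolding nowhere_dense_def by (meson subsetD)

lemma not_nowhere_dense_UNIV: "\<not> nowhere_dense UNIV"
proof
  assume "nowhere_dense UNIV"
  then obtain \<tau> where "\<And>\<sigma>. \<not> extends \<sigma> ([] @ \<tau>)" unfolding nowhere_dense_def by blast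
  moreover have "extends (\<lambda>j. if j < length \<tau> then \<tau> ! j else (True, True)) ([] @ \<tau>)" by (simp add: extends_def)
  ultimately show False by blast
qed

text \<open>Sets of pairs of a stage and a path whose fibres are nowhere dense from some stage on. A
  set outside the ideal has a somewhere dense fibre at arbitrarily late stages.\<close>

definition sparse_ideal :: "(nat \<times> path) set set" where
  "sparse_ideal = {Z. \<exists>n0. \<forall>i\<ge>n0. nowhere_dense {\<sigma>. (i, \<sigma>) \<in> Z}}"

lemma proper_sparse_ideal: "proper_ideal sparse_ideal"
  unfolding proper_ideal_def
proof (intro conjI ballI allI impI)
  show "{} \<in> sparse_ideal" by (simp add: sparse_ideal_def nowhere_dense_def)
  show "UNIV \<notin> sparse_ideal" using not_nowhere_dense_UNIV by (auto simp: sparse_ideal_def)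
  fix X Y assume "X \<in> sparse_ideal" "Y \<in> sparse_ideal"
  then obtain n1 n2 where n: "\<forall>i\<ge>n1. nowhere_dense {\<sigma>. (i, \<sigma>) \<in> X}" "\<forall>i\<ge>n2. nowhere_dense {\<sigma>. (i, \<sigma>) \<in> Y}"
    by (auto simp: sparse_ideal_def)
  have "nowhere_dense {\<sigma>. (i, \<sigma>) \<in> X \<union> Y}" if "max n1 n2 \<le> i" for i
  proof -
    have "{\<sigma>. (i, \<sigma>) \<in> X \<union> Y} = {\<sigma>. (i, \<sigma>) \<in> X} \<union> {\<sigma>. (i, \<sigma>) \<in> Y}" by auto
    then show ?thesis using n that nowhere_dense_Un by simp
  qed
  then show "X \<union> Y \<in> sparse_ideal" unfolding sparse_ideal_def by blast
next
  fix X Y assume "X \<in> sparse_ideal" "Y \<subseteq> X"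
  then obtain n0 where n0: "\<forall>i\<ge>n0. nowhere_dense {\<sigma>. (i, \<sigma>) \<in> X}" by (auto simp: sparse_ideal_def)
  have "nowhere_dense {\<sigma>. (i, \<sigma>) \<in> Y}" if "n0 \<le> i" for i
    by (rule nowhere_dense_mono[of "{\<sigma>. (i, \<sigma>) \<in> X}"]) (use n0 that \<open>Y \<subseteq> X\<close> in auto)
  then show "Y \<in> sparse_ideal" unfolding sparse_ideal_def by blast
qed

text \<open>Copies of the symbol sets and of the set of paths inside \<open>'a\<close> can be united
  into one set that bounds all of them.\<close>

lemma (in monster_model) small_image:
  assumes "S \<prec> K" obtains \<Lambda> :: "'a set" where "\<Lambda> \<prec> K" "S \<lesssim> \<Lambda>"
proof -
  obtain f where f: "inj_on f S" "f ` S \<subseteq> K" using assms unfolding lesspoll_def lepoll_def by auto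
  show ?thesis by (rule that[of "f ` S"]) (use f assms in simp_all)
qed

text \<open>Writes \<open>\<psi>\<close> as \<open>\<theta>(b, y)\<close> with
  \<open>\<theta>\<close> over \<open>N\<close>. Elements of \<open>b\<close> that lie in
  \<open>N\<close> may remain parameters; only those outside \<open>N\<close> become
  variables.\<close>

lemma (in monster_model) abstract_parameters:
  assumes "fml M (N \<union> set b) l \<psi>"
  obtains \<theta> where "fml M N (length b + l) \<theta>" "\<And>c. length c = l \<Longrightarrow> holds M \<theta> (b @ c) \<longleftrightarrow> holds M \<psi> c"
proof -
  define idx where "idx a = (SOME i. i < length b \<and> b ! i = a)" for a
  have idx: "idx a < length b \<and> b ! idx a = a" if "a \<in> set b" for a
    unfolding idx_def by (rule someI_ex) (use that in \<open>auto simp: in_set_conv_nth\<close>)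
  define \<beta> where "\<beta> a = (if a \<in> N then Inr a else Inl (idx a))" for a
  let ?\<alpha> = "\<lambda>i. Inl (length b + i)"
  let ?\<theta> = "sb 0 ?\<alpha> \<beta> \<psi>"
  have idx': "idx a < length b \<and> b ! idx a = a" if "a \<in> params \<psi>" "a \<notin> N" for a
    using idx[of a] that assms by (auto simp: fml_def)
  have f: "fml M N (length b + l) ?\<theta>"
    unfolding fml_def
  proof (intro conjI)
    show "wf M ?\<theta>" using assms by (simp add: fml_def)
    show "fv ?\<theta> \<subseteq> {..<length b + l}"
    proof
      fix j assume "j \<in> fv ?\<theta>"
      then consider i where "i \<in> fv \<psi>" "j = length b + i" | a where "a \<in> params \<psi>" "\<beta> a = Inl j"
        using fv_sb[of ?\<alpha> \<beta> \<psi>] by auto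
      then show "j \<in> {..<length b + l}"
      proof cases
        case 1
        then show ?thesis using assms by (auto simp: fml_def)
      next
        case 2
        then show ?thesis using idx'[of a] by (auto simp: \<beta>_def split: if_splits)
      qed
    qed
    show "params ?\<theta> \<subseteq> N" using params_sb[of ?\<alpha> \<beta> \<psi>] by (auto simp: \<beta>_def split: if_splits)
  qed
  show ?thesis
  proof (rule that[OF f])
    fix c :: "'a list" assume c: "length c = l"
    let ?e = "\<lambda>i. if i < length (b @ c) then (b @ c) ! i else undefined"
    have "holds M ?\<theta> (b @ c) \<longleftrightarrow> sat M ?e ?\<theta>"
      by (rule holds_sat) (use f c in \<open>auto simp: fml_def\<close>)
    also have "\<dots> \<longleftrightarrow> sat M (\<lambda>i. val ?e (?\<alpha> i)) \<psi>"
    proof (rule sat_sb_id)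
      fix a assume "a \<in> params \<psi>"
      then show "val ?e (\<beta> a) = a" using idx'[of a] by (auto simp: \<beta>_def nth_append)
    qed
    also have "\<dots> \<longleftrightarrow> holds M \<psi> c"
      by (rule holds_sat[symmetric]) (use assms c in \<open>auto simp: fml_def nth_append\<close>)
    finally show "holds M ?\<theta> (b @ c) \<longleftrightarrow> holds M \<psi> c" .
  qed
qed

lemma (in monster_model) inst_front:
  assumes "fml M N (length b + l) \<theta>" "set b \<subseteq> N"
  obtains \<psi> where "fml M N l \<psi>" "\<And>c. length c = l \<Longrightarrow> holds M \<psi> c \<longleftrightarrow> holds M \<theta> (b @ c)"
proof -
  let ?\<alpha> = "\<lambda>i. if i < length b then Inr (b ! i) else Inl (i - length b)"
  let ?\<psi> = "sb 0 ?\<alpha> Inr \<theta>"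
  have f: "fml M N l ?\<psi>"
    unfolding fml_def
  proof (intro conjI)
    show "wf M ?\<psi>" using assms by (simp add: fml_def)
    show "fv ?\<psi> \<subseteq> {..<l}"
      using fv_sb[of ?\<alpha> Inr \<theta>] assms by (fastforce simp: fml_def split: if_splits)
    show "params ?\<psi> \<subseteq> N"
    proof
      fix a assume "a \<in> params ?\<psi>"
      then consider i where "i \<in> fv \<theta>" "?\<alpha> i = Inr a" | "a \<in> params \<theta>"
        using params_sb[of ?\<alpha> Inr \<theta>] by blast
      then show "a \<in> N" using assms by cases (auto simp: fml_def split: if_splits)
    qed
  qed
  show ?thesis
  proof (rule that[OF f])
    fix c :: "'a list" assume c: "length c = l"
    let ?e = "\<lambda>i. if i < length c then c ! i else undefined"
    have "holds M ?\<psi> c \<longleftrightarrow> sat M ?e ?\<psi>"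
      by (rule holds_sat) (use f c in \<open>auto simp: fml_def\<close>)
    also have "\<dots> \<longleftrightarrow> sat M (\<lambda>i. val ?e (?\<alpha> i)) \<theta>" by (rule sat_sb_id) simp
    also have "\<dots> \<longleftrightarrow> holds M \<theta> (b @ c)"
      by (rule holds_sat[symmetric]) (use assms c in \<open>auto simp: fml_def nth_append\<close>)
    finally show "holds M ?\<psi> c \<longleftrightarrow> holds M \<theta> (b @ c)" .
  qed
qed

text \<open>The Tarski-Vaught test. The hypothesis also yields that \<open>N\<close> is nonempty and
  closed under functions.\<close>

lemma (in monster_model) elementary_submodel:
  assumes N: "N \<subseteq> dom M" "N \<prec> K"
    and TV: "\<And>\<theta> a. fml M N 1 \<theta> \<Longrightarrow> a \<in> dom M \<Longrightarrow> holds M \<theta> [a] \<Longrightarrow> \<exists>a'\<in>N. holds M \<theta> [a']"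
  shows "is_model M K N"
proof -
  obtain a0 where "a0 \<in> dom M" using dom_ne by blast
  then obtain a1 where a1: "a1 \<in> N"
    using TV[of "Neg FF" a0] by (auto simp: fml_def fv_def holds_def)
  have "fnc M f as \<in> N" if as: "set as \<subseteq> N" "length as = arF M f" for f as
  proof -
    \<comment> \<open>The value of a function at elements of \<open>N\<close> is the only solution
      of this formula, so the test puts it into \<open>N\<close>.\<close>
    let ?\<theta> = "Eq (Var 0) (App f (map Par as))"
    have h: "holds M ?\<theta> [x] \<longleftrightarrow> x = fnc M f as" for x by (simp add: holds_def o_def)
    have "fml M N 1 ?\<theta>" using as by (auto simp: fml_def fv_def)
    moreover have "fnc M f as \<in> dom M" using struc as N unfolding is_struc_def by (meson subset_trans)
    ultimately obtain a' where "a' \<in> N" "holds M ?\<theta> [a']" using TV[of ?\<theta> "fnc M f as"] h by blast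
    then show ?thesis using h by simp
  qed
  then have S: "is_struc (M\<lparr>dom := N\<rparr>)" using a1 by (auto simp: is_struc_def)
  have ev: "evalt (M\<lparr>dom := N\<rparr>) e t = evalt M e t" for e t
  proof (induction t)
    case (App f ts)
    then have "map (evalt (M\<lparr>dom := N\<rparr>) e) ts = map (evalt M e) ts" by simp
    then show ?case by (simp del: map_eq_conv)
  qed auto
  have el: "sat (M\<lparr>dom := N\<rparr>) e \<phi> \<longleftrightarrow> sat M e \<phi>" if "wf M \<phi>" "params \<phi> \<subseteq> N" "range e \<subseteq> N" for e \<phi>
    using that
  proof (induction \<phi> arbitrary: e)
    case (Eq s t)
    then show ?case by (simp add: ev)
  next
    case (Rel R ts)
    have "map (evalt (M\<lparr>dom := N\<rparr>) e) ts = map (evalt M e) ts" by (simp add: ev)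
    then show ?case by (simp del: map_eq_conv)
  next
    case (Ex \<phi>)
    have IH: "sat (M\<lparr>dom := N\<rparr>) (case_nat a e) \<phi> \<longleftrightarrow> sat M (case_nat a e) \<phi>" if "a \<in> N" for a
    proof -
      have "range (case_nat a e) \<subseteq> N" using that Ex.prems(3) by (force split: nat.split)
      then show ?thesis using Ex.IH Ex.prems by simp
    qed
    \<comment> \<open>The environment takes values in \<open>N\<close>, so all variables other than
      the quantified one can be filled with parameters from \<open>N\<close>.\<close>
    let ?\<alpha> = "\<lambda>i. case i of 0 \<Rightarrow> Inl (0 :: nat) | Suc j \<Rightarrow> Inr (e j)"
    let ?\<theta> = "sb 0 ?\<alpha> Inr \<phi>"
    have f: "fml M N 1 ?\<theta>"
      unfolding fml_def
    proof (intro conjI)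
      show "wf M ?\<theta>" using Ex.prems by simp
      show "fv ?\<theta> \<subseteq> {..<1}"
      proof
        fix j assume "j \<in> fv ?\<theta>"
        then obtain i where "?\<alpha> i = Inl j" using fv_sb[of ?\<alpha> Inr \<phi>] by blast
        then show "j \<in> {..<1}" by (auto split: nat.splits)
      qed
      show "params ?\<theta> \<subseteq> N"
      proof
        fix a assume "a \<in> params ?\<theta>"
        then consider i where "?\<alpha> i = Inr a" | "a \<in> params \<phi>"
          using subsetD[OF params_sb[of ?\<alpha> Inr \<phi>]] by auto
        then show "a \<in> N" using Ex.prems(2,3) by cases (auto split: nat.splits)
      qed
    qed
    have h: "holds M ?\<theta> [a] \<longleftrightarrow> sat M (case_nat a e) \<phi>" for a
    proof -
      have "holds M ?\<theta> [a] \<longleftrightarrow> sat M (\<lambda>_. a) ?\<theta>"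
        by (rule holds_sat) (use f in \<open>auto simp: fml_def\<close>)
      also have "\<dots> \<longleftrightarrow> sat M (\<lambda>i. val (\<lambda>_. a) (?\<alpha> i)) \<phi>" by (rule sat_sb_id) simp
      also have "(\<lambda>i. val (\<lambda>_. a) (?\<alpha> i)) = case_nat a e" by (auto split: nat.split)
      finally show ?thesis .
    qed
    have "(\<exists>a\<in>N. sat M (case_nat a e) \<phi>) \<longleftrightarrow> (\<exists>a\<in>dom M. sat M (case_nat a e) \<phi>)"
      using TV[OF f] h N(1) by blast
    then show ?case using IH by simp
  qed auto
  have "sat (M\<lparr>dom := N\<rparr>) e \<phi> \<longleftrightarrow> sat M e \<phi>" if "sentence M \<phi>" "params \<phi> \<subseteq> N" for e \<phi>
  proof -
    have fv: "fv \<phi> = {}" and wf: "wf M \<phi>" using that by (auto simp: sentence_def)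
    have "sat (M\<lparr>dom := N\<rparr>) e \<phi> \<longleftrightarrow> sat (M\<lparr>dom := N\<rparr>) (\<lambda>_. a1) \<phi>" by (rule sat_cong) (simp add: fv)
    also have "\<dots> \<longleftrightarrow> sat M (\<lambda>_. a1) \<phi>" by (rule el[OF wf that(2)]) (use a1 in auto)
    also have "\<dots> \<longleftrightarrow> sat M e \<phi>" by (rule sat_cong) (simp add: fv)
    finally show ?thesis .
  qed
  then show ?thesis using N S by (simp add: is_model_def small_def)
qed

section \<open>Large partial types\<close>

locale weave_model = monster_model T M K
  for T :: "('f, 'r, 'a) fm set" and M :: "('f, 'r, 'a) struc" and K :: "'a set" +
  fixes \<phi> :: "('f, 'r, 'a) fm" and m n k :: nat and \<Lambda> :: "'a set"
  assumes fml_\<phi>: "fml M {} (m + n) \<phi>"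
    and \<Lambda>: "infinite \<Lambda>" "\<Lambda> \<prec> K" "(UNIV :: 'f set) \<lesssim> \<Lambda>" "(UNIV :: 'r set) \<lesssim> \<Lambda>" "(UNIV :: path set) \<lesssim> \<Lambda>"
begin

abbreviation "weave r U R B \<equiv> wv m n \<phi> k right_comb r U R UNIV B"

definition large :: "('f, 'r, 'a) fm set \<Rightarrow> 'a list list set \<Rightarrow> 'a list list set \<Rightarrow> bool" where
  "large r U R \<longleftrightarrow> (\<exists>B. weave r U R B)"

lemma large_mono: "large r U R \<Longrightarrow> r' \<subseteq> r \<Longrightarrow> U' \<subseteq> U \<Longrightarrow> R' \<subseteq> R \<Longrightarrow> large r' U' R'"
  unfolding large_def using wv_mono by blast

definition over :: "'a set \<Rightarrow> ('f, 'r, 'a) fm set \<Rightarrow> 'a list list set \<Rightarrow> 'a list list set \<Rightarrow> bool" where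
  "over E r U R \<longleftrightarrow> E \<subseteq> dom M \<and> (\<forall>\<theta>\<in>r. fml M E n \<theta>) \<and>
     (\<forall>u\<in>U \<union> R. \<forall>b\<in>set u. length b = n \<and> set b \<subseteq> E)"

lemma small_\<Lambda>: "E \<lesssim> \<Lambda> \<Longrightarrow> E \<prec> K"
  using \<Lambda>(2) lesspoll_trans1 by blast

lemma fml_\<phi>_over: "fml M E (m + n) \<phi>"
  using fml_\<phi> fml_mono by blast

lemma over_compactness:
  assumes "over E r U R" "E \<prec> K"
    and "\<And>r0 CC. r0 \<subseteq> r \<Longrightarrow> finite r0 \<Longrightarrow> finite CC \<Longrightarrow> \<exists>B. wv m n \<phi> k right_comb r0 U R CC B"
  shows "large r U R"
  unfolding large_def
  by (rule weave_compactness[of E, OF _ _ fml_\<phi>_over]) (use assms finite_right_comb in \<open>auto simp: over_def\<close>)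

lemma large_compactness:
  assumes "over E r U R" "E \<prec> K" and fin: "\<And>r0. r0 \<subseteq> r \<Longrightarrow> finite r0 \<Longrightarrow> large r0 U R"
  shows "large r U R"
proof (rule over_compactness[OF assms(1,2)])
  fix r0 and CC :: "path set set" assume "r0 \<subseteq> r" "finite r0"
  then obtain B where B: "weave r0 U R B" using fin unfolding large_def by blast
  have "wv m n \<phi> k right_comb r0 U R CC B" by (rule wv_mono[OF B]) auto
  then show "\<exists>B. wv m n \<phi> k right_comb r0 U R CC B" by blast
qed

text \<open>Density above \<open>\<eta>\<close> provides, for each depth, a cone map into
  \<open>X\<close>. Finitely many combs survive such a map if the depth is large, so the weave
  composed with it meets any finite part of the requirements, now including
  \<open>r'\<close>.\<close>

lemma large_of_dense:
  assumes o: "over E (r \<union> r') U R" "E \<prec> K" and B: "weave r U R B"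
    and dense: "\<And>\<tau>. \<exists>\<sigma>\<in>X. extends \<sigma> (\<eta> @ \<tau>)" and X: "\<And>\<sigma> \<theta>. \<sigma> \<in> X \<Longrightarrow> \<theta> \<in> r' \<Longrightarrow> holds M \<theta> (B \<sigma>)"
  shows "large (r \<union> r') U R"
proof (rule over_compactness[OF o])
  fix r0 and CC :: "path set set" assume r0: "r0 \<subseteq> r \<union> r'" "finite r0" and CC: "finite CC"
  have "\<forall>C. \<exists>d. \<forall>d' \<tau>0 g. d \<le> d' \<longrightarrow> cone_map d' \<tau>0 g \<longrightarrow>
    (up_comb C \<longrightarrow> up_comb (g ` C) \<and> card (g ` C) = card C) \<and> (right_comb C \<longrightarrow> right_comb (g ` C))"
  proof
    fix C
    obtain d1 where 1: "\<forall>d' \<tau>0 g. d1 \<le> d' \<longrightarrow> cone_map d' \<tau>0 g \<longrightarrow> up_comb C \<longrightarrow> up_comb (g ` C) \<and> card (g ` C) = card C"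
      using up_comb_cone_map[of C] by (cases "up_comb C") auto
    obtain d2 where 2: "\<forall>d' \<tau>0 g. d2 \<le> d' \<longrightarrow> cone_map d' \<tau>0 g \<longrightarrow> right_comb C \<longrightarrow> right_comb (g ` C)"
      using right_comb_cone_map[of C] by (cases "right_comb C") auto
    show "\<exists>d. \<forall>d' \<tau>0 g. d \<le> d' \<longrightarrow> cone_map d' \<tau>0 g \<longrightarrow>
      (up_comb C \<longrightarrow> up_comb (g ` C) \<and> card (g ` C) = card C) \<and> (right_comb C \<longrightarrow> right_comb (g ` C))"
    proof (intro exI[of _ "max d1 d2"] allI impI)
      fix d' \<tau>0 g assume "max d1 d2 \<le> d'" "cone_map d' \<tau>0 g"
      then show "(up_comb C \<longrightarrow> up_comb (g ` C) \<and> card (g ` C) = card C) \<and> (right_comb C \<longrightarrow> right_comb (g ` C))"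
        using 1[rule_format, of d' \<tau>0 g] 2[rule_format, of d' \<tau>0 g] by simp
    qed
  qed
  then obtain D where D: "\<And>C d' \<tau>0 g. D C \<le> d' \<Longrightarrow> cone_map d' \<tau>0 g \<Longrightarrow>
    (up_comb C \<longrightarrow> up_comb (g ` C) \<and> card (g ` C) = card C) \<and> (right_comb C \<longrightarrow> right_comb (g ` C))" by metis
  define d where "d = (\<Sum>C\<in>CC. D C)"
  have dD: "D C \<le> d" if "C \<in> CC" for C unfolding d_def using that CC by (simp add: member_le_sum)
  \<comment> \<open>Density is used here: some member of \<open>X\<close> continues
    \<open>\<eta>\<close> followed by the first \<open>d\<close> steps of
    \<open>\<sigma>\<close>.\<close>
  define g where "g \<sigma> = (SOME \<rho>. \<rho> \<in> X \<and> extends \<rho> (\<eta> @ map \<sigma> [0..<d]))" for \<sigma> :: path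
  have g: "g \<sigma> \<in> X \<and> extends (g \<sigma>) (\<eta> @ map \<sigma> [0..<d])" for \<sigma>
    using someI_ex[of "\<lambda>\<rho>. \<rho> \<in> X \<and> extends \<rho> (\<eta> @ map \<sigma> [0..<d])"] dense[of "map \<sigma> [0..<d]"]
    unfolding g_def by blast
  then have cg: "cone_map d \<eta> g" by (simp add: cone_map_def)
  have "wv m n \<phi> k right_comb r0 U R CC (\<lambda>\<sigma>. B (g \<sigma>))"
    unfolding wv_def
  proof (intro conjI allI ballI impI)
    fix \<sigma> show "length (B (g \<sigma>)) = n" "set (B (g \<sigma>)) \<subseteq> dom M" using B by (auto simp: wv_def)
    fix \<theta> assume "\<theta> \<in> r0"
    then have "\<theta> \<in> r \<or> \<theta> \<in> r'" using r0 by blast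
    then show "holds M \<theta> (B (g \<sigma>))" using B X g by (auto simp: wv_def)
  next
    fix u C assume u: "u \<in> U" and C: "C \<in> CC" "(C = {} \<or> up_comb C) \<and> length u + card C = k"
    have "(g ` C = {} \<or> up_comb (g ` C)) \<and> length u + card (g ` C) = k"
      using D[OF dD[OF C(1)] cg] C(2) by auto
    then have "\<not> jsat m \<phi> (set u \<union> B ` (g ` C))" using B u unfolding wv_def by blast
    then show "\<not> jsat m \<phi> (set u \<union> (\<lambda>\<sigma>. B (g \<sigma>)) ` C)" by (simp add: image_image)
  next
    fix v C assume v: "v \<in> R" and C: "C \<in> CC" "C = {} \<or> right_comb C"
    have "g ` C = {} \<or> right_comb (g ` C)"
      using D[OF dD[OF C(1)] cg] C(2) by auto
    then have "jsat m \<phi> (set v \<union> B ` (g ` C))" using B v unfolding wv_def by blast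
    then show "jsat m \<phi> (set v \<union> (\<lambda>\<sigma>. B (g \<sigma>)) ` C)" by (simp add: image_image)
  qed
  then show "\<exists>B. wv m n \<phi> k right_comb r0 U R CC B" by blast
qed

lemma extends_case_nat: "extends (case_nat x \<sigma>) [x]"
  by (simp add: extends_def)

lemma cone_map_case_nat: "cone_map d [x] (case_nat x)"
  by (auto simp: cone_map_def extends_def nth_Cons split: nat.split)

text \<open>The elements in the \<open>(1,0)\<close>- and the \<open>(0,1)\<close>-cone of a weave are frozen as the next members of
  an up-comb and of a right-comb; the \<open>(1,1)\<close>-cone is still a weave relative to them.\<close>

lemma weave_freeze:
  assumes B: "weave r U R B"
  shows "weave r (U \<union> {u @ [B (case_nat (True, False) \<sigma>)] | u \<sigma>. u \<in> U})
    (R \<union> {v @ [B (case_nat (False, True) \<sigma>)] | v \<sigma>. v \<in> R}) (\<lambda>\<sigma>. B (case_nat (True, True) \<sigma>))"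
proof -
  let ?g = "case_nat (True, True) :: path \<Rightarrow> path"
  have up: "up_comb (?g ` C) \<and> card (?g ` C) = card C" if "up_comb C" for C
    using up_comb_cone_map[OF that] cone_map_case_nat by blast
  have ri: "right_comb (?g ` C)" if "right_comb C" for C
    using right_comb_cone_map[OF that] cone_map_case_nat by blast
  have Bu: "\<not> jsat m \<phi> (set u \<union> B ` C)" if "u \<in> U" "C = {} \<or> up_comb C" "length u + card C = k" for u C
    using B that unfolding wv_def by blast
  have Br: "jsat m \<phi> (set v \<union> B ` C)" if "v \<in> R" "C = {} \<or> right_comb C" for v C
    using B that unfolding wv_def by blast
  show ?thesis
    unfolding wv_def
  proof (intro conjI allI ballI impI)
    fix \<sigma> show "length (B (?g \<sigma>)) = n" "set (B (?g \<sigma>)) \<subseteq> dom M" using B by (auto simp: wv_def)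
    fix \<theta> assume "\<theta> \<in> r" then show "holds M \<theta> (B (?g \<sigma>))" using B by (simp add: wv_def)
  next
    fix u C assume "u \<in> U \<union> {u @ [B (case_nat (True, False) \<sigma>)] | u \<sigma>. u \<in> U}"
      and C: "(C = {} \<or> up_comb C) \<and> length u + card C = k"
    then consider "u \<in> U" | u' \<sigma> where "u' \<in> U" "u = u' @ [B (case_nat (True, False) \<sigma>)]" by blast
    then show "\<not> jsat m \<phi> (set u \<union> (\<lambda>\<sigma>. B (?g \<sigma>)) ` C)"
    proof cases
      case 1
      then show ?thesis using Bu[of u "?g ` C"] up[of C] C by (auto simp: image_image)
    next
      case 2
      let ?\<sigma> = "case_nat (True, False) \<sigma> :: path"
      have ne: "?\<sigma> \<notin> ?g ` C" by (auto dest: fun_cong[where x = 0])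
      have "up_comb (insert ?\<sigma> (?g ` C)) \<and> length u' + card (insert ?\<sigma> (?g ` C)) = k"
      proof (cases "C = {}")
        case True
        then show ?thesis using C 2 by (simp add: up_comb.single)
      next
        case False
        then have uC: "up_comb (?g ` C)" "card (?g ` C) = card C" using C up by blast+
        have "up_comb (insert ?\<sigma> (?g ` C))"
          by (rule up_comb_insert[where \<tau> = "[]" and i = True, OF uC(1)])
            (auto simp: extends_case_nat)
        then show ?thesis using uC ne C 2 finite_up_comb[OF uC(1)] by simp
      qed
      then have "\<not> jsat m \<phi> (set u' \<union> B ` insert ?\<sigma> (?g ` C))" using Bu[OF 2(1)] by blast
      then show ?thesis using 2(2) by (simp add: image_image)
    qed
  next
    fix v C assume "v \<in> R \<union> {v @ [B (case_nat (False, True) \<sigma>)] | v \<sigma>. v \<in> R}"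
      and C: "C = {} \<or> right_comb C"
    then consider "v \<in> R" | v' \<sigma> where "v' \<in> R" "v = v' @ [B (case_nat (False, True) \<sigma>)]" by blast
    then show "jsat m \<phi> (set v \<union> (\<lambda>\<sigma>. B (?g \<sigma>)) ` C)"
    proof cases
      case 1
      then show ?thesis using Br[of v "?g ` C"] ri[of C] C by (auto simp: image_image)
    next
      case 2
      let ?\<sigma> = "case_nat (False, True) \<sigma> :: path"
      have "right_comb (insert ?\<sigma> (?g ` C))"
      proof (cases "C = {}")
        case True
        then show ?thesis by (simp add: right_comb.single)
      next
        case False
        then have uC: "right_comb (?g ` C)" using C ri by blast
        show ?thesis
          by (rule right_comb_insert[where \<tau> = "[]" and j = True, OF uC])
            (auto simp: extends_case_nat)
      qed
      then have "jsat m \<phi> (set v' \<union> B ` insert ?\<sigma> (?g ` C))" using Br[OF 2(1)] by blast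
      then show ?thesis using 2(2) by (simp add: image_image)
    qed
  qed
qed

section \<open>One stage of the chain\<close>

definition state :: "'a set \<Rightarrow> ('f, 'r, 'a) fm set \<Rightarrow> 'a list list set \<Rightarrow> 'a list list set \<Rightarrow> bool" where
  "state E r U R \<longleftrightarrow> over E r U R \<and> E \<lesssim> \<Lambda> \<and> large r U R"

text \<open>Witnesses are chosen simultaneously for as many formulas \<open>\<theta>(x, y)\<close> as possible. Largeness only
  shrinks along the construction, so a formula that is left out can never get a witness later.\<close>

lemma witnesses:
  assumes s: "state E0 r U R" and E: "E \<subseteq> E0"
  obtains E' r' where "state E' r' U R" "E0 \<subseteq> E'" "r \<subseteq> r'"
    "\<And>\<theta> c. fml M E (n + length c) \<theta> \<Longrightarrow> set c \<subseteq> dom M \<Longrightarrow> large (insert (inst n \<theta> c) r') U R \<Longrightarrow>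
       \<exists>c'. length c' = length c \<and> set c' \<subseteq> E' \<and> inst n \<theta> c' \<in> r'"
proof -
  \<comment> \<open>A partial choice of witnesses is a relation between requests and tuples. A
    request also records the length \<open>l\<close>, which the formula alone does not
    determine.\<close>
  define I where "I = (\<lambda>((\<theta>, l :: nat), c). inst n \<theta> c :: ('f, 'r, 'a) fm)"
  define ok where "ok G \<longleftrightarrow> single_valued G \<and>
    (\<forall>((\<theta>, l), c)\<in>G. fml M E (n + l) \<theta> \<and> length c = l \<and> set c \<subseteq> dom M)" for G :: "((('f, 'r, 'a) fm \<times> nat) \<times> 'a list) set"
  define EG where "EG G = E0 \<union> (\<Union>x\<in>G. set (snd x))" for G :: "((('f, 'r, 'a) fm \<times> nat) \<times> 'a list) set"
  have E0: "over E0 r U R" "E0 \<lesssim> \<Lambda>" "large r U R" using s by (auto simp: state_def)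
  have okD: "fml M E (n + l) \<theta>" "length c = l" "set c \<subseteq> dom M" if "ok G" "((\<theta>, l), c) \<in> G" for G \<theta> l c
    using that unfolding ok_def by auto
  have "E \<lesssim> \<Lambda>" using E E0(2) by (meson lepoll_trans subset_imp_lepoll)
  note fE = formulas_lepoll[OF \<Lambda>(1) this \<Lambda>(3,4)]
  \<comment> \<open>A choice assigns at most one finite tuple to each request, and there are at most
    \<open>\<Lambda>\<close> many requests.\<close>
  have EGL: "EG G \<lesssim> \<Lambda>" if G: "ok G" for G
  proof -
    have "inj_on fst G"
      using G unfolding ok_def by (auto simp: inj_on_def dest: single_valuedD)
    moreover have "fst ` G \<subseteq> {\<theta>. params \<theta> \<subseteq> E} \<times> UNIV"
    proof
      fix x assume "x \<in> fst ` G"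
      then obtain \<theta> l c where "x = (\<theta>, l)" "((\<theta>, l), c) \<in> G" by auto
      then show "x \<in> {\<theta>. params \<theta> \<subseteq> E} \<times> UNIV" using okD(1)[OF G] by (simp add: fml_def)
    qed
    ultimately have "G \<lesssim> {\<theta> :: ('f, 'r, 'a) fm. params \<theta> \<subseteq> E} \<times> (UNIV :: nat set)"
      unfolding lepoll_def by blast
    also have "\<dots> \<lesssim> \<Lambda>"
      by (rule Times_lepoll_infinite[OF \<Lambda>(1) fE]) (use \<Lambda>(1) in \<open>simp add: infinite_le_lepoll\<close>)
    finally have "G \<lesssim> \<Lambda>" .
    then have "(\<Union>x\<in>G. set (snd x)) \<lesssim> \<Lambda>"
      by (rule UN_lepoll_infinite[OF \<Lambda>(1)]) (use \<Lambda>(1) in \<open>simp add: finite_lepoll_infinite\<close>)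
    then show ?thesis unfolding EG_def by (rule Un_lepoll_infinite[OF \<Lambda>(1) E0(2)])
  qed
  have EGo: "over (EG G) (r \<union> I ` G) U R" if G: "ok G" for G
    unfolding over_def
  proof (intro conjI ballI)
    show "EG G \<subseteq> dom M" using E0(1) okD(3)[OF G] by (force simp: EG_def over_def)
    fix \<theta> assume "\<theta> \<in> r \<union> I ` G"
    then consider "\<theta> \<in> r" | \<psi> l c where "((\<psi>, l), c) \<in> G" "\<theta> = inst n \<psi> c" by (auto simp: I_def)
    then show "fml M (EG G) n \<theta>"
    proof cases
      case 1
      then show ?thesis using E0(1) by (auto simp: over_def EG_def intro: fml_mono)
    next
      case 2
      have "fml M (E \<union> set c) n \<theta>" unfolding 2(2) by (rule fml_inst) (use okD[OF G 2(1)] in simp)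
      moreover have "E \<union> set c \<subseteq> EG G" using E 2(1) by (force simp: EG_def)
      ultimately show ?thesis using fml_mono by blast
    qed
  next
    fix u b assume "u \<in> U \<union> R" "b \<in> set u"
    then have "length b = n \<and> set b \<subseteq> E0" using E0(1) by (simp add: over_def)
    then show "length b = n" "set b \<subseteq> EG G" by (auto simp: EG_def)
  qed
  let ?A = "{G. ok G \<and> large (r \<union> I ` G) U R}"
  have "\<exists>G\<in>?A. \<forall>X\<in>?A. G \<subseteq> X \<longrightarrow> X = G"
  proof (rule subset_Zorn_nonempty)
    have "{} \<in> ?A" using E0(3) by (simp add: ok_def single_valued_def)
    then show "?A \<noteq> {}" by blast
  next
    fix C assume C: "C \<noteq> {}" "subset.chain ?A C"
    have mem: "ok G" "large (r \<union> I ` G) U R" if "G \<in> C" for G using C that by (auto simp: subset_chain_def)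
    have "single_valued (\<Union>C)"
    proof (rule single_valuedI)
      fix x y z assume "(x, y) \<in> \<Union>C" "(x, z) \<in> \<Union>C"
      then obtain G G' where G: "G \<in> C" "(x, y) \<in> G" "G' \<in> C" "(x, z) \<in> G'" by blast
      then have "G \<subseteq> G' \<or> G' \<subseteq> G" using C by (auto simp: subset_chain_def)
      moreover have "single_valued G" "single_valued G'"
        using mem(1)[OF G(1)] mem(1)[OF G(3)] unfolding ok_def by simp_all
      ultimately show "y = z" using G(2,4) by (auto dest: single_valuedD)
    qed
    moreover have "fml M E (n + l) \<theta> \<and> length c = l \<and> set c \<subseteq> dom M" if "((\<theta>, l), c) \<in> \<Union>C" for \<theta> l c
      using that okD[OF mem(1)] by blast
    ultimately have ok: "ok (\<Union>C)" unfolding ok_def by auto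
    have "large (r \<union> I ` \<Union>C) U R"
    proof (rule large_compactness[OF EGo[OF ok] small_\<Lambda>[OF EGL[OF ok]]])
      fix r0 assume r0: "r0 \<subseteq> r \<union> I ` \<Union>C" "finite r0"
      then have "r0 - r \<subseteq> I ` \<Union>C" "finite (r0 - r)" by auto
      then obtain G0 where G0: "G0 \<subseteq> \<Union>C" "finite G0" "r0 - r = I ` G0"
        using finite_subset_image[of "r0 - r" I "\<Union>C"] by blast
      obtain G where G: "G \<in> C" "G0 \<subseteq> G" using finite_subset_Union_chain[OF G0(2,1) C(1,2)] by blast
      have "r0 \<subseteq> r \<union> I ` G" using G0(3) G(2) by blast
      then show "large r0 U R" using large_mono[OF mem(2)[OF G(1)]] by blast
    qed
    then show "\<Union>C \<in> ?A" using ok by simp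
  qed
  then obtain G where GA: "G \<in> ?A" and GM: "\<forall>X\<in>?A. G \<subseteq> X \<longrightarrow> X = G" by (elim bexE)
  have ok: "ok G" and lG: "large (r \<union> I ` G) U R" using GA by simp_all
  show ?thesis
  proof (rule that[of "EG G" "r \<union> I ` G"])
    show "state (EG G) (r \<union> I ` G) U R" using EGo[OF ok] EGL[OF ok] lG by (simp add: state_def)
    show "E0 \<subseteq> EG G" by (simp add: EG_def)
    fix \<theta> c assume f: "fml M E (n + length c) \<theta>" and c: "set c \<subseteq> dom M"
      and l: "large (insert (inst n \<theta> c) (r \<union> I ` G)) U R"
    \<comment> \<open>If the request were unanswered, \<open>c\<close> itself could serve as its
      answer and the choice would not be maximal.\<close>
    have "\<exists>c'. ((\<theta>, length c), c') \<in> G"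
    proof (rule ccontr)
      assume no: "\<not> (\<exists>c'. ((\<theta>, length c), c') \<in> G)"
      let ?G = "insert ((\<theta>, length c), c) G"
      have "single_valued ?G" using ok no unfolding ok_def single_valued_def by blast
      then have "ok ?G" using ok f c unfolding ok_def by auto
      moreover have "r \<union> I ` ?G = insert (inst n \<theta> c) (r \<union> I ` G)" by (simp add: I_def)
      ultimately have "?G \<in> ?A" using l by simp
      from bspec[OF GM this] have "?G = G" by blast
      then show False using no by blast
    qed
    then obtain c' where c': "((\<theta>, length c), c') \<in> G" by blast
    have "inst n \<theta> c' \<in> I ` G" using c' by (force simp: I_def image_iff)
    moreover have "set c' \<subseteq> EG G" using c' by (force simp: EG_def)
    ultimately show "\<exists>c'. length c' = length c \<and> set c' \<subseteq> EG G \<and> inst n \<theta> c' \<in> r \<union> I ` G"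
      using okD(2)[OF ok c'] by blast
  qed simp
qed

text \<open>The last clause treats formulas over the old set \<open>E\<close> only. Those with
  parameters from \<open>E'\<close> are served at the next stage, and the union of the chain serves
  all.\<close>

definition step where
  "step E r U R E' r' U' R' B \<longleftrightarrow> E \<subseteq> E' \<and> r \<subseteq> r' \<and> U \<subseteq> U' \<and> R \<subseteq> R' \<and> weave r U R B \<and>
     (\<forall>\<sigma>. set (B \<sigma>) \<subseteq> E') \<and>
     (\<forall>u\<in>U. \<forall>\<sigma>. u @ [B (case_nat (True, False) \<sigma>)] \<in> U') \<and>
     (\<forall>v\<in>R. \<forall>\<sigma>. v @ [B (case_nat (False, True) \<sigma>)] \<in> R') \<and>
     (\<forall>\<theta> c. fml M E (n + length c) \<theta> \<and> set c \<subseteq> dom M \<and> large (insert (inst n \<theta> c) r') U' R' \<longrightarrow>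
       (\<exists>c'. length c' = length c \<and> set c' \<subseteq> E' \<and> inst n \<theta> c' \<in> r'))"

text \<open>Freezing comes before the choice of witnesses, so that largeness in the last clause is
  measured against the enlarged families of frozen lists.\<close>

lemma step_exists:
  assumes s: "state E r U R"
  shows "\<exists>E' r' U' R' B. state E' r' U' R' \<and> step E r U R E' r' U' R' B"
proof -
  obtain B where B: "weave r U R B" using s unfolding state_def large_def by blast
  let ?U = "U \<union> {u @ [B (case_nat (True, False) \<sigma>)] | u \<sigma>. u \<in> U}"
  let ?R = "R \<union> {v @ [B (case_nat (False, True) \<sigma>)] | v \<sigma>. v \<in> R}"
  let ?E = "E \<union> (\<Union>\<sigma>. set (B \<sigma>))"
  have Bn: "length (B \<sigma>) = n" "set (B \<sigma>) \<subseteq> dom M" for \<sigma> using B by (auto simp: wv_def)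
  have so: "over E r U R" "E \<lesssim> \<Lambda>" using s by (auto simp: state_def)
  have "(\<Union>\<sigma>. set (B \<sigma>)) \<lesssim> \<Lambda>"
    by (rule UN_lepoll_infinite[OF \<Lambda>(1) \<Lambda>(5)]) (use \<Lambda>(1) in \<open>simp add: finite_lepoll_infinite\<close>)
  then have "?E \<lesssim> \<Lambda>" by (rule Un_lepoll_infinite[OF \<Lambda>(1) so(2)])
  moreover have "over ?E r ?U ?R"
    unfolding over_def
  proof (intro conjI ballI)
    show "?E \<subseteq> dom M" using so(1) Bn by (auto simp: over_def)
    show "fml M ?E n \<theta>" if "\<theta> \<in> r" for \<theta> using so(1) that by (auto simp: over_def intro: fml_mono)
    fix u b assume u: "u \<in> ?U \<union> ?R" "b \<in> set u"
    have *: "length b = n \<and> set b \<subseteq> E" if "w \<in> U \<union> R" "b \<in> set w" for w using so(1) that by (simp add: over_def)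
    have "(\<exists>w\<in>U \<union> R. b \<in> set w) \<or> (\<exists>\<sigma>. b = B \<sigma>)" using u by fastforce
    then show "length b = n" "set b \<subseteq> ?E" using * Bn by blast+
  qed
  moreover have "large r ?U ?R" unfolding large_def using weave_freeze[OF B] by blast
  ultimately have "state ?E r ?U ?R" by (simp add: state_def)
  then obtain E' r' where E': "state E' r' ?U ?R" "?E \<subseteq> E'" "r \<subseteq> r'"
    "\<And>\<theta> c. fml M E (n + length c) \<theta> \<Longrightarrow> set c \<subseteq> dom M \<Longrightarrow> large (insert (inst n \<theta> c) r') ?U ?R \<Longrightarrow>
       \<exists>c'. length c' = length c \<and> set c' \<subseteq> E' \<and> inst n \<theta> c' \<in> r'"
    by (rule witnesses[where E = E]) auto
  have BE': "set (B \<sigma>) \<subseteq> E'" for \<sigma> using E'(2) by blast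
  have "step E r U R E' r' ?U ?R B"
    unfolding step_def
  proof (intro conjI allI ballI impI)
    fix \<theta> c assume "fml M E (n + length c) \<theta> \<and> set c \<subseteq> dom M \<and> large (insert (inst n \<theta> c) r') ?U ?R"
    then show "\<exists>c'. length c' = length c \<and> set c' \<subseteq> E' \<and> inst n \<theta> c' \<in> r'" using E'(4) by simp
  qed (use E'(2,3) B BE' in auto)
  then show ?thesis using E'(1) by blast
qed

end

section \<open>The union of the chain and its two limit types\<close>

locale weave_chain = weave_model T M K \<phi> m n k \<Lambda>
  for T :: "('f, 'r, 'a) fm set" and M :: "('f, 'r, 'a) struc" and K :: "'a set"
    and \<phi> :: "('f, 'r, 'a) fm" and m n k :: nat and \<Lambda> :: "'a set" +
  fixes E :: "nat \<Rightarrow> 'a set" and r :: "nat \<Rightarrow> ('f, 'r, 'a) fm set"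
    and U R :: "nat \<Rightarrow> 'a list list set" and B :: "nat \<Rightarrow> path \<Rightarrow> 'a list"
  assumes st: "state (E i) (r i) (U i) (R i)"
    and stp: "step (E i) (r i) (U i) (R i) (E (Suc i)) (r (Suc i)) (U (Suc i)) (R (Suc i)) (B i)"
    and start: "[] \<in> U 0" "[] \<in> R 0"
begin

lemma mono:
  assumes "i \<le> j" shows "E i \<subseteq> E j" "r i \<subseteq> r j" "U i \<subseteq> U j" "R i \<subseteq> R j"
proof -
  have s: "E i \<subseteq> E (Suc i)" "r i \<subseteq> r (Suc i)" "U i \<subseteq> U (Suc i)" "R i \<subseteq> R (Suc i)" for i
    using stp[of i] by (simp_all add: step_def)
  show "E i \<subseteq> E j" "r i \<subseteq> r j" "U i \<subseteq> U j" "R i \<subseteq> R j"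
    by (rule lift_Suc_mono_le[OF _ assms], rule s)+
qed

lemma weave_B: "weave (r i) (U i) (R i) (B i)"
  using stp[of i] by (simp add: step_def)

definition N :: "'a set" where "N = (\<Union>i. E i)"

definition rr :: "('f, 'r, 'a) fm set" where "rr = (\<Union>i. r i)"

lemma N_dom: "N \<subseteq> dom M"
  using st unfolding N_def state_def over_def by blast

text \<open>The cardinal is a strong limit but not assumed regular, so countable unions of small
  sets need not be small. One small bound \<open>\<Lambda>\<close> for all stages prevents
  this.\<close>

lemma N_small: "N \<prec> K"
proof -
  have "N \<lesssim> \<Lambda>"
    unfolding N_def
    by (rule UN_lepoll_infinite[OF \<Lambda>(1)]) (use \<Lambda>(1) st in \<open>auto simp: infinite_le_lepoll state_def\<close>)
  then show ?thesis by (rule small_\<Lambda>)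
qed

lemma B_N: "length (B i \<sigma>) = n" "set (B i \<sigma>) \<subseteq> N"
proof -
  show "length (B i \<sigma>) = n" using weave_B[of i] by (simp add: wv_def)
  have "set (B i \<sigma>) \<subseteq> E (Suc i)" using stp[of i] by (simp add: step_def)
  then show "set (B i \<sigma>) \<subseteq> N" unfolding N_def by blast
qed

lemma finite_subset_N:
  assumes "finite F" "F \<subseteq> N" obtains i where "F \<subseteq> E i"
proof -
  have "\<exists>i. F \<subseteq> E i" using assms
  proof (induction F)
    case (insert x F)
    then obtain i j where "F \<subseteq> E i" "x \<in> E j" unfolding N_def by auto
    then have "insert x F \<subseteq> E (max i j)" using mono(1)[of i "max i j"] mono(1)[of j "max i j"] by auto
    then show ?case by blast
  qed simp
  then show ?thesis using that by blast
qed

text \<open>The parameters of \<open>\<theta>\<close> appear at a finite stage, and largeness at the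
  following stage triggers the witness clause there.\<close>

lemma heir_witness:
  assumes f: "fml M N (n + length c) \<theta>" and c: "set c \<subseteq> dom M"
    and l: "\<And>i. large (insert (inst n \<theta> c) (r i)) (U i) (R i)"
  obtains c' where "length c' = length c" "set c' \<subseteq> N" "inst n \<theta> c' \<in> rr"
proof -
  obtain i where "params \<theta> \<subseteq> E i" using finite_subset_N[OF finite_params] f by (auto simp: fml_def)
  then have "fml M (E i) (n + length c) \<theta>" using f by (simp add: fml_def)
  then have "\<exists>c'. length c' = length c \<and> set c' \<subseteq> E (Suc i) \<and> inst n \<theta> c' \<in> r (Suc i)"
    using stp[of i] c l[of "Suc i"] unfolding step_def by blast
  then show ?thesis using that unfolding N_def rr_def by blast
qed

lemma rr_holds: "\<theta> \<in> rr \<Longrightarrow> \<exists>i0. \<forall>i\<ge>i0. \<forall>\<sigma>. holds M \<theta> (B i \<sigma>)"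
proof -
  assume "\<theta> \<in> rr"
  then obtain i0 where "\<theta> \<in> r i0" by (auto simp: rr_def)
  then have "\<theta> \<in> r i" if "i0 \<le> i" for i using mono(2)[OF that] by blast
  then show ?thesis using weave_B unfolding wv_def by blast
qed

lemma fml_rr: "\<theta> \<in> rr \<Longrightarrow> fml M N n \<theta>"
  using st unfolding rr_def state_def over_def N_def by (blast intro: fml_mono)

lemma N_model: "is_model M K N"
proof (rule elementary_submodel[OF N_dom N_small])
  fix \<theta> a assume f: "fml M N 1 \<theta>" and a: "a \<in> dom M" and h: "holds M \<theta> [a]"
  have f': "fml M N (n + 1) (shift n \<theta>)" by (rule fml_shift[OF f]) simp
  have hi: "holds M (inst n (shift n \<theta>) [x]) xs \<longleftrightarrow> holds M \<theta> [x]" if "length xs = n" for x xs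
    using holds_inst[of M N n "[x]" "shift n \<theta>" xs] holds_shift[OF f, of n "xs @ [x]"] f' that by simp
  have "weave (insert (inst n (shift n \<theta>) [a]) (r i)) (U i) (R i) (B i)" for i
    using weave_B[of i] hi B_N(1) h unfolding wv_def by simp
  then have "large (insert (inst n (shift n \<theta>) [a]) (r i)) (U i) (R i)" for i unfolding large_def by blast
  then obtain c' where c': "length c' = length [a]" "set c' \<subseteq> N" "inst n (shift n \<theta>) c' \<in> rr"
    using heir_witness[of "[a]" "shift n \<theta>"] f' a by auto
  then obtain a' where a': "c' = [a']" by (cases c') auto
  obtain i where "\<forall>\<sigma>. holds M (inst n (shift n \<theta>) c') (B i \<sigma>)" using rr_holds[OF c'(3)] by blast
  then have "holds M \<theta> [a']" using hi B_N(1) a' by blast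
  then show "\<exists>a'\<in>N. holds M \<theta> [a']" using c'(2) a' by auto
qed

context
  fixes Uf :: "(nat \<times> path) set set"
  assumes Uf: "ultra Uf" "Uf \<inter> sparse_ideal = {}"
begin

definition lp :: "bool \<times> bool \<Rightarrow> ('f, 'r, 'a) fm set" where
  "lp x = lim_tp Uf (\<lambda>(i, \<sigma>). B i (case_nat x \<sigma>)) n"

lemma tail_Uf: "{(i, \<sigma>). i0 \<le> i} \<in> Uf"
proof (rule ccontr)
  assume "{(i, \<sigma>). i0 \<le> i} \<notin> Uf"
  then have "- {(i, \<sigma>). i0 \<le> i} \<in> Uf" by (rule ultra_Compl[OF Uf(1)])
  moreover have "nowhere_dense {}" by (simp add: nowhere_dense_def)
  then have "- {(i, \<sigma>). i0 \<le> i} \<in> sparse_ideal"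
    unfolding sparse_ideal_def by (intro CollectI exI[of _ i0]) simp
  ultimately show False using Uf(2) by blast
qed

lemma coheir_lp: "coheir M N n (lp x)"
  unfolding lp_def
proof (rule coheir_lim_tp[OF Uf(1) N_dom])
  have "{y. length ((\<lambda>(i, \<sigma>). B i (case_nat x \<sigma>)) y) = n \<and> set ((\<lambda>(i, \<sigma>). B i (case_nat x \<sigma>)) y) \<subseteq> N} = UNIV"
    by (auto simp: B_N(1) intro: subsetD[OF B_N(2)])
  moreover have "UNIV \<in> Uf" using ultra_mono[OF Uf(1) tail_Uf[of 0]] by blast
  ultimately show "{y. length ((\<lambda>(i, \<sigma>). B i (case_nat x \<sigma>)) y) = n \<and> set ((\<lambda>(i, \<sigma>). B i (case_nat x \<sigma>)) y) \<subseteq> N} \<in> Uf"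
    by simp
qed

lemma gtype_lp: "gtype M n (lp x)"
  using coheir_lp by (simp add: coheir_def)

lemma lp_ex:
  assumes "\<theta> \<in> lp x" obtains i \<sigma> where "i0 \<le> i" "holds M \<theta> (B i (case_nat x \<sigma>))"
proof -
  have "{y. holds M \<theta> ((\<lambda>(i, \<sigma>). B i (case_nat x \<sigma>)) y)} \<in> Uf" using assms by (simp add: lp_def lim_tp_def)
  then obtain y where "y \<in> {y. holds M \<theta> ((\<lambda>(i, \<sigma>). B i (case_nat x \<sigma>)) y)} \<inter> {(i, \<sigma>). i0 \<le> i}"
    using ultra_ex[OF Uf(1) ultra_Int[OF Uf(1) _ tail_Uf]] by blast
  then show ?thesis using that by auto
qed

lemma rr_lp: "rr \<subseteq> lp x"
proof
  fix \<theta> assume \<theta>: "\<theta> \<in> rr"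
  obtain i0 where i0: "\<forall>i\<ge>i0. \<forall>\<sigma>. holds M \<theta> (B i \<sigma>)" using rr_holds[OF \<theta>] by blast
  have "{y. holds M \<theta> ((\<lambda>(i, \<sigma>). B i (case_nat x \<sigma>)) y)} \<in> Uf"
    by (rule ultra_mono[OF Uf(1) tail_Uf[of i0]]) (use i0 in auto)
  moreover have "fml M (dom M) n \<theta>" using fml_rr[OF \<theta>] N_dom fml_mono by blast
  ultimately show "\<theta> \<in> lp x" by (simp add: lp_def lim_tp_def)
qed

text \<open>The ultrafilter avoids sparse sets, so at some stage \<open>j\<close> past
  \<open>i\<close> the formula holds on a somewhere dense part of the \<open>x\<close>-cone, and the
  weave of that stage can be thinned to it. Largeness at \<open>j\<close> implies largeness at
  \<open>i\<close>.\<close>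

lemma lp_large:
  assumes \<theta>: "\<theta> \<in> lp x" shows "large (insert \<theta> (r i)) (U i) (R i)"
proof -
  let ?Z = "{y. holds M \<theta> ((\<lambda>(i, \<sigma>). B i (case_nat x \<sigma>)) y)}"
  have "?Z \<in> Uf" using \<theta> by (simp add: lp_def lim_tp_def)
  then have "?Z \<notin> sparse_ideal" using Uf(2) by blast
  then obtain j where j: "i \<le> j" "\<not> nowhere_dense {\<sigma>. (j, \<sigma>) \<in> ?Z}" unfolding sparse_ideal_def by blast
  then obtain \<tau>0 where \<tau>0: "\<And>\<tau>. \<exists>\<sigma>. holds M \<theta> (B j (case_nat x \<sigma>)) \<and> extends \<sigma> (\<tau>0 @ \<tau>)"
    unfolding nowhere_dense_def by auto
  let ?X = "{case_nat x \<sigma> | \<sigma>. holds M \<theta> (B j (case_nat x \<sigma>))}"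
  have f: "fml M (dom M) n \<theta>" using gtypeD[OF gtype_lp \<theta>] .
  have sj: "over (E j) (r j) (U j) (R j)" "E j \<lesssim> \<Lambda>" using st[of j] by (auto simp: state_def)
  have "large (r j \<union> {\<theta>}) (U j) (R j)"
  proof (rule large_of_dense[where E = "E j \<union> params \<theta>" and X = ?X and \<eta> = "x # \<tau>0"])
    show "over (E j \<union> params \<theta>) (r j \<union> {\<theta>}) (U j) (R j)"
      using sj(1) f unfolding over_def by (auto simp: fml_def) blast+
    show "E j \<union> params \<theta> \<prec> K" using small_Un[OF small_\<Lambda>[OF sj(2)] small_finite[OF finite_params]] .
    show "weave (r j) (U j) (R j) (B j)" by (rule weave_B)
    fix \<tau>
    obtain \<sigma> where \<sigma>: "holds M \<theta> (B j (case_nat x \<sigma>))" "extends \<sigma> (\<tau>0 @ \<tau>)" using \<tau>0 by blast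
    have "extends (case_nat x \<sigma>) ((x # \<tau>0) @ \<tau>)"
      using \<sigma>(2) by (auto simp: extends_def nth_Cons split: nat.split)
    then show "\<exists>\<sigma>\<in>?X. extends \<sigma> ((x # \<tau>0) @ \<tau>)" using \<sigma>(1) by blast
  qed auto
  moreover have "insert \<theta> (r i) \<subseteq> r j \<union> {\<theta>}" using mono(2)[OF j(1)] by blast
  ultimately show ?thesis using mono(3,4)[OF j(1)] by (rule large_mono)
qed

text \<open>A formula \<open>\<theta>(b, y)\<close> true of \<open>c\<close> puts
  \<open>\<theta>(x, c)\<close> into the limit type, so it is large at all stages. Its witness
  \<open>c'\<close> in \<open>N\<close> gives a formula of \<open>rr\<close>, which \<open>b\<close>
  satisfies, and hence \<open>\<theta>(b, c')\<close>.\<close>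

lemma heir_coheir_lp: "heir_coheir M N n (lp x)"
  unfolding heir_coheir_def
proof (intro conjI allI impI ballI coheir_lp)
  fix b c \<psi> assume bc: "set c \<subseteq> dom M \<and> realizes M n b (restr (lp x) (N \<union> set c))" and \<psi>: "\<psi> \<in> tp M (N \<union> set b) c"
  have b: "length b = n" using bc by (simp add: realizes_def)
  have f\<psi>: "fml M (N \<union> set b) (length c) \<psi>" "holds M \<psi> c" using \<psi> by (auto simp: tp_def)
  obtain \<theta> where \<theta>: "fml M N (n + length c) \<theta>" "\<And>c'. length c' = length c \<Longrightarrow> holds M \<theta> (b @ c') \<longleftrightarrow> holds M \<psi> c'"
    using abstract_parameters[OF f\<psi>(1)] b by metis
  have "holds M (inst n \<theta> c) b" using holds_inst[OF \<theta>(1) b] \<theta>(2) f\<psi>(2) by simp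
  then have "inst n \<theta> c \<in> lp x"
    using gtype_mem[OF gtype_lp _ _ fml_inst[OF \<theta>(1)]] bc N_dom by blast
  then obtain c' where c': "length c' = length c" "set c' \<subseteq> N" "inst n \<theta> c' \<in> rr"
    using heir_witness[OF \<theta>(1) _ lp_large[of _ x]] bc by blast
  have "params (inst n \<theta> c') \<subseteq> N" using fml_rr[OF c'(3)] by (simp add: fml_def)
  then have "inst n \<theta> c' \<in> restr (lp x) (N \<union> set c)" using rr_lp[of x] c'(3) by (auto simp: restr_def)
  then have "holds M (inst n \<theta> c') b" using bc by (simp add: realizes_def)
  then have "holds M \<theta> (b @ c')" using holds_inst[of M N n c' \<theta> b] \<theta>(1) b c'(1) by simp
  then show "\<exists>xs. length xs = length c \<and> set xs \<subseteq> N \<and> holds M \<psi> xs" using \<theta>(2) c' by blast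
qed

text \<open>A request with the empty tuple has only one possible answer. So a formula over
  \<open>N\<close> in one limit is, up to equivalence, already in \<open>rr\<close>, which is
  contained in both limits.\<close>

lemma lp_agree: "realizes M n b (restr (lp x) N) \<Longrightarrow> tp M N b \<subseteq> lp y"
proof
  fix \<theta> assume b: "realizes M n b (restr (lp x) N)" and \<theta>: "\<theta> \<in> tp M N b"
  have f: "fml M N n \<theta>" using \<theta> b by (simp add: tp_def realizes_def)
  have fd: "fml M (dom M) n \<theta>" using f N_dom fml_mono by blast
  have eq: "holds M (inst n \<theta> []) xs \<longleftrightarrow> holds M \<theta> xs" if "length xs = n" for xs
    using holds_inst[of M N n "[]" \<theta> xs] f that by simp
  have fi: "fml M (dom M) n (inst n \<theta> [])" using fml_inst[of M "dom M" n "[]" \<theta>] fd by simp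
  have "\<theta> \<in> lp x" using gtype_mem[OF gtype_lp N_dom b f] \<theta> by (simp add: tp_def)
  then have "inst n \<theta> [] \<in> lp x"
    using gtype_conseq[OF gtype_lp, of "{\<theta>}" x "inst n \<theta> []"] fi eq by auto
  then obtain c' where "length c' = length ([] :: 'a list)" "inst n \<theta> c' \<in> rr"
    using heir_witness[of "[]" \<theta>, OF _ _ lp_large[of _ x]] f by auto
  then have "inst n \<theta> [] \<in> lp y" using rr_lp[of y] by auto
  then show "\<theta> \<in> lp y" using gtype_conseq[OF gtype_lp, of "{inst n \<theta> []}" y \<theta>] fd eq by auto
qed

text \<open>Truth of a formula on a Morley list is reflected in a frozen list. The most recent entry
  is replaced first, by a frozen point of some stage, and the earlier entries follow at later
  stages. This reversal matches combs, whose outermost point is frozen first.\<close>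

lemma mlist_lp:
  assumes ctx: "\<And>i u \<sigma>. u \<in> C i \<Longrightarrow> u @ [B i (case_nat x \<sigma>)] \<in> C (Suc i)" "\<And>i j. i \<le> j \<Longrightarrow> C i \<subseteq> C j"
  shows "mlist N n (lp x) L \<Longrightarrow> fml M N (length L * n) \<theta> \<Longrightarrow> holds M \<theta> (concat L) \<Longrightarrow> u \<in> C i0 \<Longrightarrow>
    \<exists>L' i1. length L' = length L \<and> (\<forall>b\<in>set L'. length b = n \<and> set b \<subseteq> N) \<and> u @ L' \<in> C i1 \<and> holds M \<theta> (concat L')"
proof (induction L arbitrary: \<theta> u i0)
  case Nil
  then show ?case by (intro exI[of _ "[]"] exI[of _ i0]) simp
next
  case (Cons d L)
  have d: "realizes M n d (restr (lp x) (N \<union> set (concat L)))" "mlist N n (lp x) L" using Cons.prems by auto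
  have Ld: "set (concat L) \<subseteq> dom M" "length (concat L) = length L * n"
    using mlist_block[OF d(2)] length_concat_blocks[of L n] by auto
  have f: "fml M N (n + length (concat L)) \<theta>" using Cons.prems(2) Ld(2) by simp
  have "holds M (inst n \<theta> (concat L)) d" using holds_inst[OF f, of d] d(1) Cons.prems(3) by (simp add: realizes_def)
  then have "inst n \<theta> (concat L) \<in> lp x"
    using gtype_mem[OF gtype_lp _ d(1) fml_inst[OF f]] N_dom Ld by blast
  then obtain i \<sigma> where i: "i0 \<le> i" "holds M (inst n \<theta> (concat L)) (B i (case_nat x \<sigma>))" by (rule lp_ex)
  let ?b = "B i (case_nat x \<sigma>)"
  have h: "holds M \<theta> (?b @ concat L)" using holds_inst[OF f, of ?b] i(2) B_N(1) by simp
  \<comment> \<open>The chosen point lies in \<open>N\<close>, so it becomes a parameter and the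
    induction continues with the remaining variables.\<close>
  obtain \<psi> where \<psi>: "fml M N (length L * n) \<psi>" "\<And>c. length c = length L * n \<Longrightarrow> holds M \<psi> c \<longleftrightarrow> holds M \<theta> (?b @ c)"
    using inst_front[of N ?b "length L * n" \<theta>] f Ld(2) B_N by metis
  have "u @ [?b] \<in> C (Suc i)" using ctx(1) ctx(2)[OF i(1)] Cons.prems(4) by blast
  from Cons.IH[OF d(2) \<psi>(1) _ this] obtain L' i1 where L': "length L' = length L"
    "\<forall>b\<in>set L'. length b = n \<and> set b \<subseteq> N" "(u @ [?b]) @ L' \<in> C i1" "holds M \<psi> (concat L')"
    using \<psi>(2)[OF Ld(2)] h by auto
  have "length (concat L') = length L * n" using length_concat_blocks[of L' n] L'(1,2) by auto
  then have "holds M \<theta> (concat (?b # L'))" using \<psi>(2) L'(4) by simp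
  then show ?case using L' B_N[of i "case_nat x \<sigma>"] by (intro exI[of _ "?b # L'"] exI[of _ i1]) auto
qed

text \<open>Joint satisfiability as one formula in the concatenated blocks, the form in which
  \<open>mlist_lp\<close> can transfer it.\<close>

lemma jsat_fml:
  obtains \<theta> where "fml M N (l * n) \<theta>"
    "\<And>L. length L = l \<Longrightarrow> (\<forall>b\<in>set L. length b = n \<and> set b \<subseteq> dom M) \<Longrightarrow> holds M \<theta> (concat L) \<longleftrightarrow> jsat m \<phi> (set L)"
proof -
  define Q where "Q xs = jsat m \<phi> ((\<lambda>i. take n (drop (i * n) xs)) ` {..<l})" for xs
  let ?ts = "\<lambda>i. map (\<lambda>j. Inl (i * n + j) :: nat + 'a) [0..<n]"
  have "definable M N (\<lambda>e :: nat \<Rightarrow> 'a. jsat m \<phi> ((\<lambda>ts. map (case_sum e id) ts) ` ?ts ` {..<l}))"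
    by (rule definable_jsat[OF fml_\<phi>_over]) auto
  moreover have "(\<lambda>ts. map (case_sum e id) ts) ` ?ts ` {..<l} = (\<lambda>i. take n (drop (i * n) (map e [0..<l * n]))) ` {..<l}" for e :: "nat \<Rightarrow> 'a"
  proof -
    have "map (case_sum e id) (?ts i) = take n (drop (i * n) (map e [0..<l * n]))" if "i < l" for i
    proof -
      have "i * n + n \<le> l * n" using mult_le_mono1[of "Suc i" l n] that by simp
      moreover have "i * n \<le> l * n" using that by simp
      ultimately show ?thesis by (intro nth_equalityI) (auto simp del: mult_le_cancel2)
    qed
    then show ?thesis unfolding image_image by (intro image_cong) auto
  qed
  ultimately have "definable M N (\<lambda>e :: nat \<Rightarrow> 'a. Q (map e [0..<l * n]))" unfolding Q_def by simp
  then obtain \<theta> where \<theta>: "fml M N (l * n) \<theta>"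
    "\<And>xs. length xs = l * n \<Longrightarrow> set xs \<subseteq> dom M \<Longrightarrow> holds M \<theta> xs \<longleftrightarrow> Q xs"
    by (rule definable_imp_fml[OF dom_ne]) blast
  show ?thesis
  proof (rule that[OF \<theta>(1)])
    fix L assume L: "length L = l" "\<forall>b\<in>set L. length b = n \<and> set b \<subseteq> dom M"
    have "(\<lambda>i. take n (drop (i * n) (concat L))) ` {..<l} = (\<lambda>i. L ! i) ` {..<l}"
      using block_nth[of L n] L by (intro image_cong) auto
    also have "\<dots> = set L" using L(1) by (auto simp: set_conv_nth)
    finally have "Q (concat L) \<longleftrightarrow> jsat m \<phi> (set L)" unfolding Q_def by simp
    moreover have "length (concat L) = l * n" "set (concat L) \<subseteq> dom M"
      using length_concat_blocks[of L n] L by auto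
    ultimately show "holds M \<theta> (concat L) \<longleftrightarrow> jsat m \<phi> (set L)" using \<theta>(2) by simp
  qed
qed

lemma morley_J:
  assumes "morley M N n p bs" "finite J"
  obtains L where "mlist N n p L" "set L = bs ` J" "length L = card J"
proof (rule that[of "map bs (rev (sorted_list_of_set J))"])
  show "mlist N n p (map bs (rev (sorted_list_of_set J)))"
    by (rule morley_mlist[OF assms(1)]) simp
qed (use assms(2) in auto)

text \<open>If \<open>k\<close> members of the Morley sequence were jointly satisfiable, so would be
  a frozen list of length \<open>k\<close> in some \<open>U i\<close>. The weave of that stage
  forbids this, already with the empty comb.\<close>

lemma k_divides_up: "k_divides_along M N m \<phi> n (lp (True, False)) k"
proof -
  obtain bs where bs: "morley M N n (lp (True, False)) bs" using morley_exists[OF gtype_lp N_dom N_small] by blast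
  have "\<not> fam_sat M m \<phi> bs J" if J: "finite J" "card J = k" for J
  proof
    assume fs: "fam_sat M m \<phi> bs J"
    obtain L where L: "mlist N n (lp (True, False)) L" "set L = bs ` J" "length L = card J"
      using morley_J[OF bs J(1)] by blast
    obtain \<theta> where \<theta>: "fml M N (length L * n) \<theta>" "\<And>L'. length L' = length L \<Longrightarrow>
      (\<forall>b\<in>set L'. length b = n \<and> set b \<subseteq> dom M) \<Longrightarrow> holds M \<theta> (concat L') \<longleftrightarrow> jsat m \<phi> (set L')"
      by (rule jsat_fml[of "length L"]) blast
    have "holds M \<theta> (concat L)" using \<theta>(2)[of L] mlist_block[OF L(1)] fs L(2) by (simp add: fam_sat_jsat)
    moreover have "u @ [B i (case_nat (True, False) \<sigma>)] \<in> U (Suc i)" if "u \<in> U i" for i u \<sigma>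
      using stp[of i] that by (simp add: step_def)
    ultimately obtain L' i1 where L': "length L' = length L" "\<forall>b\<in>set L'. length b = n \<and> set b \<subseteq> N"
      "[] @ L' \<in> U i1" "holds M \<theta> (concat L')"
      using mlist_lp[of U "(True, False)", OF _ mono(3) L(1) \<theta>(1) _ start(1)] by blast
    have "jsat m \<phi> (set L')" using \<theta>(2)[OF L'(1)] L' N_dom by blast
    moreover have "\<not> jsat m \<phi> (set L' \<union> B i1 ` {})"
      using weave_B[of i1] L' L(3) J(2) unfolding wv_def by (metis UNIV_I add.right_neutral append_Nil card.empty)
    ultimately show False by simp
  qed
  then show ?thesis using bs unfolding k_divides_along_def fam_k_inconsistent_def by blast
qed

text \<open>Here the negated formula is reflected: an unsatisfiable part of the Morley sequence
  would yield an unsatisfiable frozen list in some \<open>R i\<close>.\<close>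

lemma not_divides_right: "\<not> divides_along M N m \<phi> n (lp (False, True))"
proof
  assume "divides_along M N m \<phi> n (lp (False, True))"
  then obtain bs J where bs: "morley M N n (lp (False, True)) bs" and J: "finite J" "\<not> fam_sat M m \<phi> bs J"
    unfolding divides_along_def fam_consistent_def by blast
  obtain L where L: "mlist N n (lp (False, True)) L" "set L = bs ` J" "length L = card J"
    using morley_J[OF bs J(1)] by blast
  obtain \<theta> where \<theta>: "fml M N (length L * n) \<theta>" "\<And>L'. length L' = length L \<Longrightarrow>
    (\<forall>b\<in>set L'. length b = n \<and> set b \<subseteq> dom M) \<Longrightarrow> holds M \<theta> (concat L') \<longleftrightarrow> jsat m \<phi> (set L')"
    by (rule jsat_fml[of "length L"]) blast
  have "holds M (Neg \<theta>) (concat L)" using \<theta>(2)[of L] mlist_block[OF L(1)] J(2) L(2) by (simp add: fam_sat_jsat)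
  moreover have "fml M N (length L * n) (Neg \<theta>)" using \<theta>(1) by simp
  moreover have "u @ [B i (case_nat (False, True) \<sigma>)] \<in> R (Suc i)" if "u \<in> R i" for i u \<sigma>
    using stp[of i] that by (simp add: step_def)
  ultimately obtain L' i1 where L': "length L' = length L" "\<forall>b\<in>set L'. length b = n \<and> set b \<subseteq> N"
    "[] @ L' \<in> R i1" "holds M (Neg \<theta>) (concat L')"
    using mlist_lp[of R "(False, True)", OF _ mono(4) L(1) _ _ start(2)] by blast
  have "\<not> jsat m \<phi> (set L')" using \<theta>(2)[OF L'(1)] L' N_dom by auto
  moreover have "jsat m \<phi> (set L' \<union> B i1 ` {})"
    using weave_B[of i1] L' unfolding wv_def by (metis UNIV_I append_Nil)
  ultimately show False by simp
qed

lemma not_kims_lemma: "\<not> kims_lemma M K True k (heir_coheir M) (heir_coheir M)"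
proof
  assume kl: "kims_lemma M K True k (heir_coheir M) (heir_coheir M)"
  obtain b where b: "realizes M n b (restr (lp (True, False)) N)" using gtype_realize[OF gtype_lp N_dom N_small] by blast
  have "N \<subseteq> dom M \<and> small K N \<and> (True \<longrightarrow> is_model M K N) \<and> fml M N (m + n) \<phi> \<and> length b = n \<and> set b \<subseteq> dom M \<and>
    gtype M n (lp (True, False)) \<and> gtype M n (lp (False, True)) \<and>
    tp M N b \<subseteq> lp (True, False) \<and> tp M N b \<subseteq> lp (False, True) \<and>
    heir_coheir M N n (lp (True, False)) \<and> heir_coheir M N n (lp (False, True)) \<and>
    k_divides_along M N m \<phi> n (lp (True, False)) k"
    using N_dom N_small N_model fml_\<phi>_over b gtype_lp lp_agree[OF b] heir_coheir_lp k_divides_up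
    by (auto simp: small_def realizes_def)
  then have "divides_along M N m \<phi> n (lp (False, True))"
    using kl[unfolded kims_lemma_def, rule_format, of N m n \<phi> b] by blast
  then show False using not_divides_right by blast
qed

end

end

lemma (in weave_model) weave_not_kims_lemma:
  assumes "weave {} {[]} {[]} B0"
  shows "\<not> kims_lemma M K True k (heir_coheir M) (heir_coheir M)"
proof -
  define st where "st = (\<lambda>(E, r, U, R). state E r U R)"
  define stp where "stp = (\<lambda>(E, r, U, R) (E', r', U', R'). \<exists>B. step E r U R E' r' U' R' B)"
  have s0: "state {} {} {[]} {[]}" using assms by (auto simp: state_def over_def large_def)
  \<comment> \<open>The invariant of the dependent choice depends on the index only to pin down the
    start, where nothing but the empty list is frozen.\<close>
  have "\<exists>f. \<forall>i. (st (f i) \<and> (i = 0 \<longrightarrow> f i = ({}, {}, {[]}, {[]}))) \<and> stp (f i) (f (Suc i))"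
  proof (rule dependent_nat_choice)
    show "\<exists>x. st x \<and> (0 = (0 :: nat) \<longrightarrow> x = ({}, {}, {[]}, {[]}))" using s0 by (auto simp: st_def)
    fix x and i :: nat assume "st x \<and> (i = 0 \<longrightarrow> x = ({}, {}, {[]}, {[]}))"
    moreover obtain E r U R where x: "x = (E, r, U, R)" by (cases x) auto
    ultimately have "state E r U R" by (simp add: st_def)
    then obtain E' r' U' R' B where "state E' r' U' R'" "step E r U R E' r' U' R' B" using step_exists by blast
    then have "st (E', r', U', R') \<and> stp x (E', r', U', R')" unfolding x st_def stp_def by auto
    then show "\<exists>y. (st y \<and> (Suc i = 0 \<longrightarrow> y = ({}, {}, {[]}, {[]}))) \<and> stp x y" by auto
  qed
  then obtain f where f: "\<And>i. st (f i)" "f 0 = ({}, {}, {[]}, {[]})" "\<And>i. stp (f i) (f (Suc i))" by auto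
  define E where "E i = fst (f i)" for i
  define r where "r i = fst (snd (f i))" for i
  define U where "U i = fst (snd (snd (f i)))" for i
  define R where "R i = snd (snd (snd (f i)))" for i
  have fi: "f i = (E i, r i, U i, R i)" for i by (simp add: E_def r_def U_def R_def)
  have "\<forall>i. \<exists>B. step (E i) (r i) (U i) (R i) (E (Suc i)) (r (Suc i)) (U (Suc i)) (R (Suc i)) B"
    using f(3) unfolding fi stp_def by simp
  then obtain B where B: "\<And>i. step (E i) (r i) (U i) (R i) (E (Suc i)) (r (Suc i)) (U (Suc i)) (R (Suc i)) (B i)"
    by metis
  have c: "weave_chain T M K \<phi> m n k \<Lambda> E r U R B"
  proof
    show "state (E i) (r i) (U i) (R i)" for i using f(1)[of i] by (simp add: fi st_def)
    show "[] \<in> U 0" "[] \<in> R 0" using f(2) by (auto simp: fi)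
  qed (rule B)
  obtain Uf where Uf: "ultra Uf" "Uf \<inter> sparse_ideal = {}" using ultra_avoiding_ideal[OF proper_sparse_ideal] by blast
  show ?thesis by (rule weave_chain.not_kims_lemma[OF c Uf])
qed

lemma (in monster_model) has_weave_not_kims_lemma:
  assumes "has_weave M k False"
  shows "\<not> kims_lemma M K True k (heir_coheir M) (heir_coheir M)"
proof -
  obtain m n \<phi> and bs :: "path \<Rightarrow> 'a list" where f: "fml M {} (m + n) \<phi>"
    and bs: "\<And>\<sigma>. length (bs \<sigma>) = n \<and> set (bs \<sigma>) \<subseteq> dom M"
    and u: "\<And>C. up_comb C \<Longrightarrow> fam_k_inconsistent M m \<phi> bs C k"
    and rc: "\<And>C. right_comb C \<Longrightarrow> fam_consistent M m \<phi> bs C"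
    using assms unfolding has_weave_def by blast
  have sF: "(UNIV :: 'f set) \<prec> K" and sR: "(UNIV :: 'r set) \<prec> K"
    using monster by (simp_all add: monster_def)
  obtain \<Lambda>1 :: "'a set" where 1: "\<Lambda>1 \<prec> K" "(UNIV :: 'f set) \<lesssim> \<Lambda>1" by (rule small_image[OF sF])
  obtain \<Lambda>2 :: "'a set" where 2: "\<Lambda>2 \<prec> K" "(UNIV :: 'r set) \<lesssim> \<Lambda>2" by (rule small_image[OF sR])
  obtain \<Lambda>3 :: "'a set" where 3: "\<Lambda>3 \<prec> K" "(UNIV :: (path \<times> nat) set) \<lesssim> \<Lambda>3" by (rule small_image[OF small_paths])
  \<comment> \<open>The parts bound the function symbols, the relation symbols and the paths; the
    last one also makes the union infinite.\<close>
  let ?\<Lambda> = "\<Lambda>1 \<union> \<Lambda>2 \<union> \<Lambda>3"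
  have sub: "\<Lambda>1 \<lesssim> ?\<Lambda>" "\<Lambda>2 \<lesssim> ?\<Lambda>" "\<Lambda>3 \<lesssim> ?\<Lambda>" by (auto intro: subset_imp_lepoll)
  have "(UNIV :: path set) \<lesssim> (UNIV :: (path \<times> nat) set)"
    unfolding lepoll_def by (intro exI[of _ "\<lambda>\<sigma>. (\<sigma>, 0)"]) (auto simp: inj_on_def)
  then have P: "(UNIV :: path set) \<lesssim> ?\<Lambda>" using 3(2) sub(3) by (meson lepoll_trans)
  have "(UNIV :: nat set) \<lesssim> (UNIV :: (path \<times> nat) set)"
    unfolding lepoll_def by (intro exI[of _ "\<lambda>i. (\<lambda>_. (True, True), i)"]) (auto simp: inj_on_def)
  then have "(UNIV :: nat set) \<lesssim> ?\<Lambda>" using 3(2) sub(3) by (meson lepoll_trans)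
  then have inf: "infinite ?\<Lambda>" by (simp only: infinite_le_lepoll)
  interpret weave_model T M K \<phi> m n k ?\<Lambda>
  proof
    show "fml M {} (m + n) \<phi>" by (rule f)
    show "infinite ?\<Lambda>" by (rule inf)
    show "?\<Lambda> \<prec> K" using 1(1) 2(1) 3(1) by (intro small_Un)
    show "(UNIV :: 'f set) \<lesssim> ?\<Lambda>" using 1(2) sub(1) by (rule lepoll_trans)
    show "(UNIV :: 'r set) \<lesssim> ?\<Lambda>" using 2(2) sub(2) by (rule lepoll_trans)
  qed (rule P)
  have "weave {} {[]} {[]} bs"
    unfolding wv_def
  proof (intro conjI allI ballI impI)
    fix \<sigma> show "length (bs \<sigma>) = n" "set (bs \<sigma>) \<subseteq> dom M" using bs by auto
  next
    fix u' C assume u': "u' \<in> {[] :: 'a list list}" and C: "(C = {} \<or> up_comb C) \<and> length u' + card C = k"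
    \<comment> \<open>The empty set is not a comb, but it lies in any singleton comb, and
      \<open>k\<close>-inconsistency passes to subsets.\<close>
    obtain C' where "C \<subseteq> C'" "up_comb C'" using C up_comb.single by blast
    moreover have "finite C" using C finite_up_comb by auto
    ultimately have "\<not> fam_sat M m \<phi> bs C" using u[of C'] C u' unfolding fam_k_inconsistent_def by simp
    then show "\<not> jsat m \<phi> (set u' \<union> bs ` C)" using u' by (simp add: fam_sat_jsat)
  next
    fix v C assume v: "v \<in> {[] :: 'a list list}" and C: "C = {} \<or> right_comb C"
    obtain C' where "C \<subseteq> C'" "right_comb C'" using C right_comb.single by blast
    moreover have "finite C" using C finite_right_comb by auto
    ultimately have "fam_sat M m \<phi> bs C" using rc[of C'] unfolding fam_consistent_def by simp
    then show "jsat m \<phi> (set v \<union> bs ` C)" using v by (simp add: fam_sat_jsat)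
  qed auto
  then show ?thesis by (rule weave_not_kims_lemma)
qed

section \<open>The cycle of implications between the five conditions\<close>

theorem theorem3p11:
  fixes T :: "('f, 'r, 'a) fm set" and M :: "('f, 'r, 'a) struc" and K :: "'a set" and k :: nat
  assumes "monster T M K"
  shows "(kims_lemma M K False k
            (\<lambda>A n p. bi_invariant M A n p \<or> semi_reliable M A n p)
            (\<lambda>A n p. bi_invariant M A n p \<or> semi_reliable M A n p)
          \<longleftrightarrow> kims_lemma M K False k (bi_invariant M) (bi_invariant M))
       \<and> (kims_lemma M K False k (bi_invariant M) (bi_invariant M)
          \<longleftrightarrow> kims_lemma M K True k (heir_coheir M) (heir_coheir M))
       \<and> (kims_lemma M K True k (heir_coheir M) (heir_coheir M)
          \<longleftrightarrow> \<not> has_weave M k False)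
       \<and> (\<not> has_weave M k False \<longleftrightarrow> \<not> has_weave M k True)"
proof -
  interpret monster_model T M K by (rule monster_model.intro[OF assms])
  let ?X = "\<lambda>A n p. bi_invariant M A n p \<or> semi_reliable M A n p"
  have 12: "kims_lemma M K False k (bi_invariant M) (bi_invariant M)" if kl: "kims_lemma M K False k ?X ?X"
    unfolding kims_lemma_def
  proof (intro allI impI, elim conjE)
    fix A m n \<phi> b p q
    assume *: "A \<subseteq> dom M" "small K A" "fml M A (m + n) \<phi>" "length b = n" "set b \<subseteq> dom M"
      "gtype M n p" "gtype M n q" "tp M A b \<subseteq> p" "tp M A b \<subseteq> q"
      "bi_invariant M A n p" "bi_invariant M A n q" "k_divides_along M A m \<phi> n p k"
    show "divides_along M A m \<phi> n q"
      using kl[unfolded kims_lemma_def, rule_format, of A m n \<phi> b p q] * by simp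
  qed
  have 23: "kims_lemma M K True k (heir_coheir M) (heir_coheir M)"
    if kl: "kims_lemma M K False k (bi_invariant M) (bi_invariant M)"
    unfolding kims_lemma_def
  proof (intro allI impI, elim conjE)
    fix A m n \<phi> b p q
    assume *: "A \<subseteq> dom M" "small K A" "fml M A (m + n) \<phi>" "length b = n" "set b \<subseteq> dom M"
      "gtype M n p" "gtype M n q" "tp M A b \<subseteq> p" "tp M A b \<subseteq> q"
      "heir_coheir M A n p" "heir_coheir M A n q" "k_divides_along M A m \<phi> n p k"
    show "divides_along M A m \<phi> n q"
      using kl[unfolded kims_lemma_def, rule_format, of A m n \<phi> b p q] *
        heir_coheir_bi_invariant[OF *(10,1)] heir_coheir_bi_invariant[OF *(11,1)] by simp
  qed
  have 34: "\<not> has_weave M k False" if "kims_lemma M K True k (heir_coheir M) (heir_coheir M)"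
    using that has_weave_not_kims_lemma by blast
  have 45: "has_weave M k False" if "has_weave M k True"
  proof -
    obtain m n \<phi> and bs :: "path \<Rightarrow> 'a list" where "fml M {} (m + n) \<phi>"
      "\<forall>\<sigma>. length (bs \<sigma>) = n \<and> set (bs \<sigma>) \<subseteq> dom M" "\<forall>C. up_comb C \<longrightarrow> fam_k_inconsistent M m \<phi> bs C k"
      "\<forall>C. right_comb C \<longrightarrow> fam_consistent M m \<phi> bs C"
      using \<open>has_weave M k True\<close> unfolding has_weave_def by blast
    then show ?thesis
      unfolding has_weave_def by (intro exI[of _ m] exI[of _ n] exI[of _ \<phi>] exI[of _ bs]) simp
  qed
  have 51: "kims_lemma M K False k ?X ?X" if "\<not> has_weave M k True"
    by (rule no_strong_weave_kims_lemma[OF that])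
  show ?thesis using 12 23 34 45 51 by argo
qed

end
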